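(* Suppose that: (i) $\sup_{k\ge1}\|\psi_k\|_\infty<\infty$; (ii) there are $\lambda\in\mathbb R$ and $K_0>0$, independent of $n$ and $p$, such that for all $n,p$ the matrix $\Psi\in\mathbb R^{p\times p}$, $\Psi_{k\ell}=\sum_{j=1}^n\psi_k(j/n)\psi_\ell(j/n)$, satisfies $|u^\top(\Psi-nI_p)u|\le K_0\sum_{k=1}^pk^\lambda u_k^2$ for all $u\in\mathbb R^p$; (iii) $\|\mathcal Rq_{\hat\theta}\|_\infty\le C_0$ for a constant $C_0$ independent of $n$ and $p$. Define $$S_{\mathtt p}(\gamma_0)=\sum_{k=1}^p\frac{n+k^{2\gamma_0+2\beta}}{n+k^{2\gamma+2\beta}},\qquad S_\tau(\gamma_0)=\Big(\sum_{k=1}^p\frac1{n+k^{2\gamma_0+2\beta}}\Big)^{1/2}.$$ Then there are constants $c,K>0$, depending only on the problem parameters (not on $n$, $p$, the data, or $\gamma_0$), such that for all $\gamma_0\le\gamma$ with $2\gamma_0+2\beta\ge\lambda$ and $S_\tau(\gamma_0)S_{\mathtt p}(\gamma_0)\le c$, it holds $$\mathrm{TV}(\pi_f,\gamma_f)\le K\,S_\tau(\gamma_0)\,S_{\mathtt p}(\gamma_0).$$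
   Context: Operator. $\mathcal R:E\to L^2[0,1]$ is a compact linear operator, $E$ a linear subspace of $L^2[0,1]$; $\phi_k$, $k\ge1$, is a complete orthonormal basis of $E$ of eigenfunctions of $\mathcal R^\top\mathcal R$ with eigenvalues $\lambda_1\ge\lambda_2\ge\dots>0$ satisfying $c'k^{-2\beta}\le\lambda_k\le C'k^{-2\beta}$ for all $k$ (constants $0<c'<C'$, $\beta\ge0$). Put $\psi_k=\mathcal R\phi_k/\sqrt{\lambda_k}$ (orthonormal in $L^2[0,1]$); these functions are taken to be defined pointwise on $[0,1]$, and $\|\cdot\|_\infty$ is the sup norm on $[0,1]$. Exponential family. $\rho(dy\mid s)=\exp(sy-h(s))\mu(dy)$, $y\in\mathcal Y\subset\mathbb R$, with $h(s)=\log\int e^{sy}\mu(dy)$ finite for all $s\in\mathbb R$; $h$ is infinitely differentiable and strictly convex with $h''>0$. Posterior. Given integers $n,p\ge1$ and data $Y_1,\dots,Y_n\in\mathcal Y$, for $\theta\in\mathbb R^p$ let $q_\theta=\sum_{k=1}^p\theta_k\phi_k$ and let $R\in\mathbb R^{n\times p}$, $R_{jk}=(\mathcal R\phi_k)(j/n)$, with rows $R_j^\top$, so $R_j^\top\theta=(\mathcal Rq_\theta)(j/n)$. Let $L(\theta)=\sum_{j=1}^n[h(R_j^\top\theta)-Y_jR_j^\top\theta]$, $G^2=\mathrm{diag}(k^{2\gamma})_{k=1}^p$ with $\gamma\ge0$, and $f(\theta)=L(\theta)+\frac12\|G\theta\|^2$, which is strongly convex with unique minimizer $\hat\theta$. Let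 $\pi_f\propto e^{-f}$ (the posterior) and $\gamma_f=\mathcal N(\hat\theta,\nabla^2f(\hat\theta)^{-1})$ (its Laplace approximation). $\mathrm{TV}$ is total variation distance, $\sup_A|\mu(A)-\nu(A)|$. "Problem parameters" means: the operator $\mathcal R$ (hence $\beta,c',C',\phi_k,\psi_k$), the function $h$, $\gamma$, $\lambda$, and the constants $K_0$, $C_0$, $\sup_k\|\psi_k\|_\infty$. The statement is for any $n,p$ and any data for which (iii) holds. *)

theory Defs
  imports "HOL-Analysis.Analysis"
begin

text \<open>The space \<open>L\<^sup>2[0,1]\<close> is represented by square-integrable functions with the
  associated semi-inner product; only the values on \<open>[0,1]\<close> matter, and equality of elements of
  \<open>L\<^sup>2\<close> is equality almost everywhere.\<close>

abbreviation I01 :: "real measure" where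
  "I01 \<equiv> lebesgue_on {0..1}"

definition L2 :: "(real \<Rightarrow> real) set" where
  "L2 = {f \<in> borel_measurable I01. integrable I01 (\<lambda>t. (f t)\<^sup>2)}"

definition L2_inner :: "(real \<Rightarrow> real) \<Rightarrow> (real \<Rightarrow> real) \<Rightarrow> real" where
  "L2_inner f g = (LINT t|I01. f t * g t)"

definition L2_norm :: "(real \<Rightarrow> real) \<Rightarrow> real" where
  "L2_norm f = sqrt (L2_inner f f)"

definition L2_subspace :: "(real \<Rightarrow> real) set \<Rightarrow> bool" where
  "L2_subspace E \<longleftrightarrow> E \<subseteq> L2 \<and> (\<lambda>t. 0) \<in> E \<and>
     (\<forall>f\<in>E. \<forall>g\<in>E. \<forall>a b. (\<lambda>t. a * f t + b * g t) \<in> E)"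

definition L2_linear :: "(real \<Rightarrow> real) set \<Rightarrow> ((real \<Rightarrow> real) \<Rightarrow> real \<Rightarrow> real) \<Rightarrow> bool" where
  "L2_linear E R \<longleftrightarrow> (\<forall>f\<in>E. R f \<in> L2) \<and>
     (\<forall>f\<in>E. \<forall>g\<in>E. \<forall>a b. AE t in I01. R (\<lambda>t. a * f t + b * g t) t = a * R f t + b * R g t)"

text \<open>Compatibility of \<open>R\<close> with equality almost everywhere need not be required: a compact linear
  operator is bounded for the \<open>L\<^sup>2\<close> seminorms.\<close>

definition compact_operator :: "(real \<Rightarrow> real) set \<Rightarrow> ((real \<Rightarrow> real) \<Rightarrow> real \<Rightarrow> real) \<Rightarrow> bool" where
  "compact_operator E R \<longleftrightarrow> L2_linear E R \<and>
     (\<forall>F :: nat \<Rightarrow> real \<Rightarrow> real. (\<forall>m. F m \<in> E) \<and> bounded (range (\<lambda>m. L2_norm (F m))) \<longrightarrow>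
        (\<exists>r g. strict_mono r \<and> g \<in> L2 \<and>
           (\<lambda>m. L2_norm (\<lambda>t. R (F (r m)) t - g t)) \<longlonglongrightarrow> 0))"

text \<open>The adjoint takes its values in the closure of \<open>E\<close> in \<open>L\<^sup>2\<close>, the Hilbert space in which \<open>E\<close>
  is dense (and \<open>E\<close> itself when \<open>E\<close> is closed). This determines it up to equality almost
  everywhere.\<close>

definition adjoint_operator ::
  "(real \<Rightarrow> real) set \<Rightarrow> ((real \<Rightarrow> real) \<Rightarrow> real \<Rightarrow> real) \<Rightarrow> ((real \<Rightarrow> real) \<Rightarrow> real \<Rightarrow> real) \<Rightarrow> bool" where
  "adjoint_operator E R Rt \<longleftrightarrow>
     (\<forall>g\<in>L2. Rt g \<in> L2 \<and> (\<forall>\<epsilon>>0. \<exists>e\<in>E. L2_norm (\<lambda>t. Rt g t - e t) < \<epsilon>) \<and>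
        (\<forall>f\<in>E. L2_inner (R f) g = L2_inner f (Rt g)))"

definition complete_orthonormal_basis ::
  "(real \<Rightarrow> real) set \<Rightarrow> (nat \<Rightarrow> real \<Rightarrow> real) \<Rightarrow> bool" where
  "complete_orthonormal_basis E \<phi> \<longleftrightarrow>
     (\<forall>k\<ge>1. \<phi> k \<in> E) \<and>
     (\<forall>k\<ge>1. \<forall>l\<ge>1. L2_inner (\<phi> k) (\<phi> l) = (if k = l then 1 else 0)) \<and>
     (\<forall>f\<in>E. (\<lambda>m. L2_norm (\<lambda>t. f t - (\<Sum>k=1..m. L2_inner f (\<phi> k) * \<phi> k t))) \<longlonglongrightarrow> 0)"

definition supnorm :: "(real \<Rightarrow> real) \<Rightarrow> ereal" where
  "supnorm g = (SUP t\<in>{0..1}. ereal \<bar>g t\<bar>)"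

definition psi :: "((real \<Rightarrow> real) \<Rightarrow> real \<Rightarrow> real) \<Rightarrow> (nat \<Rightarrow> real \<Rightarrow> real) \<Rightarrow> (nat \<Rightarrow> real)
    \<Rightarrow> nat \<Rightarrow> real \<Rightarrow> real" where
  "psi R \<phi> ev k t = R (\<phi> k) t / sqrt (ev k)"

definition qfun :: "(nat \<Rightarrow> real \<Rightarrow> real) \<Rightarrow> nat \<Rightarrow> (nat \<Rightarrow> real) \<Rightarrow> real \<Rightarrow> real" where
  "qfun \<phi> p \<theta> t = (\<Sum>k=1..p. \<theta> k * \<phi> k t)"

text \<open>Vectors in \<open>\<real>\<^sup>p\<close> are functions on \<open>{1..p}\<close>, and a \<open>p\<close> by \<open>p\<close> matrix is a function whose
  entries are only used at indices in \<open>{1..p}\<close>.\<close>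

definition quad_form :: "nat \<Rightarrow> (nat \<Rightarrow> nat \<Rightarrow> real) \<Rightarrow> (nat \<Rightarrow> real) \<Rightarrow> real" where
  "quad_form p A u = (\<Sum>k=1..p. \<Sum>l=1..p. u k * A k l * u l)"

definition id_mat :: "nat \<Rightarrow> nat \<Rightarrow> real" where
  "id_mat k l = (if k = l then 1 else 0)"

definition mat_inverses :: "nat \<Rightarrow> (nat \<Rightarrow> nat \<Rightarrow> real) \<Rightarrow> (nat \<Rightarrow> nat \<Rightarrow> real) \<Rightarrow> bool" where
  "mat_inverses p A B \<longleftrightarrow> (\<forall>i\<in>{1..p}. \<forall>k\<in>{1..p}.
     (\<Sum>j=1..p. A i j * B j k) = id_mat i k \<and> (\<Sum>j=1..p. B i j * A j k) = id_mat i k)"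

definition mat_inv :: "nat \<Rightarrow> (nat \<Rightarrow> nat \<Rightarrow> real) \<Rightarrow> nat \<Rightarrow> nat \<Rightarrow> real" where
  "mat_inv p A = (SOME B. mat_inverses p A B)"

definition Psi_mat :: "(nat \<Rightarrow> real \<Rightarrow> real) \<Rightarrow> nat \<Rightarrow> nat \<Rightarrow> nat \<Rightarrow> real" where
  "Psi_mat \<psi> n k l = (\<Sum>j=1..n. \<psi> k (real j / real n) * \<psi> l (real j / real n))"

definition partial :: "nat \<Rightarrow> ((nat \<Rightarrow> real) \<Rightarrow> real) \<Rightarrow> (nat \<Rightarrow> real) \<Rightarrow> real" where
  "partial k F \<theta> = deriv (\<lambda>s. F (\<theta>(k := s))) (\<theta> k)"

definition hessian :: "((nat \<Rightarrow> real) \<Rightarrow> real) \<Rightarrow> (nat \<Rightarrow> real) \<Rightarrow> nat \<Rightarrow> nat \<Rightarrow> real" where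
  "hessian F \<theta> k l = partial k (partial l F) \<theta>"

definition log_partition :: "real measure \<Rightarrow> real \<Rightarrow> real" where
  "log_partition \<mu> s = ln (LINT y|\<mu>. exp (s * y))"

text \<open>The second conjunct says that \<open>log_partition \<mu> s\<close> is the logarithm of a number in
  \<open>(0,\<infinity>)\<close>. The derivatives and strict convexity concern the function on all of \<open>\<real>\<close>.\<close>

definition exp_family :: "real set \<Rightarrow> real measure \<Rightarrow> bool" where
  "exp_family \<Y> \<mu> \<longleftrightarrow> sets \<mu> = sets (restrict_space borel \<Y>) \<and>
     (\<forall>s. integrable \<mu> (\<lambda>y. exp (s * y)) \<and> 0 < (LINT y|\<mu>. exp (s * y))) \<and>
     (\<forall>m s. (deriv ^^ m) (log_partition \<mu>) differentiable (at s)) \<and>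
     (\<forall>s t a. s \<noteq> t \<and> 0 < a \<and> a < 1 \<longrightarrow> log_partition \<mu> ((1 - a) * s + a * t)
         < (1 - a) * log_partition \<mu> s + a * log_partition \<mu> t) \<and>
     (\<forall>s. (deriv ^^ 2) (log_partition \<mu>) s > 0)"

definition design :: "((real \<Rightarrow> real) \<Rightarrow> real \<Rightarrow> real) \<Rightarrow> (nat \<Rightarrow> real \<Rightarrow> real) \<Rightarrow> nat
    \<Rightarrow> nat \<Rightarrow> nat \<Rightarrow> real" where
  "design R \<phi> n j k = R (\<phi> k) (real j / real n)"

definition neg_log_lik :: "(real \<Rightarrow> real) \<Rightarrow> (nat \<Rightarrow> nat \<Rightarrow> real) \<Rightarrow> nat \<Rightarrow> nat \<Rightarrow> (nat \<Rightarrow> real)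
    \<Rightarrow> (nat \<Rightarrow> real) \<Rightarrow> real" where
  "neg_log_lik h A n p Y \<theta> =
     (\<Sum>j=1..n. h (\<Sum>k=1..p. A j k * \<theta> k) - Y j * (\<Sum>k=1..p. A j k * \<theta> k))"

definition neg_log_post :: "(real \<Rightarrow> real) \<Rightarrow> (nat \<Rightarrow> nat \<Rightarrow> real) \<Rightarrow> real \<Rightarrow> nat \<Rightarrow> nat \<Rightarrow> (nat \<Rightarrow> real)
    \<Rightarrow> (nat \<Rightarrow> real) \<Rightarrow> real" where
  "neg_log_post h A \<gamma> n p Y \<theta> =
     neg_log_lik h A n p Y \<theta> + 1/2 * (\<Sum>k=1..p. real k powr (2 * \<gamma>) * (\<theta> k)\<^sup>2)"

abbreviation lborel_vec :: "nat \<Rightarrow> (nat \<Rightarrow> real) measure" where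
  "lborel_vec p \<equiv> PiM {1..p} (\<lambda>_. lborel)"

definition gibbs :: "nat \<Rightarrow> ((nat \<Rightarrow> real) \<Rightarrow> real) \<Rightarrow> (nat \<Rightarrow> real) measure" where
  "gibbs p V = density (lborel_vec p)
     (\<lambda>\<theta>. ennreal (exp (- V \<theta>) / (LINT \<eta>|lborel_vec p. exp (- V \<eta>))))"

text \<open>The normal distribution with mean \<open>m\<close> and (positive definite) covariance matrix \<open>S\<close>; the
  normalising integral is \<open>sqrt ((2 pi)^p * det S)\<close>.\<close>

definition gaussian :: "nat \<Rightarrow> (nat \<Rightarrow> real) \<Rightarrow> (nat \<Rightarrow> nat \<Rightarrow> real) \<Rightarrow> (nat \<Rightarrow> real) measure" where
  "gaussian p m S = gibbs p (\<lambda>\<theta>. 1/2 * quad_form p (mat_inv p S) (\<lambda>k. \<theta> k - m k))"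

definition laplace_approx :: "nat \<Rightarrow> ((nat \<Rightarrow> real) \<Rightarrow> real) \<Rightarrow> (nat \<Rightarrow> real) \<Rightarrow> (nat \<Rightarrow> real) measure" where
  "laplace_approx p F \<theta>h = gaussian p \<theta>h (mat_inv p (hessian F \<theta>h))"

definition total_variation :: "'a measure \<Rightarrow> 'a measure \<Rightarrow> real" where
  "total_variation M N = (SUP A\<in>sets M. \<bar>measure M A - measure N A\<bar>)"

definition S_p :: "real \<Rightarrow> real \<Rightarrow> nat \<Rightarrow> nat \<Rightarrow> real \<Rightarrow> real" where
  "S_p \<beta> \<gamma> n p \<gamma>0 = (\<Sum>k=1..p. (real n + real k powr (2 * \<gamma>0 + 2 * \<beta>))
                              / (real n + real k powr (2 * \<gamma> + 2 * \<beta>)))"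

definition S_tau :: "real \<Rightarrow> nat \<Rightarrow> nat \<Rightarrow> real \<Rightarrow> real" where
  "S_tau \<beta> n p \<gamma>0 = sqrt (\<Sum>k=1..p. 1 / (real n + real k powr (2 * \<gamma>0 + 2 * \<beta>)))"

end

(* Everything rests on the midpoint form of the Prekopa-Leindler inequality on R^p. With V0 the
   quadratic form of the Hessian at the mode, V1 = f - f(mode), and z the midpoint of x and y,
     V0 x + V1 y >= V0 z + V1 z - 2 eps(z),   eps ~ (S_tau * N2)^2,
   on a ball {N2 <= const / S_tau} of the weighted norm N2 = sum_k w_k (theta_k - mode_k)^2: the strong
   convexity of both potentials pays for the cross term, which is a third-order Taylor remainder.
   Prekopa-Leindler turns this into the integral of exp (- (V0 + V1) / 2 + eps) over the ball being at
   least the geometric mean of the two masses, i.e. a lower bound 1 - O((S_tau S_p)^2) on the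
   Hellinger affinity of the two truncated measures, and this bounds their total variation distance
   by O(S_tau S_p) without any dependence on p. Prekopa-Leindler also gives the moments of N2
   under the Gaussian, and a Borell-type inequality which controls the mass of exp (- V1) far away,
   where nothing but convexity is known. *)

theory Submission
  imports Defs "HOL-Probability.Distributions"
begin

section \<open>The Prekopa-Leindler inequality\<close>

text \<open>A direct expansion loses too much. A linear predictor moves by at most a constant times
  \<open>\<tau> * sqrt N2\<close>, and the squared moves sum to at most a constant times
  \<open>N2\<close>, so \<open>V1 - V0\<close> is only bounded by
  \<open>\<tau> * N2 powr (3/2)\<close>. As \<open>N2\<close> has size \<open>S\<close>, this
  exceeds \<open>t = \<tau> * S\<close> by a factor \<open>sqrt S\<close>. Comparing
  \<open>V0\<close> at \<open>x\<close> with \<open>V1\<close> at \<open>y\<close> leaves a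
  remainder linear in \<open>x - y\<close>; once strong convexity absorbs it, a square of size
  \<open>t^2\<close> is left, and an affinity defect of size \<open>t^2\<close> is a total variation
  of size \<open>t\<close>. The level \<open>r = \<kappa> / \<tau>\<close> is the scale of
  \<open>N2\<close> on which predictors still move by at most 1 and the error stays below 1. Since
  \<open>S / r = t / \<kappa>\<close>, a small \<open>t\<close> puts most of the mass in the ball.
  Moments are available for \<open>V0\<close> only, which is even and strongly convex. So the error
  is integrated against \<open>exp (- V0)\<close> alone, and the behaviour of
  \<open>exp (- V1)\<close> outside the ball is deduced from the comparison inside: closeness on the
  large ball \<open>T\<close> bounds the \<open>V1\<close>-mass of the shell between
  \<open>U\<close> and \<open>T\<close>, and convexity carries this outwards.\<close>

lemma lborel_halfsum_compact:
  fixes K L C :: "real set"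
  assumes "compact K" "compact L" "K \<noteq> {}" "L \<noteq> {}"
    and [measurable]: "C \<in> sets borel"
    and C: "\<And>x y. x \<in> K \<Longrightarrow> y \<in> L \<Longrightarrow> (x + y) / 2 \<in> C"
  shows "emeasure lborel K + emeasure lborel L \<le> 2 * emeasure lborel C"
proof -
  obtain k where k: "k \<in> K" "\<And>x. x \<in> K \<Longrightarrow> x \<le> k"
    using compact_attains_sup[OF assms(1,3)] by blast
  obtain l where l: "l \<in> L" "\<And>y. y \<in> L \<Longrightarrow> l \<le> y"
    using compact_attains_inf[OF assms(2,4)] by blast
  have [measurable]: "K \<in> sets borel" "L \<in> sets borel"
    using assms by (auto intro: borel_closed compact_imp_closed)
  have "emeasure lborel K = (\<integral>\<^sup>+x. indicator K x \<partial>lborel)" by simp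
  also have "\<dots> = 2 * (\<integral>\<^sup>+x. indicator K (- l + 2 * x) \<partial>lborel)"
    by (subst nn_integral_real_affine[where c=2 and t="-l"]) auto
  finally have K: "emeasure lborel K = 2 * (\<integral>\<^sup>+x. indicator K (- l + 2 * x) \<partial>lborel)" .
  have "emeasure lborel L = (\<integral>\<^sup>+x. indicator L x \<partial>lborel)" by simp
  also have "\<dots> = 2 * (\<integral>\<^sup>+x. indicator L (- k + 2 * x) \<partial>lborel)"
    by (subst nn_integral_real_affine[where c=2 and t="-k"]) auto
  finally have L: "emeasure lborel L = 2 * (\<integral>\<^sup>+x. indicator L (- k + 2 * x) \<partial>lborel)" .
  \<comment> \<open>\<open>(K + l) / 2\<close> lies to the left and \<open>(k + L) / 2\<close> to the right of \<open>(k + l) / 2\<close>.\<close>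
  have "(\<integral>\<^sup>+x. indicator K (- l + 2 * x) \<partial>lborel) + (\<integral>\<^sup>+x. indicator L (- k + 2 * x) \<partial>lborel)
      = (\<integral>\<^sup>+x. indicator K (- l + 2 * x) + indicator L (- k + 2 * x) \<partial>lborel)"
    by (rule nn_integral_add[symmetric]) auto
  also have "\<dots> \<le> (\<integral>\<^sup>+x. indicator C x \<partial>lborel)"
  proof (rule nn_integral_mono_AE)
    \<comment> \<open>The two translates can meet only in \<open>(k + l) / 2\<close>, a null set, so
      almost everywhere at most one of the indicators is 1.\<close>
    show "AE x in lborel. indicator K (- l + 2 * x) + indicator L (- k + 2 * x) \<le> (indicator C x :: ennreal)"
      using AE_lborel_singleton[of "(k + l) / 2"]
    proof eventually_elim
      case (elim x)
      have 1: "x \<in> C" if "- l + 2 * x \<in> K" using C[OF that l(1)] by simp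
      have 2: "x \<in> C" if "- k + 2 * x \<in> L" using C[OF k(1) that] by simp
      have 3: "\<not> (- l + 2 * x \<in> K \<and> - k + 2 * x \<in> L)"
        using k(2)[of "- l + 2 * x"] l(2)[of "- k + 2 * x"] elim by auto
      show ?case using 1 2 3 by (auto simp: indicator_def)
    qed
  qed
  finally have "(\<integral>\<^sup>+x. indicator K (- l + 2 * x) \<partial>lborel) + (\<integral>\<^sup>+x. indicator L (- k + 2 * x) \<partial>lborel)
     \<le> emeasure lborel C" by simp
  then show ?thesis unfolding K L distrib_left[symmetric] by (intro mult_left_mono) auto
qed

text \<open>Inner regularity, with a point of \<open>A\<close> thrown in so that the compact set
  stays nonempty even if \<open>A\<close> is null: the half-sum inequality fails for empty
  sets.\<close>

lemma lborel_bounded_inner_compact: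
  fixes A :: "real set"
  assumes [measurable]: "A \<in> sets borel" and "bounded A" "A \<noteq> {}" "e > 0"
  obtains K where "compact K" "K \<subseteq> A" "K \<noteq> {}" "emeasure lborel A \<le> emeasure lborel K + ennreal e"
proof -
  obtain a where a: "a \<in> A" using assms by auto
  have "A \<in> sets lebesgue" by simp
  from sets_lebesgue_inner_closed[OF this \<open>e > 0\<close>] obtain T where
    T: "closed T" "T \<subseteq> A" "A - T \<in> lmeasurable" "emeasure lebesgue (A - T) < ennreal e" by metis
  have [measurable]: "T \<in> sets borel" using T by auto
  let ?K = "insert a T"
  have "emeasure lborel A \<le> emeasure lborel (?K \<union> (A - T))"
    by (rule emeasure_mono) auto
  also have "\<dots> \<le> emeasure lborel ?K + emeasure lborel (A - T)"
    by (rule emeasure_subadditive) auto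
  also have "emeasure lborel (A - T) = emeasure lebesgue (A - T)" by simp
  finally have 1: "emeasure lborel A \<le> emeasure lborel ?K + ennreal e"
    using T(4) by (meson add_left_mono order_trans less_imp_le)
  have "closed ?K" using T(1) by auto
  moreover have "bounded ?K" using T(2) a assms(2) by (meson bounded_subset insert_subset)
  ultimately have "compact ?K" by (simp add: compact_eq_bounded_closed)
  then show ?thesis using that[of ?K] 1 a T(2) by auto
qed

text \<open>The one-dimensional Brunn-Minkowski inequality. \<open>C\<close> is any Borel superset
  of the half-sum set, which itself need not be Borel. Compact inner approximations supply the
  extreme points on which the compact case relies.\<close>

lemma lborel_halfsum:
  fixes A B C :: "real set"
  assumes [measurable]: "A \<in> sets borel" "B \<in> sets borel" "C \<in> sets borel"
    and "bounded A" "bounded B" "A \<noteq> {}" "B \<noteq> {}"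
    and C: "\<And>x y. x \<in> A \<Longrightarrow> y \<in> B \<Longrightarrow> (x + y) / 2 \<in> C"
  shows "emeasure lborel A + emeasure lborel B \<le> 2 * emeasure lborel C"
proof (rule ennreal_le_epsilon)
  fix e :: real assume e: "0 < e"
  obtain K where K: "compact K" "K \<subseteq> A" "K \<noteq> {}" "emeasure lborel A \<le> emeasure lborel K + ennreal (e/2)"
    using lborel_bounded_inner_compact[of A "e/2"] assms e by auto
  obtain L where L: "compact L" "L \<subseteq> B" "L \<noteq> {}" "emeasure lborel B \<le> emeasure lborel L + ennreal (e/2)"
    using lborel_bounded_inner_compact[of B "e/2"] assms e by auto
  have "emeasure lborel A + emeasure lborel B \<le> (emeasure lborel K + ennreal (e/2)) + (emeasure lborel L + ennreal (e/2))"
    using K L by (intro add_mono) auto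
  also have "\<dots> = (emeasure lborel K + emeasure lborel L) + (ennreal (e/2) + ennreal (e/2))"
    by (simp add: ac_simps)
  also have "ennreal (e/2) + ennreal (e/2) = ennreal e" using e by (simp flip: ennreal_plus)
  also have "emeasure lborel K + emeasure lborel L \<le> 2 * emeasure lborel C"
    by (rule lborel_halfsum_compact) (use K L C in auto)
  finally show "emeasure lborel A + emeasure lborel B \<le> 2 * emeasure lborel C + ennreal e" by (simp add: add_right_mono)
qed

section \<open>From sets to functions on the real line\<close>

lemma nn_integral_layer_cake:
  fixes f :: "real \<Rightarrow> real"
  assumes [measurable]: "f \<in> borel_measurable borel" and "\<And>x. 0 \<le> f x"
  shows "(\<integral>\<^sup>+x. ennreal (f x) \<partial>lborel) = (\<integral>\<^sup>+s. indicator {0..} s * emeasure lborel {x. s < f x} \<partial>lborel)"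
proof -
  have "(\<integral>\<^sup>+x. ennreal (f x) \<partial>lborel) = (\<integral>\<^sup>+x. \<integral>\<^sup>+s. indicator {0..} s * indicator {x. s < f x} x \<partial>lborel \<partial>lborel)"
  proof (rule nn_integral_cong)
    fix x
    have "(\<integral>\<^sup>+s. indicator {0..} s * indicator {x. s < f x} x \<partial>lborel) = (\<integral>\<^sup>+s. indicator {0..<f x} s \<partial>lborel)"
      by (rule nn_integral_cong) (auto simp: indicator_def)
    also have "\<dots> = ennreal (f x)" using assms(2)[of x] by simp
    finally show "ennreal (f x) = (\<integral>\<^sup>+s. indicator {0..} s * indicator {x. s < f x} x \<partial>lborel)" by simp
  qed
  also have "\<dots> = (\<integral>\<^sup>+s. \<integral>\<^sup>+x. indicator {0..} s * indicator {x. s < f x} x \<partial>lborel \<partial>lborel)"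
  proof (rule lborel_pair.Fubini')
    have "(\<lambda>(s, x). indicator {0..} s * (if s < f x then 1 else 0 :: ennreal)) \<in> borel_measurable (lborel \<Otimes>\<^sub>M lborel)"
      by measurable
    then show "(\<lambda>(s, x). indicator {0..} s * indicator {x. s < f x} x :: ennreal) \<in> borel_measurable (lborel \<Otimes>\<^sub>M lborel)"
      by (simp add: indicator_def case_prod_unfold of_bool_def)
  qed
  also have "\<dots> = (\<integral>\<^sup>+s. indicator {0..} s * emeasure lborel {x. s < f x} \<partial>lborel)"
  proof (rule nn_integral_cong)
    fix s
    have "{x. s < f x} \<in> sets borel" by measurable
    then show "(\<integral>\<^sup>+x. indicator {0..} s * indicator {x. s < f x} x \<partial>lborel) = indicator {0..} s * emeasure lborel {x. s < f x}"
      by (subst nn_integral_cmult) auto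
  qed
  finally show ?thesis .
qed

lemma ennreal_amgm:
  fixes u v w :: ennreal
  assumes "u + v \<le> 2 * w"
  shows "u * v \<le> w\<^sup>2"
proof (cases "w = top")
  case False
  then obtain w' where w: "w = ennreal w'" "0 \<le> w'" by (cases w) auto
  have "u + v < top" using assms w
    by (metis (no_types, lifting) ennreal_less_top ennreal_mult_less_top ennreal_numeral order_le_less_trans)
  then obtain u' v' where uv: "u = ennreal u'" "0 \<le> u'" "v = ennreal v'" "0 \<le> v'"
    by (cases u; cases v) auto
  have "ennreal (u' + v') \<le> ennreal (2 * w')"
    using assms by (simp add: w uv ennreal_mult)
  then have le: "u' + v' \<le> 2 * w'" using w by (simp add: ennreal_le_iff)
  have "4 * (u' * v') \<le> (u' + v')\<^sup>2"
    using zero_le_power2[of "u' - v'"] by (simp add: power2_eq_square algebra_simps)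
  also have "\<dots> \<le> (2 * w')\<^sup>2" using le uv by (intro power_mono) auto
  finally have "u' * v' \<le> w'\<^sup>2" by (simp add: power2_eq_square)
  then have "ennreal (u' * v') \<le> ennreal (w'\<^sup>2)" by (rule ennreal_leI)
  then show ?thesis using uv w by (simp add: ennreal_mult ennreal_power)
qed simp

text \<open>Brunn-Minkowski is applied to superlevel sets and integrated over the level. It needs
  both sets nonempty, hence the normalisation by the suprema: afterwards both are nonempty at every
  level in \<open>{0..<1}\<close> and empty from 1 on. The result bounds the arithmetic mean of the
  integrals, which dominates the geometric one.\<close>

lemma prekopa_leindler_real_bounded:
  fixes a b c :: "real \<Rightarrow> real"
  assumes [measurable]: "a \<in> borel_measurable borel" "b \<in> borel_measurable borel" "c \<in> borel_measurable borel"
    and nn: "\<And>x. 0 \<le> a x" "\<And>x. 0 \<le> b x" "\<And>x. 0 \<le> c x"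
    and bd: "bdd_above (range a)" "bdd_above (range b)"
    and supp: "bounded {x. 0 < a x}" "bounded {x. 0 < b x}"
    and le: "\<And>x y. a x * b y \<le> (c ((x + y) / 2))\<^sup>2"
  shows "(\<integral>\<^sup>+x. ennreal (a x) \<partial>lborel) * (\<integral>\<^sup>+x. ennreal (b x) \<partial>lborel) \<le> (\<integral>\<^sup>+x. ennreal (c x) \<partial>lborel)\<^sup>2"
proof (cases "(\<forall>x. a x = 0) \<or> (\<forall>x. b x = 0)")
  case True
  then show ?thesis by auto
next
  case False
  define \<alpha> where "\<alpha> = Sup (range a)"
  define \<beta> where "\<beta> = Sup (range b)"
  have a_le: "a x \<le> \<alpha>" for x unfolding \<alpha>_def using bd by (intro cSup_upper) auto
  have b_le: "b x \<le> \<beta>" for x unfolding \<beta>_def using bd by (intro cSup_upper) auto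
  have \<alpha>: "\<alpha> > 0" using False a_le nn by (metis less_le_trans order_less_le)
  have \<beta>: "\<beta> > 0" using False b_le nn by (metis less_le_trans order_less_le)
  \<comment> \<open>The scaling of \<open>c\<close> under which the hypothesis becomes the same
    inequality for the normalised functions.\<close>
  define g where "g = sqrt (\<alpha> * \<beta>)"
  have g: "g > 0" "g\<^sup>2 = \<alpha> * \<beta>" unfolding g_def using \<alpha> \<beta> by auto
  let ?a = "\<lambda>x. a x / \<alpha>" and ?b = "\<lambda>x. b x / \<beta>" and ?c = "\<lambda>x. c x / g"
  have level: "emeasure lborel {x. s < ?a x} + emeasure lborel {x. s < ?b x} \<le> 2 * emeasure lborel {x. s < ?c x}"
    if s: "0 \<le> s" "s < 1" for s
  proof (rule lborel_halfsum)
    have "s * \<alpha> < Sup (range a)" using s \<alpha> unfolding \<alpha>_def[symmetric] by simp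
    then obtain x where "s * \<alpha> < a x" using less_cSupD[of "range a" "s * \<alpha>"] by auto
    then show "{x. s < ?a x} \<noteq> {}" using \<alpha> by (auto simp: field_simps)
    have "s * \<beta> < Sup (range b)" using s \<beta> unfolding \<beta>_def[symmetric] by simp
    then obtain x where "s * \<beta> < b x" using less_cSupD[of "range b" "s * \<beta>"] by auto
    then show "{x. s < ?b x} \<noteq> {}" using \<beta> by (auto simp: field_simps)
    have pa: "0 < a x" if "s < ?a x" for x
      using that s \<alpha> by (metis divide_eq_0_iff less_eq_real_def nn(1) not_le)
    have pb: "0 < b x" if "s < ?b x" for x
      using that s \<beta> by (metis divide_eq_0_iff less_eq_real_def nn(2) not_le)
    show "bounded {x. s < ?a x}" by (rule bounded_subset[OF supp(1)]) (use pa in auto)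
    show "bounded {x. s < ?b x}" by (rule bounded_subset[OF supp(2)]) (use pb in auto)
    fix x y assume xy: "x \<in> {x. s < ?a x}" "y \<in> {x. s < ?b x}"
    have "s\<^sup>2 * g\<^sup>2 = (s * \<alpha>) * (s * \<beta>)" unfolding g(2) by (simp add: power2_eq_square)
    also have "\<dots> < a x * b y"
      using xy \<alpha> \<beta> s by (intro mult_strict_mono) (auto simp: field_simps intro: le_less_trans[of 0 "\<beta> * s"] le_less_trans[of 0 "\<alpha> * s"])
    also have "\<dots> \<le> (c ((x + y) / 2))\<^sup>2" by (rule le)
    finally have "(s * g)\<^sup>2 < (c ((x + y) / 2))\<^sup>2" by (simp add: power_mult_distrib)
    then have "s * g < c ((x + y) / 2)" by (rule power2_less_imp_less) (rule nn)
    then show "(x + y) / 2 \<in> {x. s < ?c x}" using g by (simp add: field_simps)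
  qed measurable
  have [measurable]: "(\<lambda>s. emeasure lborel {x. s < f x}) \<in> borel_measurable borel"
    if [measurable]: "f \<in> borel_measurable borel" for f :: "real \<Rightarrow> real"
  proof -
    have "(\<lambda>s. \<integral>\<^sup>+x. (if s < f x then 1 else 0) \<partial>lborel) \<in> borel_measurable borel" by measurable
    moreover have "(\<integral>\<^sup>+x. (if s < f x then 1 else 0) \<partial>lborel) = emeasure lborel {x. s < f x}" for s
    proof -
      have "{x. s < f x} \<in> sets lborel" by measurable
      from nn_integral_indicator[OF this] show ?thesis
        by (simp add: indicator_def of_bool_def)
    qed
    ultimately show ?thesis by simp
  qed
  have ca: "(\<integral>\<^sup>+x. ennreal (?a x) \<partial>lborel) = (\<integral>\<^sup>+s. indicator {0..} s * emeasure lborel {x. s < ?a x} \<partial>lborel)"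
    by (rule nn_integral_layer_cake) (use nn \<alpha> in auto)
  have cb: "(\<integral>\<^sup>+x. ennreal (?b x) \<partial>lborel) = (\<integral>\<^sup>+s. indicator {0..} s * emeasure lborel {x. s < ?b x} \<partial>lborel)"
    by (rule nn_integral_layer_cake) (use nn \<beta> in auto)
  have cc: "(\<integral>\<^sup>+x. ennreal (?c x) \<partial>lborel) = (\<integral>\<^sup>+s. indicator {0..} s * emeasure lborel {x. s < ?c x} \<partial>lborel)"
    by (rule nn_integral_layer_cake) (use nn g in auto)
  have a1: "?a x \<le> 1" and b1: "?b x \<le> 1" for x using a_le b_le \<alpha> \<beta> by auto
  have "(\<integral>\<^sup>+x. ennreal (?a x) \<partial>lborel) + (\<integral>\<^sup>+x. ennreal (?b x) \<partial>lborel) =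
     (\<integral>\<^sup>+s. indicator {0..} s * emeasure lborel {x. s < ?a x} + indicator {0..} s * emeasure lborel {x. s < ?b x} \<partial>lborel)"
    unfolding ca cb by (rule nn_integral_add[symmetric]) measurable
  also have "\<dots> \<le> (\<integral>\<^sup>+s. 2 * (indicator {0..} s * emeasure lborel {x. s < ?c x}) \<partial>lborel)"
  proof (rule nn_integral_mono)
    fix s :: real
    consider "s < 0" | "0 \<le> s" "s < 1" | "1 \<le> s" by linarith
    then show "indicator {0..} s * emeasure lborel {x. s < ?a x} + indicator {0..} s * emeasure lborel {x. s < ?b x}
      \<le> 2 * (indicator {0..} s * emeasure lborel {x. s < ?c x})"
    proof cases
      case 2 then show ?thesis using level[of s] by simp
    next
      case 3
      then have "{x. s < ?a x} = {}" "{x. s < ?b x} = {}"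
        using a1 b1 by (smt (verit) Collect_empty_eq)+
      then show ?thesis by simp
    qed simp
  qed
  also have "\<dots> = 2 * (\<integral>\<^sup>+x. ennreal (?c x) \<partial>lborel)"
    unfolding cc by (rule nn_integral_cmult) measurable
  finally have *: "(\<integral>\<^sup>+x. ennreal (?a x) \<partial>lborel) * (\<integral>\<^sup>+x. ennreal (?b x) \<partial>lborel) \<le> (\<integral>\<^sup>+x. ennreal (?c x) \<partial>lborel)\<^sup>2"
    by (rule ennreal_amgm)
  have sc: "(\<integral>\<^sup>+x. ennreal (f x) \<partial>lborel) = ennreal r * (\<integral>\<^sup>+x. ennreal (f x / r) \<partial>lborel)"
    if [measurable]: "f \<in> borel_measurable borel" and "r > 0" "\<And>x. 0 \<le> f x" for f :: "real \<Rightarrow> real" and r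
    using that by (subst nn_integral_cmult[symmetric]) (auto simp flip: ennreal_mult)
  have "(\<integral>\<^sup>+x. ennreal (a x) \<partial>lborel) * (\<integral>\<^sup>+x. ennreal (b x) \<partial>lborel)
     = (ennreal \<alpha> * ennreal \<beta>) * ((\<integral>\<^sup>+x. ennreal (?a x) \<partial>lborel) * (\<integral>\<^sup>+x. ennreal (?b x) \<partial>lborel))"
    by (subst sc[of a \<alpha>], (use \<alpha> nn in auto)[3], subst sc[of b \<beta>], (use \<beta> nn in auto)[3], simp add: ac_simps)
  also have "\<dots> \<le> (ennreal \<alpha> * ennreal \<beta>) * (\<integral>\<^sup>+x. ennreal (?c x) \<partial>lborel)\<^sup>2"
    by (rule mult_left_mono[OF *]) simp
  also have "ennreal \<alpha> * ennreal \<beta> = (ennreal g)\<^sup>2"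
    using g \<alpha> \<beta> by (simp add: ennreal_power flip: ennreal_mult)
  also have "(ennreal g)\<^sup>2 * (\<integral>\<^sup>+x. ennreal (?c x) \<partial>lborel)\<^sup>2 = (\<integral>\<^sup>+x. ennreal (c x) \<partial>lborel)\<^sup>2"
    by (subst sc[of c g], (use g nn in auto)[3], simp add: power_mult_distrib)
  finally show ?thesis .
qed

lemma ennreal_SUP_mult_le:
  fixes f g :: "nat \<Rightarrow> ennreal"
  assumes "incseq f" "incseq g" "\<And>n. f n * g n \<le> K"
  shows "(SUP n. f n) * (SUP n. g n) \<le> K"
proof -
  have "(SUP n. f n) * (SUP n. g n) = (SUP n. SUP m. f m * g n)"
    by (simp add: SUP_mult_left_ennreal SUP_mult_right_ennreal)
  also have "\<dots> \<le> K"
  proof (intro SUP_least)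
    fix n m
    have "f m * g n \<le> f (max m n) * g (max m n)"
      using assms by (intro mult_mono) (auto simp: incseq_def)
    also have "\<dots> \<le> K" by (rule assms)
    finally show "f m * g n \<le> K" .
  qed
  finally show ?thesis .
qed

text \<open>Boundedness and bounded support are removed by monotone truncation of \<open>a\<close>
  and \<open>b\<close>.\<close>

lemma prekopa_leindler_real:
  fixes a b c :: "real \<Rightarrow> ennreal"
  assumes [measurable]: "a \<in> borel_measurable borel" "b \<in> borel_measurable borel" "c \<in> borel_measurable borel"
    and le: "\<And>x y. a x * b y \<le> (c ((x + y) / 2))\<^sup>2"
  shows "(\<integral>\<^sup>+x. a x \<partial>lborel) * (\<integral>\<^sup>+x. b x \<partial>lborel) \<le> (\<integral>\<^sup>+x. c x \<partial>lborel)\<^sup>2"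
proof -
  define tr :: "(real \<Rightarrow> ennreal) \<Rightarrow> nat \<Rightarrow> real \<Rightarrow> ennreal"
    where "tr f n x = indicator {- real n..real n} x * min (f x) (of_nat n)" for f n x
  have [measurable]: "tr f n \<in> borel_measurable borel" if [measurable]: "f \<in> borel_measurable borel" for f n
    unfolding tr_def by measurable
  have inc: "incseq (tr f)" for f
    unfolding tr_def incseq_def le_fun_def
    by (auto simp: indicator_def intro!: min.mono intro: min.coboundedI2)
  have sup: "(SUP n. tr f n x) = f x" for f x
  proof (rule antisym)
    show "(SUP n. tr f n x) \<le> f x"
      by (intro SUP_least) (auto simp: tr_def indicator_def)
    show "f x \<le> (SUP n. tr f n x)"
    proof (rule dense_le)
      fix y assume "y < f x"
      then have "y < top" by (metis less_top order_less_trans top.not_eq_extremum)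
      then obtain y' where y': "y = ennreal y'" "0 \<le> y'" by (cases y) auto
      obtain n :: nat where n: "max \<bar>x\<bar> y' \<le> real n" using real_arch_simple by blast
      have "y \<le> tr f n x"
        unfolding tr_def using n y' \<open>y < f x\<close>
        by (auto simp: indicator_def ennreal_of_nat_eq_real_of_nat abs_le_iff)
      then show "y \<le> (SUP n. tr f n x)" by (meson SUP_upper2 UNIV_I)
    qed
  qed
  have int: "(\<integral>\<^sup>+x. f x \<partial>lborel) = (SUP n. \<integral>\<^sup>+x. tr f n x \<partial>lborel)"
    if [measurable]: "f \<in> borel_measurable borel" for f
    using nn_integral_monotone_convergence_SUP[OF inc[of f], where M=lborel] by (simp add: sup)
  have inci: "incseq (\<lambda>n. \<integral>\<^sup>+x. tr f n x \<partial>lborel)" for f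
    using inc[of f] by (auto simp: incseq_def le_fun_def intro!: nn_integral_mono)
  have fin: "tr f n x = ennreal (enn2real (tr f n x))" "tr f n x \<le> of_nat n" for f n x
  proof -
    show "tr f n x \<le> of_nat n" unfolding tr_def by (auto simp: indicator_def)
    then show "tr f n x = ennreal (enn2real (tr f n x))"
      by (metis ennreal_enn2real ennreal_of_nat_eq_real_of_nat ennreal_less_top order_le_less_trans)
  qed
  have bound: "enn2real (tr f n x) \<le> real n" for f n x
    using fin(2)[of f n x] by (metis enn2real_leI ennreal_of_nat_eq_real_of_nat of_nat_0_le_iff)
  have "(\<integral>\<^sup>+x. tr a n x \<partial>lborel) * (\<integral>\<^sup>+x. tr b n x \<partial>lborel) \<le> (\<integral>\<^sup>+x. c x \<partial>lborel)\<^sup>2" for n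
  proof -
    \<comment> \<open>Capping \<open>c\<close> at \<open>n\<close> makes it finite and preserves the
      hypothesis, because both truncated factors are at most \<open>n\<close>.\<close>
    define c' where "c' x = min (c x) (of_nat n)" for x
    have [measurable]: "c' \<in> borel_measurable borel" unfolding c'_def by measurable
    have c'fin: "c' x = ennreal (enn2real (c' x))" for x
      unfolding c'_def by (metis ennreal_enn2real ennreal_of_nat_eq_real_of_nat ennreal_less_top min_less_iff_disj)
    have "(\<integral>\<^sup>+x. ennreal (enn2real (tr a n x)) \<partial>lborel) * (\<integral>\<^sup>+x. ennreal (enn2real (tr b n x)) \<partial>lborel)
      \<le> (\<integral>\<^sup>+x. ennreal (enn2real (c' x)) \<partial>lborel)\<^sup>2"
    proof (rule prekopa_leindler_real_bounded)
      show "bdd_above (range (\<lambda>x. enn2real (tr a n x)))" "bdd_above (range (\<lambda>x. enn2real (tr b n x)))"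
        using bound by (auto intro!: bdd_aboveI)
      have "{x. 0 < enn2real (tr f n x)} \<subseteq> {- real n..real n}" for f
        by (auto simp: tr_def indicator_def split: if_splits)
      then show "bounded {x. 0 < enn2real (tr a n x)}" "bounded {x. 0 < enn2real (tr b n x)}"
        by (meson bounded_closed_interval bounded_subset)+
      fix x y
      have "tr a n x * tr b n y \<le> a x * b y"
        unfolding tr_def by (intro mult_mono) (auto simp: indicator_def)
      also note le[of x y]
      finally have 1: "tr a n x * tr b n y \<le> (c ((x + y) / 2))\<^sup>2" .
      have 2: "tr a n x * tr b n y \<le> (of_nat n)\<^sup>2"
        unfolding power2_eq_square by (intro mult_mono fin) auto
      have "tr a n x * tr b n y \<le> (c' ((x + y) / 2))\<^sup>2"
        unfolding c'_def using 1 2 by (cases "c ((x + y) / 2) \<le> of_nat n") (auto simp: min_def)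
      then have "ennreal (enn2real (tr a n x) * enn2real (tr b n y)) \<le> ennreal ((enn2real (c' ((x + y) / 2)))\<^sup>2)"
        using fin(1)[of a n x] fin(1)[of b n y] c'fin[of "(x + y) / 2"]
        by (metis enn2real_nonneg ennreal_mult' ennreal_power)
      then show "enn2real (tr a n x) * enn2real (tr b n y) \<le> (enn2real (c' ((x + y) / 2)))\<^sup>2"
        by (simp add: ennreal_le_iff)
    qed auto
    also have "\<dots> = (\<integral>\<^sup>+x. c' x \<partial>lborel)\<^sup>2" by (simp flip: c'fin)
    also have "\<dots> \<le> (\<integral>\<^sup>+x. c x \<partial>lborel)\<^sup>2"
      by (intro power_mono nn_integral_mono) (auto simp: c'_def)
    finally show ?thesis by (simp flip: fin(1))
  qed
  from ennreal_SUP_mult_le[OF inci inci this] show ?thesis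
    by (simp add: int)
qed

section \<open>Induction on the dimension\<close>

interpretation lborel_product: product_sigma_finite "\<lambda>_::nat. lborel :: real measure"
  by standard

abbreviation midpt :: "nat set \<Rightarrow> (nat \<Rightarrow> real) \<Rightarrow> (nat \<Rightarrow> real) \<Rightarrow> nat \<Rightarrow> real" where
  "midpt I x y \<equiv> (\<lambda>k\<in>I. (x k + y k) / 2)"

text \<open>The one-dimensional inequality on the fibres over \<open>x\<close>, \<open>x'\<close>
  and their midpoint shows that the marginals satisfy the hypothesis in one dimension less. Points
  of the product space are \<open>undefined\<close> off \<open>I\<close>, which is why
  \<open>midpt\<close> restricts.\<close>

theorem prekopa_leindler:
  fixes a b c :: "(nat \<Rightarrow> real) \<Rightarrow> ennreal"
  assumes "finite I"
    and "a \<in> borel_measurable (PiM I (\<lambda>_. lborel))" "b \<in> borel_measurable (PiM I (\<lambda>_. lborel))"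
      "c \<in> borel_measurable (PiM I (\<lambda>_. lborel))"
    and "\<And>x y. x \<in> space (PiM I (\<lambda>_. lborel)) \<Longrightarrow> y \<in> space (PiM I (\<lambda>_. lborel)) \<Longrightarrow> a x * b y \<le> (c (midpt I x y))\<^sup>2"
  shows "(\<integral>\<^sup>+x. a x \<partial>PiM I (\<lambda>_. lborel)) * (\<integral>\<^sup>+x. b x \<partial>PiM I (\<lambda>_. lborel)) \<le> (\<integral>\<^sup>+x. c x \<partial>PiM I (\<lambda>_. lborel))\<^sup>2"
  using assms
proof (induction I arbitrary: a b c rule: finite_induct)
  case empty
  have "nn_integral (PiM {} (\<lambda>_. lborel :: real measure)) f = f (\<lambda>_. undefined)" for f :: "(nat \<Rightarrow> real) \<Rightarrow> ennreal"
    by (simp add: lborel_product.nn_integral_empty)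
  then show ?case using empty(4)[of "\<lambda>_. undefined" "\<lambda>_. undefined"]
    by (simp add: space_PiM restrict_def)
next
  case (insert i I)
  note [measurable] = insert.prems(1,2,3)
  let ?M = "PiM I (\<lambda>_. lborel :: real measure)"
  have upd: "(\<lambda>(x, y). f (x(i := y))) \<in> borel_measurable (?M \<Otimes>\<^sub>M lborel)"
    if "f \<in> borel_measurable (PiM (insert i I) (\<lambda>_. lborel))" for f :: "(nat \<Rightarrow> real) \<Rightarrow> ennreal"
    using measurable_compose[OF measurable_add_dim that] by (simp add: case_prod_unfold)
  have meas: "(\<lambda>x. \<integral>\<^sup>+y. f (x(i := y)) \<partial>lborel) \<in> borel_measurable ?M"
    if "f \<in> borel_measurable (PiM (insert i I) (\<lambda>_. lborel))" for f :: "(nat \<Rightarrow> real) \<Rightarrow> ennreal"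
    using lborel.borel_measurable_nn_integral[OF upd[OF that]] .
  have slice: "(\<lambda>y. f (x(i := y))) \<in> borel_measurable borel"
    if "f \<in> borel_measurable (PiM (insert i I) (\<lambda>_. lborel))" "x \<in> space ?M" for f :: "(nat \<Rightarrow> real) \<Rightarrow> ennreal" and x
    using measurable_compose[OF measurable_component_update[OF that(2) insert(2)] that(1)] by simp
  have "(\<integral>\<^sup>+x. \<integral>\<^sup>+y. a (x(i := y)) \<partial>lborel \<partial>?M) * (\<integral>\<^sup>+x. \<integral>\<^sup>+y. b (x(i := y)) \<partial>lborel \<partial>?M)
    \<le> (\<integral>\<^sup>+x. \<integral>\<^sup>+y. c (x(i := y)) \<partial>lborel \<partial>?M)\<^sup>2"
  proof (rule insert.IH)
    fix x x' assume x: "x \<in> space ?M" "x' \<in> space ?M"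
    then have m: "midpt I x x' \<in> space ?M" by (auto simp: space_PiM)
    show "(\<integral>\<^sup>+y. a (x(i := y)) \<partial>lborel) * (\<integral>\<^sup>+y. b (x'(i := y)) \<partial>lborel)
      \<le> (\<integral>\<^sup>+y. c ((midpt I x x')(i := y)) \<partial>lborel)\<^sup>2"
    proof (rule prekopa_leindler_real)
      fix y y'
      have "midpt (insert i I) (x(i := y)) (x'(i := y')) = (midpt I x x')(i := (y + y') / 2)"
        using insert(2) by (auto simp: fun_eq_iff)
      moreover have "x(i := y) \<in> space (PiM (insert i I) (\<lambda>_. lborel))" "x'(i := y') \<in> space (PiM (insert i I) (\<lambda>_. lborel))"
        using x by (auto simp: space_PiM PiE_iff extensional_def)
      ultimately show "a (x(i := y)) * b (x'(i := y')) \<le> (c ((midpt I x x')(i := (y + y') / 2)))\<^sup>2"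
        using insert.prems(4) by metis
    qed (use x m slice insert.prems in auto)
  qed (intro meas insert.prems)+
  then show ?case
    by (simp add: lborel_product.product_nn_integral_insert[OF insert(1,2)])
qed

lemma prekopa_leindler_integral:
  fixes a b c :: "(nat \<Rightarrow> real) \<Rightarrow> real"
  assumes I: "finite I"
    and int: "integrable (PiM I (\<lambda>_. lborel)) a" "integrable (PiM I (\<lambda>_. lborel)) b" "integrable (PiM I (\<lambda>_. lborel)) c"
    and nn: "\<And>x. 0 \<le> a x" "\<And>x. 0 \<le> b x" "\<And>x. 0 \<le> c x"
    and le: "\<And>x y. x \<in> space (PiM I (\<lambda>_. lborel)) \<Longrightarrow> y \<in> space (PiM I (\<lambda>_. lborel)) \<Longrightarrow> a x * b y \<le> (c (midpt I x y))\<^sup>2"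
  shows "(LINT x|PiM I (\<lambda>_. lborel). a x) * (LINT x|PiM I (\<lambda>_. lborel). b x) \<le> (LINT x|PiM I (\<lambda>_. lborel). c x)\<^sup>2"
proof -
  let ?M = "PiM I (\<lambda>_. lborel :: real measure)"
  have "(\<integral>\<^sup>+x. ennreal (a x) \<partial>?M) * (\<integral>\<^sup>+x. ennreal (b x) \<partial>?M) \<le> (\<integral>\<^sup>+x. ennreal (c x) \<partial>?M)\<^sup>2"
    by (rule prekopa_leindler[OF I])
      (use int le nn in \<open>auto simp: ennreal_power simp flip: ennreal_mult intro!: ennreal_leI\<close>)
  then have "ennreal ((LINT x|?M. a x) * (LINT x|?M. b x)) \<le> ennreal ((LINT x|?M. c x)\<^sup>2)"
    using int nn by (simp add: nn_integral_eq_integral ennreal_mult ennreal_power)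
  then show ?thesis by (simp add: ennreal_le_iff)
qed

section \<open>Two log-concave measures with nearly equal potentials\<close>

abbreviation (input) vec_space :: "nat set \<Rightarrow> (nat \<Rightarrow> real) measure" where
  "vec_space I \<equiv> PiM I (\<lambda>_. lborel)"

text \<open>Invariance under a central reflection, one coordinate at a time. It lets the evenness of
  \<open>V0\<close> about \<open>m\<close> identify exponential moments of opposite sign.\<close>

lemma nn_integral_reflect:
  fixes f :: "(nat \<Rightarrow> real) \<Rightarrow> ennreal"
  assumes "finite I" "f \<in> borel_measurable (vec_space I)"
  shows "(\<integral>\<^sup>+x. f (\<lambda>k\<in>I. 2 * m k - x k) \<partial>vec_space I) = (\<integral>\<^sup>+x. f x \<partial>vec_space I)"
  using assms
proof (induction I arbitrary: f rule: finite_induct)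
  case empty
  show ?case
    unfolding PiM_empty by (simp add: nn_integral_count_space_finite restrict_def)
next
  case (insert i I)
  note [measurable] = insert.prems
  let ?M = "vec_space I"
  have upd: "(\<lambda>(x, y). f (x(i := y))) \<in> borel_measurable (?M \<Otimes>\<^sub>M lborel)"
    using measurable_compose[OF measurable_add_dim insert.prems] by (simp add: case_prod_unfold)
  have meas: "(\<lambda>x. \<integral>\<^sup>+y. f (x(i := y)) \<partial>lborel) \<in> borel_measurable ?M"
    using lborel.borel_measurable_nn_integral[OF upd] .
  have slice: "(\<lambda>y. f (x(i := y))) \<in> borel_measurable borel" if "x \<in> space ?M" for x
    using measurable_compose[OF measurable_component_update[OF that insert(2)] insert.prems] by (simp add: fun_upd_def)
  have refl: "(\<lambda>x. \<lambda>k\<in>insert i I. 2 * m k - x k) \<in> measurable (vec_space (insert i I)) (vec_space (insert i I))"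
  proof (rule measurable_restrict)
    fix k assume "k \<in> insert i I"
    then have [measurable]: "(\<lambda>x. x k) \<in> borel_measurable (vec_space (insert i I))"
      using measurable_component_singleton[of k "insert i I" "\<lambda>_. lborel"] by simp
    show "(\<lambda>x. 2 * m k - x k) \<in> measurable (vec_space (insert i I)) lborel" by measurable
  qed
  have "(\<integral>\<^sup>+x. f (\<lambda>k\<in>insert i I. 2 * m k - x k) \<partial>vec_space (insert i I))
     = (\<integral>\<^sup>+x. \<integral>\<^sup>+y. f (\<lambda>k\<in>insert i I. 2 * m k - (x(i := y)) k) \<partial>lborel \<partial>?M)"
    by (rule lborel_product.product_nn_integral_insert[OF insert(1,2)])
      (rule measurable_compose[OF refl insert.prems])
  also have "\<dots> = (\<integral>\<^sup>+x. \<integral>\<^sup>+y. f ((\<lambda>k\<in>I. 2 * m k - x k)(i := y)) \<partial>lborel \<partial>?M)"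
  proof (rule nn_integral_cong)
    fix x assume x: "x \<in> space ?M"
    have rx: "(\<lambda>k\<in>I. 2 * m k - x k) \<in> space ?M" using x by (auto simp: space_PiM)
    have "(\<lambda>k\<in>insert i I. 2 * m k - (x(i := y)) k) = (\<lambda>k\<in>I. 2 * m k - x k)(i := 2 * m i + (-1) * y)" for y
      using insert(2) by (auto simp: fun_eq_iff)
    then show "(\<integral>\<^sup>+y. f (\<lambda>k\<in>insert i I. 2 * m k - (x(i := y)) k) \<partial>lborel)
       = (\<integral>\<^sup>+y. f ((\<lambda>k\<in>I. 2 * m k - x k)(i := y)) \<partial>lborel)"
      using nn_integral_real_affine[OF slice[OF rx], of "-1" "2 * m i"] by simp
  qed
  also have "\<dots> = (\<integral>\<^sup>+x. \<integral>\<^sup>+y. f (x(i := y)) \<partial>lborel \<partial>?M)"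
    by (rule insert.IH[OF meas])
  also have "\<dots> = (\<integral>\<^sup>+x. f x \<partial>vec_space (insert i I))"
    by (rule lborel_product.product_nn_integral_insert[OF insert(1,2) insert.prems, symmetric])
  finally show ?case .
qed

lemma ennreal_power2_le_imp_le:
  fixes x y :: ennreal
  assumes "x\<^sup>2 \<le> y\<^sup>2" "y < top"
  shows "x \<le> y"
proof (cases x)
  case (real x')
  obtain y' where y: "y = ennreal y'" "0 \<le> y'" using assms(2) by (cases y) auto
  have "ennreal (x'\<^sup>2) \<le> ennreal (y'\<^sup>2)" using assms(1) real y by (simp add: ennreal_power)
  then have "x'\<^sup>2 \<le> y'\<^sup>2" by (simp add: ennreal_le_iff)
  then have "x' \<le> y'" using y(2) by (rule power2_le_imp_le)
  then show ?thesis using real y by (simp add: ennreal_leI)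
next
  case top
  then have "y\<^sup>2 = top" using assms(1) by (simp add: top_unique power2_eq_square)
  then show ?thesis using assms(2) by (simp add: power2_eq_square ennreal_mult_eq_top_iff)
qed

lemma integrable_mult_of_squares:
  fixes u v :: "'a \<Rightarrow> real"
  assumes [measurable]: "u \<in> borel_measurable M" "v \<in> borel_measurable M"
    and int: "integrable M (\<lambda>x. (u x)\<^sup>2)" "integrable M (\<lambda>x. (v x)\<^sup>2)"
  shows "integrable M (\<lambda>x. u x * v x)"
proof (rule Bochner_Integration.integrable_bound)
  show "integrable M (\<lambda>x. (u x)\<^sup>2 + (v x)\<^sup>2)" using int by auto
  have "\<bar>p * q\<bar> \<le> p\<^sup>2 + q\<^sup>2" for p q :: real
    using zero_le_power2[of "p - q"] zero_le_power2[of "p + q"] zero_le_power2[of p] zero_le_power2[of q]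
    unfolding power2_diff power2_sum abs_le_iff by linarith
  then show "AE x in M. norm (u x * v x) \<le> norm ((u x)\<^sup>2 + (v x)\<^sup>2)" by simp
qed measurable

text \<open>\<open>u\<close> and \<open>v\<close> are square roots of probability densities. The
  difference of the densities is \<open>(u - v) * (u + v)\<close>, and the product is split with
  weight \<open>\<eta>\<close>: the squared difference integrates to at most
  \<open>2 * \<eta>\<^sup>2\<close>, the squared sum to at most 4, which gives
  \<open>(2 * \<eta> + 4 * \<eta>) / 2\<close>.\<close>

lemma hellinger_bound:
  fixes u v :: "'a \<Rightarrow> real"
  assumes [measurable]: "u \<in> borel_measurable M" "v \<in> borel_measurable M" "A \<in> sets M"
    and int: "integrable M (\<lambda>x. (u x)\<^sup>2)" "integrable M (\<lambda>x. (v x)\<^sup>2)"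
    and one: "(LINT x|M. (u x)\<^sup>2) = 1" "(LINT x|M. (v x)\<^sup>2) = 1"
    and aff: "(LINT x|M. u x * v x) \<ge> 1 - \<eta>\<^sup>2" and \<eta>: "\<eta> > 0"
  shows "\<bar>(LINT x|M. indicator A x * (u x)\<^sup>2) - (LINT x|M. indicator A x * (v x)\<^sup>2)\<bar> \<le> 3 * \<eta>"
proof -
  have uv: "integrable M (\<lambda>x. u x * v x)" using assms by (intro integrable_mult_of_squares) auto
  have intA: "integrable M (\<lambda>x. indicator A x * (f x)\<^sup>2)" if "integrable M (\<lambda>x. (f x)\<^sup>2)" for f :: "'a \<Rightarrow> real"
    using integrable_mult_indicator[OF assms(3) that] by simp
  let ?g = "\<lambda>x. (1/2) * (((u x)\<^sup>2 + (v x)\<^sup>2 - 2 * (u x * v x)) / \<eta> + \<eta> * ((u x)\<^sup>2 + (v x)\<^sup>2 + 2 * (u x * v x)))"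
  have ig: "integrable M ?g" using int uv by auto
  have pt: "\<bar>indicator A x * (u x)\<^sup>2 - indicator A x * (v x)\<^sup>2\<bar> \<le> ?g x" for x
  proof -
    define d s where "d = \<bar>u x - v x\<bar>" and "s = \<bar>u x + v x\<bar>"
    have "2 * (d * s) \<le> d\<^sup>2 / \<eta> + \<eta> * s\<^sup>2"
    proof -
      have "0 \<le> (d - \<eta> * s)\<^sup>2 / \<eta>" using \<eta> by simp
      also have "\<dots> = d\<^sup>2 / \<eta> + \<eta> * s\<^sup>2 - 2 * (d * s)" using \<eta> by (simp add: power2_eq_square field_simps)
      finally show ?thesis by simp
    qed
    moreover have "\<bar>indicator A x * (u x)\<^sup>2 - indicator A x * (v x)\<^sup>2\<bar> \<le> d * s"
      unfolding d_def s_def abs_mult[symmetric]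
      by (auto simp: indicator_def power2_eq_square algebra_simps)
    moreover have "d\<^sup>2 = (u x)\<^sup>2 + (v x)\<^sup>2 - 2 * (u x * v x)" "s\<^sup>2 = (u x)\<^sup>2 + (v x)\<^sup>2 + 2 * (u x * v x)"
      unfolding d_def s_def by (simp_all add: power2_eq_square algebra_simps)
    ultimately show ?thesis by simp
  qed
  have "\<bar>(LINT x|M. indicator A x * (u x)\<^sup>2) - (LINT x|M. indicator A x * (v x)\<^sup>2)\<bar>
      = \<bar>LINT x|M. indicator A x * (u x)\<^sup>2 - indicator A x * (v x)\<^sup>2\<bar>"
    using intA int by (subst Bochner_Integration.integral_diff) auto
  also have "\<dots> \<le> (LINT x|M. \<bar>indicator A x * (u x)\<^sup>2 - indicator A x * (v x)\<^sup>2\<bar>)"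
    by (rule integral_abs_bound)
  also have "\<dots> \<le> (LINT x|M. ?g x)"
    by (rule integral_mono[OF _ ig pt]) (use intA int in auto)
  also have "\<dots> = (1/2) * ((2 - 2 * (LINT x|M. u x * v x)) / \<eta> + \<eta> * (2 + 2 * (LINT x|M. u x * v x)))"
    using int uv one by simp
  also have "\<dots> \<le> 3 * \<eta>"
  proof -
    let ?h = "LINT x|M. u x * v x"
    have "2 * ?h \<le> (LINT x|M. (u x)\<^sup>2 + (v x)\<^sup>2)"
    proof -
      have "(LINT x|M. 2 * (u x * v x)) \<le> (LINT x|M. (u x)\<^sup>2 + (v x)\<^sup>2)"
      proof (rule integral_mono)
        show "2 * (u x * v x) \<le> (u x)\<^sup>2 + (v x)\<^sup>2" for x
          using sum_squares_bound[of "u x" "v x"] by simp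
      qed (use int uv in auto)
      then show ?thesis unfolding integral_mult_right_zero .
    qed
    then have h1: "?h \<le> 1" using int one by simp
    have "(2 - 2 * ?h) / \<eta> \<le> (2 * \<eta>\<^sup>2) / \<eta>" using aff \<eta> by (intro divide_right_mono) auto
    also have "\<dots> = 2 * \<eta>" using \<eta> by (simp add: power2_eq_square)
    finally have "(2 - 2 * ?h) / \<eta> \<le> 2 * \<eta>" .
    moreover have "\<eta> * (2 + 2 * ?h) \<le> \<eta> * 4" using h1 \<eta> by (intro mult_left_mono) auto
    ultimately show ?thesis by simp
  qed
  finally show ?thesis .
qed

lemma amgm_param:
  fixes c s d :: real
  assumes "c > 0"
  shows "2 * (s * d) \<le> s\<^sup>2 / c + c * d\<^sup>2"
proof -
  have "0 \<le> (s - c * d)\<^sup>2 / c" using assms by simp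
  also have "\<dots> = s\<^sup>2 / c + c * d\<^sup>2 - 2 * (s * d)" using assms by (simp add: power2_eq_square field_simps)
  finally show ?thesis by simp
qed

text \<open>From \<open>(1 + \<bar>y\<bar> / 8) ^ 8 \<le> exp \<bar>y\<bar>\<close>. The eighth
  power is the one that \<open>N2 ^ 4\<close> produces in a coordinate.\<close>

lemma power8_le_exp:
  fixes y :: real
  shows "y ^ 8 \<le> 8 ^ 8 * (exp y + exp (- y))"
proof -
  have "(\<bar>y\<bar> / 8) ^ 8 \<le> (1 + \<bar>y\<bar> / of_nat 8) ^ 8" by (intro power_mono) auto
  also have "\<dots> \<le> exp \<bar>y\<bar>" by (rule exp_ge_one_plus_x_over_n_power_n) auto
  also have "\<dots> \<le> exp y + exp (- y)" by (cases "y \<ge> 0") auto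
  finally have "\<bar>y\<bar> ^ 8 \<le> 8 ^ 8 * (exp y + exp (- y))" by (simp add: power_divide field_simps)
  then show ?thesis by (simp add: power_even_abs)
qed

text \<open>In the application \<open>w k\<close> and \<open>W k\<close> are \<open>n + k powr (2 \<gamma>0 + 2 \<beta>)\<close> and
  \<open>n + k powr (2 \<gamma> + 2 \<beta>)\<close> times the \<open>k\<close>-th eigenvalue, so that \<open>S\<close>, \<open>\<tau>\<close> and \<open>t\<close> become
  \<open>S_p\<close>, \<open>S_tau\<close> and their product.\<close>

locale laplace_pair =
  fixes I :: "nat set" and w W m :: "nat \<Rightarrow> real" and V0 V1 :: "(nat \<Rightarrow> real) \<Rightarrow> real"
    and a b \<kappa> \<tau> :: real
  assumes finI: "finite I" and I_ne: "I \<noteq> {}"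
    and w_pos: "\<And>k. k \<in> I \<Longrightarrow> 0 < w k" and w_le_W: "\<And>k. k \<in> I \<Longrightarrow> w k \<le> W k"
    and a_pos: "0 < a" and b_pos: "0 < b" and \<kappa>_pos: "0 < \<kappa>" and \<tau>_pos: "0 < \<tau>"
    and small: "81 * b * \<kappa>\<^sup>2 \<le> 1"
    and V0_meas [measurable]: "V0 \<in> borel_measurable (vec_space I)"
    and V1_meas [measurable]: "V1 \<in> borel_measurable (vec_space I)"
    and V0_int: "integrable (vec_space I) (\<lambda>x. exp (- V0 x))"
    and V1_int: "integrable (vec_space I) (\<lambda>x. exp (- V1 x))"
    and V0_refl: "\<And>x. x \<in> space (vec_space I) \<Longrightarrow> V0 (\<lambda>k\<in>I. 2 * m k - x k) = V0 x"
    and V0_par: "\<And>x y. x \<in> space (vec_space I) \<Longrightarrow> y \<in> space (vec_space I) \<Longrightarrow>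
        2 * V0 (midpt I x y) + a * (\<Sum>k\<in>I. W k * ((x k - y k) / 2)\<^sup>2) \<le> V0 x + V0 y"
    and V1_conv: "\<And>x y. x \<in> space (vec_space I) \<Longrightarrow> y \<in> space (vec_space I) \<Longrightarrow>
        2 * V1 (midpt I x y) \<le> V1 x + V1 y"
    and V_loc: "\<And>x y. x \<in> space (vec_space I) \<Longrightarrow> y \<in> space (vec_space I) \<Longrightarrow>
        (\<Sum>k\<in>I. w k * (x k - m k)\<^sup>2) \<le> 9 * (\<kappa> / \<tau>) \<Longrightarrow> (\<Sum>k\<in>I. w k * (y k - m k)\<^sup>2) \<le> 9 * (\<kappa> / \<tau>) \<Longrightarrow>
        V0 (midpt I x y) + V1 (midpt I x y) - 2 * b * \<tau>\<^sup>2 * (\<Sum>k\<in>I. w k * (midpt I x y k - m k)\<^sup>2)\<^sup>2 \<le> V0 x + V1 y"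
begin

abbreviation "M \<equiv> vec_space I"

definition N2 :: "(nat \<Rightarrow> real) \<Rightarrow> real" where "N2 x = (\<Sum>k\<in>I. w k * (x k - m k)\<^sup>2)"
definition S :: real where "S = (\<Sum>k\<in>I. w k / W k)"
text \<open>The squared radius of the ball \<open>U\<close>. The ball \<open>T\<close> has
  \<open>9 * r\<close>, that is, three times the radius.\<close>

definition r :: real where "r = \<kappa> / \<tau>"
text \<open>The constant of \<open>coord_moment\<close>: \<open>8 ^ 8\<close> comes from
  \<open>power8_le_exp\<close>, \<open>a ^ 4\<close> from the choice
  \<open>s\<^sup>2 = a * W k\<close>, and 4 from two exponentials of mean at most 2 each.\<close>

definition Q :: real where "Q = 4 * 8 ^ 8 / a ^ 4"

section \<open>Geometry of the weighted norm\<close>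

lemma W_pos: "k \<in> I \<Longrightarrow> 0 < W k" using w_pos w_le_W by (meson less_le_trans)
lemma S_pos: "0 < S" unfolding S_def using finI I_ne w_pos W_pos by (intro sum_pos) auto
lemma r_pos: "0 < r" unfolding r_def using \<kappa>_pos \<tau>_pos by simp
lemma Q_pos: "0 < Q" unfolding Q_def using a_pos by simp
lemma N2_nonneg: "0 \<le> N2 x" unfolding N2_def using w_pos by (intro sum_nonneg) (auto simp: less_imp_le)
lemma N2_meas [measurable]: "N2 \<in> borel_measurable M" unfolding N2_def by measurable

lemma midpt_space: "x \<in> space M \<Longrightarrow> y \<in> space M \<Longrightarrow> midpt I x y \<in> space M"
  by (auto simp: space_PiM)

lemma N2_L2: "N2 x = (L2_set (\<lambda>k. sqrt (w k) * (x k - m k)) I)\<^sup>2"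
  unfolding N2_def L2_set_def using w_pos
  by (subst real_sqrt_pow2) (auto intro!: sum.cong sum_nonneg simp: power_mult_distrib less_imp_le)

lemma N2_midpt: "2 * N2 (midpt I x y) \<le> N2 x + N2 y"
proof -
  have "2 * N2 (midpt I x y) = (\<Sum>k\<in>I. 2 * (w k * ((x k + y k) / 2 - m k)\<^sup>2))"
    by (simp add: N2_def sum_distrib_left)
  also have "\<dots> \<le> (\<Sum>k\<in>I. w k * (x k - m k)\<^sup>2 + w k * (y k - m k)\<^sup>2)"
  proof (rule sum_mono)
    fix k assume "k \<in> I"
    have "2 * ((x k + y k) / 2 - m k)\<^sup>2 \<le> (x k - m k)\<^sup>2 + (y k - m k)\<^sup>2"
      using zero_le_power2[of "x k - y k"] by (simp add: power2_eq_square field_simps)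
    from mult_left_mono[OF this, of "w k"] show "2 * (w k * ((x k + y k) / 2 - m k)\<^sup>2) \<le> w k * (x k - m k)\<^sup>2 + w k * (y k - m k)\<^sup>2"
      using w_pos[OF \<open>k \<in> I\<close>] by (simp add: algebra_simps)
  qed
  also have "\<dots> = N2 x + N2 y" by (simp add: N2_def sum.distrib)
  finally show ?thesis .
qed

text \<open>The triangle inequality for \<open>x\<close> as twice the midpoint minus
  \<open>y\<close>: more than three radii, less one for \<open>y\<close>, leave more than two for
  twice the midpoint. This is where the 9 in \<open>T\<close> comes from.\<close>

lemma N2_midpt_gt:
  assumes "N2 x > 9 * r" "N2 y \<le> r"
  shows "N2 (midpt I x y) > r"
proof -
  let ?n = "\<lambda>x. L2_set (\<lambda>k. sqrt (w k) * (x k - m k)) I"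
  have nn: "0 \<le> ?n x" for x by (rule L2_set_nonneg)
  have "?n x = L2_set (\<lambda>k. 2 * (sqrt (w k) * (midpt I x y k - m k)) + (- 1) * (sqrt (w k) * (y k - m k))) I"
    by (rule L2_set_cong) (auto simp: field_simps)
  also have "\<dots> \<le> L2_set (\<lambda>k. 2 * (sqrt (w k) * (midpt I x y k - m k))) I + L2_set (\<lambda>k. (- 1) * (sqrt (w k) * (y k - m k))) I"
    by (rule L2_set_triangle_ineq)
  also have "L2_set (\<lambda>k. (- 1) * (sqrt (w k) * (y k - m k))) I = ?n y"
    unfolding L2_set_def by simp
  also have "L2_set (\<lambda>k. 2 * (sqrt (w k) * (midpt I x y k - m k))) I = 2 * ?n (midpt I x y)"
    by (rule L2_set_right_distrib[symmetric]) simp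
  finally have 1: "?n x \<le> 2 * ?n (midpt I x y) + ?n y" .
  have rr: "sqrt r \<ge> 0" "(sqrt r)\<^sup>2 = r" using r_pos by auto
  have 2: "?n y \<le> sqrt r" using assms(2) nn by (simp add: N2_L2 real_le_rsqrt)
  have "(3 * sqrt r)\<^sup>2 < (?n x)\<^sup>2" using assms(1) rr by (simp add: N2_L2 power_mult_distrib)
  then have 3: "3 * sqrt r < ?n x" by (rule power2_less_imp_less) (rule nn)
  have "sqrt r < ?n (midpt I x y)" using 1 2 3 by linarith
  then have "(sqrt r)\<^sup>2 < (?n (midpt I x y))\<^sup>2" using rr nn by (intro power_strict_mono) auto
  then show ?thesis using rr by (simp add: N2_L2)
qed

text \<open>A sub-Gaussian bound by Prekopa-Leindler. Tilting one factor by \<open>s\<close> and the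
  other by \<open>- s\<close> leaves \<open>2 * s * d\<close> with
  \<open>d = (x k - y k) / 2\<close>; the strong convexity \<open>a * W k * d\<^sup>2\<close> of
  \<open>V0\<close> absorbs it at the price \<open>s\<^sup>2 / (a * W k)\<close>. Evenness makes the
  two tilted integrals equal, so a square root finishes.\<close>

lemma exp_moment:
  assumes k: "k \<in> I"
  shows "(\<integral>\<^sup>+x. ennreal (exp (s * (x k - m k)) * exp (- V0 x)) \<partial>M)
     \<le> ennreal (exp (s\<^sup>2 / (2 * a * W k)) * (LINT x|M. exp (- V0 x)))"
proof -
  let ?e = "\<lambda>s x. ennreal (exp (s * (x k - m k)) * exp (- V0 x))"
  let ?c = "exp (s\<^sup>2 / (2 * a * W k))"
  have [measurable]: "(\<lambda>x. x k) \<in> borel_measurable M"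
    using measurable_component_singleton[OF k, of "\<lambda>_. lborel"] by simp
  have "(\<integral>\<^sup>+x. ?e (- s) x \<partial>M) = (\<integral>\<^sup>+x. ?e s (\<lambda>k\<in>I. 2 * m k - x k) \<partial>M)"
    by (rule nn_integral_cong) (use k V0_refl in \<open>auto simp: algebra_simps\<close>)
  also have "\<dots> = (\<integral>\<^sup>+x. ?e s x \<partial>M)"
    by (rule nn_integral_reflect[OF finI]) measurable
  finally have sym: "(\<integral>\<^sup>+x. ?e (- s) x \<partial>M) = (\<integral>\<^sup>+x. ?e s x \<partial>M)" .
  have "(\<integral>\<^sup>+x. ?e s x \<partial>M) * (\<integral>\<^sup>+x. ?e (- s) x \<partial>M) \<le> (\<integral>\<^sup>+x. ennreal (?c * exp (- V0 x)) \<partial>M)\<^sup>2"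
  proof (rule prekopa_leindler[OF finI])
    fix x y assume xy: "x \<in> space M" "y \<in> space M"
    define d where "d = (x k - y k) / 2"
    have "a * (W k * d\<^sup>2) \<le> a * (\<Sum>k\<in>I. W k * ((x k - y k) / 2)\<^sup>2)"
      unfolding d_def using a_pos W_pos k finI
      by (intro mult_left_mono member_le_sum) (auto simp: less_imp_le)
    with V0_par[OF xy] have V: "2 * V0 (midpt I x y) + a * (W k * d\<^sup>2) \<le> V0 x + V0 y" by linarith
    define c where "c = a * W k"
    have c: "c > 0" unfolding c_def using a_pos W_pos k by simp
    have "2 * (s * d) \<le> s\<^sup>2 / c + c * d\<^sup>2"
      by (rule amgm_param[OF c])
    moreover have "s * (x k - m k) + - s * (y k - m k) = 2 * (s * d)" unfolding d_def by (simp add: algebra_simps)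
    moreover have "2 * (s\<^sup>2 / (2 * a * W k)) = s\<^sup>2 / c" unfolding c_def by simp
    moreover have "a * (W k * d\<^sup>2) = c * d\<^sup>2" unfolding c_def by simp
    ultimately have "(s * (x k - m k) + - V0 x) + (- s * (y k - m k) + - V0 y)
        \<le> (s\<^sup>2 / (2 * a * W k) + - V0 (midpt I x y)) + (s\<^sup>2 / (2 * a * W k) + - V0 (midpt I x y))"
      using V by linarith
    then have "exp ((s * (x k - m k) + - V0 x) + (- s * (y k - m k) + - V0 y))
        \<le> exp ((s\<^sup>2 / (2 * a * W k) + - V0 (midpt I x y)) + (s\<^sup>2 / (2 * a * W k) + - V0 (midpt I x y)))"
      by (simp only: exp_le_cancel_iff)
    then have "(exp (s * (x k - m k)) * exp (- V0 x)) * (exp (- s * (y k - m k)) * exp (- V0 y))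
        \<le> (?c * exp (- V0 (midpt I x y)))\<^sup>2"
      by (simp only: exp_add power2_eq_square)
    then have "ennreal ((exp (s * (x k - m k)) * exp (- V0 x)) * (exp (- s * (y k - m k)) * exp (- V0 y)))
        \<le> ennreal ((?c * exp (- V0 (midpt I x y)))\<^sup>2)"
      by (rule ennreal_leI)
    then show "?e s x * ?e (- s) y \<le> (ennreal (?c * exp (- V0 (midpt I x y))))\<^sup>2"
      by (subst ennreal_power) (simp_all only: ennreal_mult' mult_nonneg_nonneg exp_ge_zero)
  qed measurable
  also have "(\<integral>\<^sup>+x. ennreal (?c * exp (- V0 x)) \<partial>M) = ennreal (?c * (LINT x|M. exp (- V0 x)))"
    using V0_int by (subst nn_integral_eq_integral) auto
  finally have "(\<integral>\<^sup>+x. ?e s x \<partial>M)\<^sup>2 \<le> (ennreal (?c * (LINT x|M. exp (- V0 x))))\<^sup>2"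
    unfolding sym by (simp add: power2_eq_square)
  \<comment> \<open>Finiteness of the tilted integral is not known beforehand, hence the nonnegative
    integrals; taking the root requires only the right side to be finite.\<close>
  then show ?thesis by (rule ennreal_power2_le_imp_le) auto
qed

definition Z0 :: real where "Z0 = (LINT x|M. exp (- V0 x))"
definition Z1 :: real where "Z1 = (LINT x|M. exp (- V1 x))"
definition t :: real where "t = \<tau> * S"

lemma t_pos: "0 < t" unfolding t_def using \<tau>_pos S_pos by simp

lemma coord_meas: "k \<in> I \<Longrightarrow> (\<lambda>x. x k) \<in> borel_measurable M"
  using measurable_component_singleton[of k I "\<lambda>_. lborel :: real measure"] by simp

lemma coord_moment:
  assumes k: "k \<in> I"
  shows "(\<integral>\<^sup>+x. ennreal (W k ^ 4 * (x k - m k) ^ 8 * exp (- V0 x)) \<partial>M) \<le> ennreal (Q * Z0)"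
proof -
  note [measurable] = coord_meas[OF k]
  \<comment> \<open>This \<open>s\<close> makes the exponent in \<open>exp_moment\<close> equal to
    1/2 for every \<open>k\<close>, so one constant serves all coordinates.\<close>
  define s where "s = sqrt (a * W k)"
  have aW: "0 < a * W k" using a_pos W_pos k by simp
  have s2: "s\<^sup>2 = a * W k" unfolding s_def using aW by simp
  have s8: "s ^ 8 = a ^ 4 * W k ^ 4"
  proof -
    have "s ^ 8 = (s\<^sup>2) ^ 4" by (simp flip: power_mult)
    then show ?thesis unfolding s2 by (simp add: power_mult_distrib)
  qed
  define C where "C = 8 ^ 8 / a ^ 4"
  have C: "C > 0" unfolding C_def using a_pos by simp
  have eq: "ennreal C * (ennreal p + ennreal q) = ennreal (C * (p + q))" if "0 \<le> p" "0 \<le> q" for p q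
    using C that by (metis ennreal_mult' ennreal_plus less_imp_le)
  let ?e = "\<lambda>s x. exp (s * (x k - m k)) * exp (- V0 x)"
  have E: "(\<integral>\<^sup>+x. ennreal (?e u x) \<partial>M) \<le> ennreal (2 * Z0)" if u: "u\<^sup>2 = s\<^sup>2" for u
  proof -
    have "exp (1 / 2 :: real) \<le> 2" using exp_bound_half[of "1/2 :: real"] by simp
    moreover have "exp (u\<^sup>2 / (2 * a * W k)) = exp (1 / 2)" using a_pos W_pos[OF k] unfolding u s2 by simp
    moreover have "Z0 \<ge> 0" unfolding Z0_def by (rule Bochner_Integration.integral_nonneg) simp
    ultimately have "exp (u\<^sup>2 / (2 * a * W k)) * Z0 \<le> 2 * Z0" by (metis mult_right_mono)
    then show ?thesis
      using exp_moment[OF k, of u] unfolding Z0_def[symmetric] by (meson ennreal_leI order_trans)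
  qed
  have "(\<integral>\<^sup>+x. ennreal (W k ^ 4 * (x k - m k) ^ 8 * exp (- V0 x)) \<partial>M)
     \<le> (\<integral>\<^sup>+x. ennreal C * (ennreal (?e s x) + ennreal (?e (- s) x)) \<partial>M)"
  proof (rule nn_integral_mono)
    fix x
    define y where "y = x k - m k"
    have "(s * y) ^ 8 \<le> 8 ^ 8 * (exp (s * y) + exp (- (s * y)))" by (rule power8_le_exp)
    then have "a ^ 4 * (W k ^ 4 * y ^ 8) \<le> a ^ 4 * (C * (exp (s * y) + exp (- (s * y))))"
      using a_pos unfolding C_def by (simp add: power_mult_distrib s8)
    then have "W k ^ 4 * y ^ 8 \<le> C * (exp (s * y) + exp (- (s * y)))"
      using a_pos by (simp add: mult_le_cancel_left)
    from mult_right_mono[OF this, of "exp (- V0 x)"]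
    have "W k ^ 4 * y ^ 8 * exp (- V0 x) \<le> C * (exp (s * y) * exp (- V0 x) + exp (- s * y) * exp (- V0 x))"
      by (simp add: algebra_simps)
    then have "ennreal (W k ^ 4 * y ^ 8 * exp (- V0 x)) \<le> ennreal (C * (exp (s * y) * exp (- V0 x) + exp (- s * y) * exp (- V0 x)))"
      by (rule ennreal_leI)
    then show "ennreal (W k ^ 4 * (x k - m k) ^ 8 * exp (- V0 x)) \<le> ennreal C * (ennreal (?e s x) + ennreal (?e (- s) x))"
      unfolding y_def eq[OF mult_nonneg_nonneg[OF exp_ge_zero exp_ge_zero] mult_nonneg_nonneg[OF exp_ge_zero exp_ge_zero]] .
  qed
  also have "\<dots> = ennreal C * ((\<integral>\<^sup>+x. ennreal (?e s x) \<partial>M) + (\<integral>\<^sup>+x. ennreal (?e (- s) x) \<partial>M))"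
    by (simp add: nn_integral_cmult nn_integral_add)
  also have "\<dots> \<le> ennreal C * (ennreal (2 * Z0) + ennreal (2 * Z0))"
    by (intro mult_left_mono add_mono E) auto
  also have "\<dots> = ennreal (Q * Z0)"
  proof -
    have "Z0 \<ge> 0" unfolding Z0_def by (rule Bochner_Integration.integral_nonneg) simp
    have "C * (2 * Z0 + 2 * Z0) = Q * Z0" unfolding Q_def C_def by simp
    then show ?thesis
      unfolding eq[OF mult_nonneg_nonneg[OF zero_le_numeral \<open>Z0 \<ge> 0\<close>] mult_nonneg_nonneg[OF zero_le_numeral \<open>Z0 \<ge> 0\<close>]]
      by (rule arg_cong)
  qed
  finally show ?thesis .
qed

text \<open>Jensen for the fourth power with weights \<open>w k / W k / S\<close>. Equal weights
  would bring in the number of coordinates; with these, coordinate moments bounded by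
  \<open>Q\<close> sum up to \<open>Q * S ^ 4\<close>.\<close>

lemma N2_pow4_le: "N2 x ^ 4 \<le> (\<Sum>k\<in>I. S ^ 3 * (w k / W k) * (W k ^ 4 * (x k - m k) ^ 8))"
proof -
  let ?p = "\<lambda>k. (w k / W k) / S" and ?y = "\<lambda>k. S * W k * (x k - m k)\<^sup>2"
  have "N2 x = (\<Sum>k\<in>I. ?p k *\<^sub>R ?y k)"
    unfolding N2_def using S_pos W_pos by (intro sum.cong) (auto simp: field_simps less_imp_neq[symmetric])
  moreover have "(\<Sum>k\<in>I. ?p k *\<^sub>R ?y k) ^ 4 \<le> (\<Sum>k\<in>I. ?p k * ?y k ^ 4)"
  proof (rule convex_on_sum[of I UNIV "\<lambda>x. x ^ 4"])
    show "(\<Sum>k\<in>I. ?p k) = 1" using S_pos unfolding sum_divide_distrib[symmetric] S_def[symmetric] by simp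
    show "0 \<le> ?p k" if "k \<in> I" for k using that w_pos W_pos S_pos by (simp add: less_imp_le)
  qed (use finI I_ne in \<open>auto intro: convex_power_even\<close>)
  moreover have "?p k * ?y k ^ 4 = S ^ 3 * (w k / W k) * (W k ^ 4 * (x k - m k) ^ 8)" if "k \<in> I" for k
  proof -
    have "(S * W k * (x k - m k)\<^sup>2) ^ 4 = S ^ 4 * W k ^ 4 * (x k - m k) ^ 8"
      by (simp add: power_mult_distrib flip: power_mult)
    moreover have "S ^ 4 = S * S ^ 3" by (simp add: eval_nat_numeral)
    ultimately show ?thesis using S_pos by simp
  qed
  ultimately show ?thesis by simp
qed

text \<open>The fourth power serves twice: up to constants it is the square of the error
  \<open>b * \<tau>\<^sup>2 * (N2 x)\<^sup>2\<close>, and it gives the tail bound of order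
  \<open>t ^ 4\<close>.\<close>

lemma N2_moment:
  shows "integrable M (\<lambda>x. N2 x ^ 4 * exp (- V0 x))" (is ?A)
    and "(LINT x|M. N2 x ^ 4 * exp (- V0 x)) \<le> Q * S ^ 4 * Z0" (is ?B)
proof -
  have Z: "Z0 \<ge> 0" unfolding Z0_def by (rule Bochner_Integration.integral_nonneg) simp
  have cf: "0 \<le> S ^ 3 * (w k / W k)" if "k \<in> I" for k using S_pos w_pos W_pos that by (simp add: less_imp_le)
  have "(\<integral>\<^sup>+x. ennreal (N2 x ^ 4 * exp (- V0 x)) \<partial>M)
     \<le> (\<integral>\<^sup>+x. (\<Sum>k\<in>I. ennreal (S ^ 3 * (w k / W k)) * ennreal (W k ^ 4 * (x k - m k) ^ 8 * exp (- V0 x))) \<partial>M)"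
  proof (rule nn_integral_mono)
    fix x
    have "N2 x ^ 4 * exp (- V0 x) \<le> (\<Sum>k\<in>I. S ^ 3 * (w k / W k) * (W k ^ 4 * (x k - m k) ^ 8)) * exp (- V0 x)"
      by (intro mult_right_mono N2_pow4_le) simp
    also have "\<dots> = (\<Sum>k\<in>I. S ^ 3 * (w k / W k) * (W k ^ 4 * (x k - m k) ^ 8 * exp (- V0 x)))"
      by (simp add: sum_distrib_right mult.assoc)
    finally have "ennreal (N2 x ^ 4 * exp (- V0 x)) \<le> ennreal (\<Sum>k\<in>I. S ^ 3 * (w k / W k) * (W k ^ 4 * (x k - m k) ^ 8 * exp (- V0 x)))"
      by (rule ennreal_leI)
    also have "\<dots> = (\<Sum>k\<in>I. ennreal (S ^ 3 * (w k / W k) * (W k ^ 4 * (x k - m k) ^ 8 * exp (- V0 x))))"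
      using cf W_pos by (intro sum_ennreal[symmetric] mult_nonneg_nonneg[OF cf]) (auto simp: zero_le_even_power less_imp_le)
    also have "\<dots> = (\<Sum>k\<in>I. ennreal (S ^ 3 * (w k / W k)) * ennreal (W k ^ 4 * (x k - m k) ^ 8 * exp (- V0 x)))"
      using W_pos by (intro sum.cong refl ennreal_mult[OF cf]) (auto simp: zero_le_even_power)
    finally show "ennreal (N2 x ^ 4 * exp (- V0 x)) \<le> (\<Sum>k\<in>I. ennreal (S ^ 3 * (w k / W k)) * ennreal (W k ^ 4 * (x k - m k) ^ 8 * exp (- V0 x)))" .
  qed
  also have "\<dots> = (\<Sum>k\<in>I. ennreal (S ^ 3 * (w k / W k)) * (\<integral>\<^sup>+x. ennreal (W k ^ 4 * (x k - m k) ^ 8 * exp (- V0 x)) \<partial>M))"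
  proof (subst nn_integral_sum)
    fix k assume k: "k \<in> I"
    note [measurable] = coord_meas[OF k]
    show "(\<lambda>x. ennreal (S ^ 3 * (w k / W k)) * ennreal (W k ^ 4 * (x k - m k) ^ 8 * exp (- V0 x))) \<in> borel_measurable M"
      by measurable
  next
    show "(\<Sum>k\<in>I. \<integral>\<^sup>+x. ennreal (S ^ 3 * (w k / W k)) * ennreal (W k ^ 4 * (x k - m k) ^ 8 * exp (- V0 x)) \<partial>M)
      = (\<Sum>k\<in>I. ennreal (S ^ 3 * (w k / W k)) * (\<integral>\<^sup>+x. ennreal (W k ^ 4 * (x k - m k) ^ 8 * exp (- V0 x)) \<partial>M))"
    proof (intro sum.cong refl nn_integral_cmult)
      fix k assume k: "k \<in> I"
      note [measurable] = coord_meas[OF k]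
      show "(\<lambda>x. ennreal (W k ^ 4 * (x k - m k) ^ 8 * exp (- V0 x))) \<in> borel_measurable M" by measurable
    qed
  qed
  also have "\<dots> \<le> (\<Sum>k\<in>I. ennreal (S ^ 3 * (w k / W k)) * ennreal (Q * Z0))"
    by (intro sum_mono mult_left_mono coord_moment) auto
  also have "\<dots> = (\<Sum>k\<in>I. ennreal (S ^ 3 * (w k / W k) * (Q * Z0)))"
    using cf Q_pos Z by (intro sum.cong refl ennreal_mult[symmetric]) auto
  also have "\<dots> = ennreal (\<Sum>k\<in>I. S ^ 3 * (w k / W k) * (Q * Z0))"
    using Q_pos Z by (intro sum_ennreal mult_nonneg_nonneg[OF cf]) auto
  also have "(\<Sum>k\<in>I. S ^ 3 * (w k / W k) * (Q * Z0)) = Q * S ^ 4 * Z0"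
    unfolding sum_distrib_right[symmetric] sum_distrib_left[symmetric] S_def[symmetric] by (simp add: eval_nat_numeral)
  finally have le: "(\<integral>\<^sup>+x. ennreal (N2 x ^ 4 * exp (- V0 x)) \<partial>M) \<le> ennreal (Q * S ^ 4 * Z0)" .
  show A: ?A
    by (rule integrableI_nonneg) (use le in \<open>auto intro: order_le_less_trans\<close>)
  have "0 \<le> Q * S ^ 4 * Z0" using Q_pos S_pos Z by auto
  then show ?B using le nn_integral_eq_integral[OF A] by (simp add: ennreal_le_iff)
qed

section \<open>Masses of the two concentric balls\<close>

definition mass :: "((nat \<Rightarrow> real) \<Rightarrow> real) \<Rightarrow> (nat \<Rightarrow> real) set \<Rightarrow> real" where
  "mass V X = (LINT x|M. indicator X x * exp (- V x))"

definition T :: "(nat \<Rightarrow> real) set" where "T = {x \<in> space M. N2 x \<le> 9 * r}"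
definition U :: "(nat \<Rightarrow> real) set" where "U = {x \<in> space M. N2 x \<le> r}"

lemma T_sets [measurable]: "T \<in> sets M" unfolding T_def by measurable
lemma U_sets [measurable]: "U \<in> sets M" unfolding U_def by measurable
lemma U_subset_T: "U \<subseteq> T" unfolding U_def T_def using r_pos by auto

lemma mass_int:
  fixes V :: "(nat \<Rightarrow> real) \<Rightarrow> real"
  assumes "integrable M (\<lambda>x. exp (- V x))" "X \<in> sets M"
  shows "integrable M (\<lambda>x. indicator X x * exp (- V x))"
  using integrable_mult_indicator[OF assms(2,1)] by simp

lemma mass_nonneg: "0 \<le> mass V X"
  unfolding mass_def by (rule Bochner_Integration.integral_nonneg) simp

lemma mass_Un:
  assumes "integrable M (\<lambda>x. exp (- V x))" "X \<in> sets M" "Y \<in> sets M" "X \<inter> Y = {}"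
  shows "mass V (X \<union> Y) = mass V X + mass V Y"
proof -
  have "mass V (X \<union> Y) = (LINT x|M. indicator X x * exp (- V x) + indicator Y x * exp (- V x))"
    unfolding mass_def using assms(4) by (intro Bochner_Integration.integral_cong) (auto simp: indicator_def)
  also have "\<dots> = mass V X + mass V Y"
    unfolding mass_def using mass_int assms by (intro Bochner_Integration.integral_add) auto
  finally show ?thesis .
qed

lemma mass_mono:
  assumes "integrable M (\<lambda>x. exp (- V x))" "X \<in> sets M" "Y \<in> sets M" "X \<subseteq> Y"
  shows "mass V X \<le> mass V Y"
  using mass_Un[OF assms(1,2), of "Y - X"] assms mass_nonneg[of V "Y - X"] by (simp add: Un_absorb1)

lemma mass_space: "mass V0 (space M) = Z0" "mass V1 (space M) = Z1"
  unfolding mass_def Z0_def Z1_def by (auto intro!: Bochner_Integration.integral_cong)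

text \<open>Markov's inequality for \<open>N2 ^ 4\<close>, with
  \<open>S / r = t / \<kappa>\<close>.\<close>

lemma mass_V0_tail: "mass V0 (space M - U) \<le> Q / \<kappa> ^ 4 * t ^ 4 * Z0"
proof -
  have "mass V0 (space M - U) \<le> (LINT x|M. N2 x ^ 4 * exp (- V0 x) / r ^ 4)"
    unfolding mass_def
  proof (rule integral_mono)
    show "integrable M (\<lambda>x. indicator (space M - U) x * exp (- V0 x))"
      by (intro mass_int V0_int) auto
    show "integrable M (\<lambda>x. N2 x ^ 4 * exp (- V0 x) / r ^ 4)" using N2_moment(1) by simp
    fix x assume x: "x \<in> space M"
    show "indicator (space M - U) x * exp (- V0 x) \<le> N2 x ^ 4 * exp (- V0 x) / r ^ 4"
    proof (cases "x \<in> U")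
      case False
      then have "r ^ 4 \<le> N2 x ^ 4" using x r_pos by (intro power_mono) (auto simp: U_def)
      then have "1 \<le> N2 x ^ 4 / r ^ 4" using r_pos by simp
      from mult_right_mono[OF this, of "exp (- V0 x)"] show ?thesis using False x by simp
    qed simp
  qed
  also have "\<dots> = (LINT x|M. N2 x ^ 4 * exp (- V0 x)) / r ^ 4" by simp
  also have "\<dots> \<le> Q * S ^ 4 * Z0 / r ^ 4" using r_pos N2_moment(2) by (intro divide_right_mono) auto
  also have "\<dots> = Q / \<kappa> ^ 4 * t ^ 4 * Z0" unfolding r_def t_def using \<kappa>_pos \<tau>_pos by (simp add: field_simps)
  finally show ?thesis .
qed

text \<open>The density is positive, so null sets are Lebesgue null sets whichever potential is
  used; this carries positivity of a mass from \<open>V0\<close> over to \<open>V1\<close>.\<close>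

lemma mass_zero_iff:
  assumes "integrable M (\<lambda>x. exp (- V x))" "X \<in> sets M"
  shows "mass V X = 0 \<longleftrightarrow> (AE x in M. x \<notin> X)"
proof -
  have "mass V X = 0 \<longleftrightarrow> (AE x in M. indicator X x * exp (- V x) = 0)"
    unfolding mass_def by (rule integral_nonneg_eq_0_iff_AE) (use mass_int[OF assms] in auto)
  then show ?thesis by (simp add: indicator_eq_0_iff)
qed

lemma not_AE_False: "\<not> (AE x in M. x \<notin> space M)"
proof
  assume "AE x in M. x \<notin> space M"
  then have "emeasure M (space M) = 0" using AE_iff_measurable[of "space M" M "\<lambda>x. x \<notin> space M"] by auto
  moreover have "emeasure M (\<Pi>\<^sub>E k\<in>I. {0..1}) = 1"
    by (subst lborel_product.emeasure_PiM[OF finI]) auto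
  moreover have "emeasure M (\<Pi>\<^sub>E k\<in>I. {0..1}) \<le> emeasure M (space M)"
    by (rule emeasure_space)
  ultimately show False by simp
qed

lemma Z_pos: "0 < Z0" "0 < Z1"
  using mass_zero_iff[OF V0_int sets.top] mass_zero_iff[OF V1_int sets.top] not_AE_False
    mass_nonneg[of V0 "space M"] mass_nonneg[of V1 "space M"]
  by (auto simp: mass_space order_less_le)

section \<open>Affinity of the truncated measures\<close>

definition G :: real where "G = b * sqrt (2 * Q)"

lemma G_pos: "0 < G" unfolding G_def using b_pos Q_pos by simp

text \<open>The assumption \<open>small\<close> enters here, its 81 being the square of the 9 in
  \<open>T\<close>. A bound by 1 allows \<open>exp\<close> of the error to be linearised.\<close>

lemma eps_le_1: "x \<in> T \<Longrightarrow> b * \<tau>\<^sup>2 * (N2 x)\<^sup>2 \<le> 1"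
proof -
  assume "x \<in> T"
  then have "(N2 x)\<^sup>2 \<le> (9 * r)\<^sup>2" using N2_nonneg by (intro power_mono) (auto simp: T_def)
  then have "b * \<tau>\<^sup>2 * (N2 x)\<^sup>2 \<le> b * \<tau>\<^sup>2 * (9 * r)\<^sup>2" using b_pos by (intro mult_left_mono) auto
  also have "\<dots> = 81 * b * \<kappa>\<^sup>2" unfolding r_def using \<tau>_pos by (simp add: power2_eq_square field_simps)
  finally show ?thesis using small by simp
qed

lemma tilted_int: "integrable M (\<lambda>x. indicator T x * exp (- (V0 x + V1 x) / 2 + b * \<tau>\<^sup>2 * (N2 x)\<^sup>2))"
proof (rule Bochner_Integration.integrable_bound)
  show "integrable M (\<lambda>x. exp 1 * (exp (- V0 x) + exp (- V1 x)))" using V0_int V1_int by auto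
  show "AE x in M. norm (indicator T x * exp (- (V0 x + V1 x) / 2 + b * \<tau>\<^sup>2 * (N2 x)\<^sup>2))
      \<le> norm (exp 1 * (exp (- V0 x) + exp (- V1 x)))"
  proof (rule AE_I2)
    fix x
    show "norm (indicator T x * exp (- (V0 x + V1 x) / 2 + b * \<tau>\<^sup>2 * (N2 x)\<^sup>2))
      \<le> norm (exp 1 * (exp (- V0 x) + exp (- V1 x)))"
    proof (cases "x \<in> T")
      case True
      have "exp (- (V0 x + V1 x) / 2 + b * \<tau>\<^sup>2 * (N2 x)\<^sup>2) = exp (b * \<tau>\<^sup>2 * (N2 x)\<^sup>2) * exp (- (V0 x + V1 x) / 2)"
        by (simp flip: exp_add)
      also have "\<dots> \<le> exp 1 * exp (- (V0 x + V1 x) / 2)" using eps_le_1[OF True] by (intro mult_right_mono) auto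
      also have "exp (- (V0 x + V1 x) / 2) \<le> exp (- V0 x) + exp (- V1 x)"
      proof (cases "V0 x \<le> V1 x")
        case True
        then have "exp (- (V0 x + V1 x) / 2) \<le> exp (- V0 x)" by simp
        then show ?thesis by (simp add: add_increasing2)
      next
        case False
        then have "exp (- (V0 x + V1 x) / 2) \<le> exp (- V1 x)" by simp
        then show ?thesis by (simp add: add_increasing)
      qed
      finally show ?thesis using True by simp
    qed simp
  qed
qed measurable

lemma T_midpt: "x \<in> T \<Longrightarrow> y \<in> T \<Longrightarrow> midpt I x y \<in> T"
  using N2_midpt[of x y] midpt_space[of x y] unfolding T_def by auto

lemma V_loc': "x \<in> T \<Longrightarrow> y \<in> T \<Longrightarrow>
    V0 (midpt I x y) + V1 (midpt I x y) - 2 * b * \<tau>\<^sup>2 * (N2 (midpt I x y))\<^sup>2 \<le> V0 x + V1 y"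
  using V_loc[of x y] unfolding T_def N2_def r_def by auto

text \<open>\<open>V_loc\<close> is exactly the hypothesis of Prekopa-Leindler once both densities
  are cut off outside \<open>T\<close>, a set closed under midpoints.\<close>

lemma mass_T_prod_le:
  "mass V0 T * mass V1 T \<le> (LINT x|M. indicator T x * exp (- (V0 x + V1 x) / 2 + b * \<tau>\<^sup>2 * (N2 x)\<^sup>2))\<^sup>2"
  unfolding mass_def
proof (rule prekopa_leindler_integral[OF finI])
  fix x y assume "x \<in> space M" "y \<in> space M"
  let ?z = "midpt I x y"
  let ?c = "- (V0 ?z + V1 ?z) / 2 + b * \<tau>\<^sup>2 * (N2 ?z)\<^sup>2"
  show "indicator T x * exp (- V0 x) * (indicator T y * exp (- V1 y)) \<le> (indicator T ?z * exp ?c)\<^sup>2"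
  proof (cases "x \<in> T \<and> y \<in> T")
    case True
    have "(exp (- V0 x) * exp (- V1 y)) = exp (- (V0 x + V1 y))" by (simp flip: exp_add)
    also have "\<dots> \<le> exp (?c + ?c)" using V_loc'[of x y] True by (simp add: field_simps)
    also have "\<dots> = (exp ?c)\<^sup>2" by (simp only: exp_add power2_eq_square)
    finally show ?thesis using True T_midpt[of x y] by simp
  qed auto
qed (use mass_int[OF V0_int T_sets] mass_int[OF V1_int T_sets] tilted_int in auto)

lemma mass_T_pos:
  assumes "Q / \<kappa> ^ 4 * t ^ 4 \<le> 1 / 2"
  shows "Z0 / 2 \<le> mass V0 T" "0 < mass V0 T" "0 < mass V1 T"
proof -
  have "mass V0 (space M - T) \<le> mass V0 (space M - U)"
    by (rule mass_mono) (use U_subset_T V0_int in auto)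
  also have "\<dots> \<le> Z0 / 2"
    using order_trans[OF mass_V0_tail mult_right_mono[OF assms, of Z0]] Z_pos by simp
  finally have "mass V0 (space M - T) \<le> Z0 / 2" .
  moreover have "mass V0 (T \<union> (space M - T)) = mass V0 T + mass V0 (space M - T)"
    by (rule mass_Un) (use V0_int in auto)
  moreover have "T \<union> (space M - T) = space M" unfolding T_def by auto
  ultimately show 1: "Z0 / 2 \<le> mass V0 T" by (simp add: mass_space)
  then show 2: "0 < mass V0 T" using Z_pos by simp
  then show "0 < mass V1 T"
    using mass_zero_iff[OF V0_int T_sets] mass_zero_iff[OF V1_int T_sets] mass_nonneg[of V1 T] by auto
qed

text \<open>After division by \<open>sqrt (z0 * z1)\<close>, \<open>mass_T_prod_le\<close> says that
  the affinity weighted by \<open>exp \<epsilon>\<close> is at least 1. The excess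
  \<open>2 * \<epsilon> * u * v\<close> is split into squares, so that only the second moment of
  \<open>\<epsilon>\<close> under the \<open>V0\<close>-measure is needed; for \<open>V1\<close> the
  total mass suffices.\<close>

lemma truncated_TV:
  assumes h: "Q / \<kappa> ^ 4 * t ^ 4 \<le> 1 / 2" and A [measurable]: "A \<in> sets M"
  shows "\<bar>mass V0 (A \<inter> T) / mass V0 T - mass V1 (A \<inter> T) / mass V1 T\<bar> \<le> 3 * (sqrt (2 * G) * t)"
proof -
  define z0 z1 where "z0 = mass V0 T" and "z1 = mass V1 T"
  have z: "0 < z0" "0 < z1" "Z0 / 2 \<le> z0" unfolding z0_def z1_def using mass_T_pos[OF h] by auto
  define u v where "u x = indicator T x * exp (- V0 x / 2) / sqrt z0"
    and "v x = indicator T x * exp (- V1 x / 2) / sqrt z1" for x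
  define \<epsilon> where "\<epsilon> x = b * \<tau>\<^sup>2 * (N2 x)\<^sup>2" for x
  \<comment> \<open>\<open>\<theta>\<close> bounds the root mean square of
    \<open>\<epsilon> * u\<close>; used as the weight of the splitting it makes both halves at most
    \<open>\<theta>\<close>. The 2 under the root in \<open>G\<close> is the bound for
    \<open>Z0 / z0\<close>.\<close>
  define \<theta> where "\<theta> = G * t\<^sup>2"
  have \<theta>: "\<theta> > 0" unfolding \<theta>_def using G_pos t_pos by simp
  have [measurable]: "u \<in> borel_measurable M" "v \<in> borel_measurable M" "\<epsilon> \<in> borel_measurable M"
    unfolding u_def v_def \<epsilon>_def by measurable
  have e2: "(exp (c / 2))\<^sup>2 = exp c" for c :: real by (simp flip: exp_double)
  have u2: "(u x)\<^sup>2 = indicator T x * exp (- V0 x) / z0" for x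
    unfolding u_def using z e2[of "- V0 x"] by (auto simp: indicator_def power_divide)
  have v2: "(v x)\<^sup>2 = indicator T x * exp (- V1 x) / z1" for x
    unfolding v_def using z e2[of "- V1 x"] by (auto simp: indicator_def power_divide)
  have int: "integrable M (\<lambda>x. (u x)\<^sup>2)" "integrable M (\<lambda>x. (v x)\<^sup>2)"
    unfolding u2 v2 using mass_int[OF V0_int T_sets] mass_int[OF V1_int T_sets] by auto
  have one: "(LINT x|M. (u x)\<^sup>2) = 1" "(LINT x|M. (v x)\<^sup>2) = 1"
    unfolding u2 v2 using z by (auto simp: z0_def z1_def mass_def)
  have uv: "u x * v x = indicator T x * exp (- (V0 x + V1 x) / 2) / sqrt (z0 * z1)" for x
  proof -
    have "- (V0 x + V1 x) / 2 = - V0 x / 2 + - V1 x / 2" by (simp add: field_simps)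
    then have "exp (- (V0 x + V1 x) / 2) = exp (- V0 x / 2) * exp (- V1 x / 2)" by (simp only: exp_add)
    then show ?thesis
      unfolding u_def v_def by (auto simp: indicator_def real_sqrt_mult)
  qed
  have uv_int: "integrable M (\<lambda>x. u x * v x)" using int by (intro integrable_mult_of_squares) auto
  have eu_eq: "(\<epsilon> x)\<^sup>2 * (u x)\<^sup>2 = b\<^sup>2 * \<tau> ^ 4 / z0 * (indicator T x * (N2 x ^ 4 * exp (- V0 x)))" for x
  proof -
    have "(\<epsilon> x)\<^sup>2 = b\<^sup>2 * \<tau> ^ 4 * N2 x ^ 4"
      unfolding \<epsilon>_def by (simp add: power_mult_distrib flip: power_mult)
    then show ?thesis unfolding u2 by simp
  qed
  have TN: "integrable M (\<lambda>x. indicator T x * (N2 x ^ 4 * exp (- V0 x)))"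
    using integrable_mult_indicator[OF T_sets N2_moment(1)] by simp
  have eu_int: "integrable M (\<lambda>x. (\<epsilon> x)\<^sup>2 * (u x)\<^sup>2)"
    unfolding eu_eq using TN by simp
  have "(LINT x|M. (\<epsilon> x)\<^sup>2 * (u x)\<^sup>2) = b\<^sup>2 * \<tau> ^ 4 / z0 * (LINT x|M. indicator T x * (N2 x ^ 4 * exp (- V0 x)))"
    unfolding eu_eq by simp
  also have "\<dots> \<le> b\<^sup>2 * \<tau> ^ 4 / z0 * (Q * S ^ 4 * Z0)"
  proof (rule mult_left_mono)
    have "(LINT x|M. indicator T x * (N2 x ^ 4 * exp (- V0 x))) \<le> (LINT x|M. N2 x ^ 4 * exp (- V0 x))"
      by (rule integral_mono[OF TN N2_moment(1)]) (auto simp: indicator_def)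
    then show "(LINT x|M. indicator T x * (N2 x ^ 4 * exp (- V0 x))) \<le> Q * S ^ 4 * Z0"
      using N2_moment(2) by linarith
    show "0 \<le> b\<^sup>2 * \<tau> ^ 4 / z0" using z by simp
  qed
  also have "\<dots> = b\<^sup>2 * Q * t ^ 4 * (Z0 / z0)" unfolding t_def by (simp add: power_mult_distrib)
  also have "\<dots> \<le> b\<^sup>2 * Q * t ^ 4 * 2"
    using z Q_pos by (intro mult_left_mono) (auto simp: field_simps)
  also have "\<dots> = \<theta>\<^sup>2" unfolding \<theta>_def G_def using Q_pos by (simp add: power_mult_distrib flip: power_mult)
  finally have eu: "(LINT x|M. (\<epsilon> x)\<^sup>2 * (u x)\<^sup>2) \<le> \<theta>\<^sup>2" .
  let ?R = "\<lambda>x. sqrt (z0 * z1) * (u x * v x + ((\<epsilon> x)\<^sup>2 * (u x)\<^sup>2 / \<theta> + \<theta> * (v x)\<^sup>2))"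
  have "sqrt (z0 * z1) \<le> sqrt ((LINT x|M. indicator T x * exp (- (V0 x + V1 x) / 2 + b * \<tau>\<^sup>2 * (N2 x)\<^sup>2))\<^sup>2)"
    unfolding z0_def z1_def by (intro real_sqrt_le_mono mass_T_prod_le)
  also have "\<dots> = (LINT x|M. indicator T x * exp (- (V0 x + V1 x) / 2 + b * \<tau>\<^sup>2 * (N2 x)\<^sup>2))"
    by (simp add: Bochner_Integration.integral_nonneg)
  also have "\<dots> \<le> (LINT x|M. ?R x)"
  proof (rule integral_mono[OF tilted_int])
    show "integrable M ?R" using uv_int eu_int int by auto
    fix x
    show "indicator T x * exp (- (V0 x + V1 x) / 2 + b * \<tau>\<^sup>2 * (N2 x)\<^sup>2) \<le> ?R x"
    proof (cases "x \<in> T")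
      case True
      have \<epsilon>: "0 \<le> \<epsilon> x" "\<epsilon> x \<le> 1" using eps_le_1[OF True] b_pos unfolding \<epsilon>_def by auto
      have "exp (\<epsilon> x) \<le> 1 + \<epsilon> x + (\<epsilon> x)\<^sup>2" by (rule exp_bound[OF \<epsilon>])
      also have "\<dots> \<le> 1 + 2 * \<epsilon> x" using \<epsilon> mult_left_mono[of "\<epsilon> x" 1 "\<epsilon> x"] by (simp add: power2_eq_square)
      finally have e: "exp (\<epsilon> x) \<le> 1 + 2 * \<epsilon> x" .
      have p: "0 \<le> u x * v x" unfolding uv using z by simp
      have "indicator T x * exp (- (V0 x + V1 x) / 2 + b * \<tau>\<^sup>2 * (N2 x)\<^sup>2) = sqrt (z0 * z1) * (u x * v x * exp (\<epsilon> x))"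
        unfolding uv exp_add \<epsilon>_def using z True by simp
      also have "\<dots> \<le> sqrt (z0 * z1) * (u x * v x * (1 + 2 * \<epsilon> x))"
        using e p z by (intro mult_left_mono) auto
      also have "\<dots> = sqrt (z0 * z1) * (u x * v x + 2 * ((\<epsilon> x * u x) * v x))" by (simp add: algebra_simps)
      also have "\<dots> \<le> ?R x"
        using amgm_param[OF \<theta>, of "\<epsilon> x * u x" "v x"] z by (intro mult_left_mono) (auto simp: power_mult_distrib)
      finally show ?thesis .
    next
      case False
      then show ?thesis using z \<theta> by (auto simp: uv intro!: mult_nonneg_nonneg add_nonneg_nonneg)
    qed
  qed
  also have "\<dots> = sqrt (z0 * z1) * ((LINT x|M. u x * v x) + ((LINT x|M. (\<epsilon> x)\<^sup>2 * (u x)\<^sup>2) / \<theta> + \<theta> * 1))"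
    using uv_int eu_int int one by simp
  also have "\<dots> \<le> sqrt (z0 * z1) * ((LINT x|M. u x * v x) + (\<theta>\<^sup>2 / \<theta> + \<theta> * 1))"
    using eu \<theta> z by (intro mult_left_mono add_left_mono add_right_mono divide_right_mono) auto
  finally have "sqrt (z0 * z1) * 1 \<le> sqrt (z0 * z1) * ((LINT x|M. u x * v x) + (\<theta>\<^sup>2 / \<theta> + \<theta> * 1))" by simp
  then have "1 \<le> (LINT x|M. u x * v x) + (\<theta>\<^sup>2 / \<theta> + \<theta> * 1)"
    using z by (simp only: mult_le_cancel_left_pos real_sqrt_gt_zero mult_pos_pos)
  then have "1 - 2 * \<theta> \<le> (LINT x|M. u x * v x)" using \<theta> by (simp add: power2_eq_square)
  then have aff: "1 - (sqrt (2 * G) * t)\<^sup>2 \<le> (LINT x|M. u x * v x)"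
    unfolding \<theta>_def using G_pos by (simp add: power_mult_distrib)
  have \<eta>: "0 < sqrt (2 * G) * t" using G_pos t_pos by simp
  have "(LINT x|M. indicator A x * (u x)\<^sup>2) = mass V0 (A \<inter> T) / z0"
    unfolding u2 mass_def by (simp add: indicator_inter_arith mult.assoc)
  moreover have "(LINT x|M. indicator A x * (v x)\<^sup>2) = mass V1 (A \<inter> T) / z1"
    unfolding v2 mass_def by (simp add: indicator_inter_arith mult.assoc)
  ultimately show ?thesis
    using hellinger_bound[OF _ _ A int one aff \<eta>] by (simp add: z0_def z1_def)
qed

text \<open>The inequality \<open>pen_borell\<close> only says that the mass of \<open>space M - T\<close> is either small or large
  relative to that of \<open>U\<close>. For a strong penalty \<open>s\<close> it is small, and it varies continuously with \<open>s\<close>, so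
  it is small for \<open>s = 0\<close> too.\<close>

definition pen :: "real \<Rightarrow> (nat \<Rightarrow> real) \<Rightarrow> real" where "pen s x = V1 x + s * N2 x"

lemma pen_meas [measurable]: "pen s \<in> borel_measurable M" unfolding pen_def by measurable

lemma pen_int: "s \<ge> 0 \<Longrightarrow> integrable M (\<lambda>x. exp (- pen s x))"
  by (rule Bochner_Integration.integrable_bound[OF V1_int]) (auto simp: pen_def N2_nonneg)

text \<open>By \<open>N2_midpt_gt\<close> the midpoint of a point outside \<open>T\<close> and a
  point of \<open>U\<close> lies outside \<open>U\<close>, and the penalised potential is still
  midpoint convex.\<close>

lemma pen_borell:
  assumes s: "s \<ge> 0"
  shows "mass (pen s) (space M - T) * mass (pen s) U \<le> (mass (pen s) (space M - U))\<^sup>2"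
  unfolding mass_def
proof (rule prekopa_leindler_integral[OF finI])
  fix x y assume xy: "x \<in> space M" "y \<in> space M"
  let ?z = "midpt I x y"
  show "indicator (space M - T) x * exp (- pen s x) * (indicator U y * exp (- pen s y)) \<le> (indicator (space M - U) ?z * exp (- pen s ?z))\<^sup>2"
  proof (cases "x \<notin> T \<and> y \<in> U")
    case True
    then have "N2 ?z > r" using N2_midpt_gt[of x y] xy by (auto simp: T_def U_def)
    then have z: "?z \<in> space M - U" using midpt_space[OF xy] by (auto simp: U_def)
    have "2 * pen s ?z \<le> pen s x + pen s y"
      using V1_conv[OF xy] mult_left_mono[OF N2_midpt[of x y] s] unfolding pen_def by (simp add: algebra_simps)
    then have "exp (- pen s x + - pen s y) \<le> exp (- pen s ?z + - pen s ?z)" by simp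
    then have "exp (- pen s x) * exp (- pen s y) \<le> (exp (- pen s ?z))\<^sup>2" by (simp only: exp_add power2_eq_square)
    then show ?thesis using True z xy by simp
  qed auto
qed (use mass_int[OF pen_int[OF s]] in auto)

lemma pen_continuous:
  assumes [measurable]: "X \<in> sets M"
  shows "continuous_on {0..} (\<lambda>s. mass (pen s) X)"
  unfolding continuous_on_sequentially
proof (intro ballI allI impI)
  fix u :: "nat \<Rightarrow> real" and s assume "s \<in> {0..}" and u: "(\<forall>n. u n \<in> {0..}) \<and> u \<longlonglongrightarrow> s"
  show "((\<lambda>s. mass (pen s) X) \<circ> u) \<longlonglongrightarrow> mass (pen s) X"
    unfolding mass_def comp_def
  proof (rule integral_dominated_convergence[where w="\<lambda>x. exp (- V1 x)"])
    show "AE x in M. (\<lambda>n. indicator X x * exp (- pen (u n) x)) \<longlonglongrightarrow> indicator X x * exp (- pen s x)"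
      unfolding pen_def using u by (intro AE_I2 tendsto_intros) auto
    show "AE x in M. norm (indicator X x * exp (- pen (u n) x)) \<le> exp (- V1 x)" for n
      unfolding pen_def using u N2_nonneg by (auto simp: indicator_def)
  qed (use V1_int in measurable)
qed

text \<open>With \<open>a'\<close>, \<open>b'\<close>, \<open>c'\<close> the penalised masses of
  \<open>U\<close>, of \<open>T - U\<close> and of the complement of \<open>T\<close>,
  \<open>pen_borell\<close> reads \<open>c' * a' \<le> (b' + c')\<^sup>2\<close>, where
  \<open>b' \<le> e * a'\<close>. This quadratic inequality excludes the value
  \<open>c' = a' / 4\<close>, which a continuous path from large to small \<open>c'\<close> would
  have to cross.\<close>

lemma V1_tail:
  assumes B: "mass V1 (T - U) \<le> e * mass V1 U" and e: "e \<le> 1 / 5" "e \<ge> 0" and A: "0 < mass V1 U"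
  shows "mass V1 (space M - T) \<le> e * mass V1 U"
proof -
  have pen0: "pen 0 = V1" unfolding pen_def by auto
  define a' b' c' where "a' s = mass (pen s) U" and "b' s = mass (pen s) (T - U)" and "c' s = mass (pen s) (space M - T)" for s
  have nn: "0 \<le> a' s" "0 \<le> b' s" "0 \<le> c' s" for s unfolding a'_def b'_def c'_def by (auto intro: mass_nonneg)
  have cont: "continuous_on {0..} a'" "continuous_on {0..} c'"
    unfolding a'_def c'_def by (intro pen_continuous; measurable)+
  have scale_ge: "exp (- s * q) * mass V1 X \<le> mass (pen s) X"
    if "s \<ge> 0" and X: "X \<in> sets M" "\<And>x. x \<in> X \<Longrightarrow> N2 x \<le> q" for s q X
  proof -
    have "exp (- s * q) * mass V1 X = (LINT x|M. exp (- s * q) * (indicator X x * exp (- V1 x)))" unfolding mass_def by simp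
    also have "\<dots> \<le> mass (pen s) X" unfolding mass_def
    proof (rule integral_mono)
      show "integrable M (\<lambda>x. exp (- s * q) * (indicator X x * exp (- V1 x)))" using mass_int[OF V1_int X(1)] by simp
      show "integrable M (\<lambda>x. indicator X x * exp (- pen s x))" by (rule mass_int[OF pen_int[OF that(1)] X(1)])
      show "exp (- s * q) * (indicator X x * exp (- V1 x)) \<le> indicator X x * exp (- pen s x)" for x
        using X(2)[of x] mult_left_mono[of "N2 x" q s] that(1) by (auto simp: indicator_def pen_def simp flip: exp_add)
    qed
    finally show ?thesis .
  qed
  have scale_le: "mass (pen s) X \<le> exp (- s * q) * mass V1 X"
    if "s \<ge> 0" and X: "X \<in> sets M" "\<And>x. x \<in> X \<Longrightarrow> q \<le> N2 x" for s q X
  proof -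
    have "mass (pen s) X \<le> (LINT x|M. exp (- s * q) * (indicator X x * exp (- V1 x)))" unfolding mass_def
    proof (rule integral_mono)
      show "integrable M (\<lambda>x. exp (- s * q) * (indicator X x * exp (- V1 x)))" using mass_int[OF V1_int X(1)] by simp
      show "integrable M (\<lambda>x. indicator X x * exp (- pen s x))" by (rule mass_int[OF pen_int[OF that(1)] X(1)])
      show "indicator X x * exp (- pen s x) \<le> exp (- s * q) * (indicator X x * exp (- V1 x))" for x
        using X(2)[of x] mult_left_mono[of q "N2 x" s] that(1) by (auto simp: indicator_def pen_def simp flip: exp_add)
    qed
    also have "\<dots> = exp (- s * q) * mass V1 X" unfolding mass_def by simp
    finally show ?thesis .
  qed
  have apos: "a' s \<ge> exp (- s * r) * mass V1 U" if "s \<ge> 0" for s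
    unfolding a'_def by (rule scale_ge) (use that in \<open>auto simp: U_def\<close>)
  have apos': "a' s > 0" if "s \<ge> 0" for s using apos[OF that] A by (smt (verit) exp_gt_zero mult_pos_pos)
  \<comment> \<open>The penalty is at most \<open>s * r\<close> on \<open>U\<close> and at least
    \<open>s * r\<close> on \<open>T - U\<close>, so it can only lower the ratio of the two
    masses.\<close>
  have ble: "b' s \<le> e * a' s" if "s \<ge> 0" for s
  proof -
    have "b' s \<le> exp (- s * r) * mass V1 (T - U)"
      unfolding b'_def by (rule scale_le) (use that in \<open>auto simp: U_def T_def\<close>)
    also have "\<dots> \<le> exp (- s * r) * (e * mass V1 U)" using B by (intro mult_left_mono) auto
    also have "\<dots> = e * (exp (- s * r) * mass V1 U)" by simp
    also have "\<dots> \<le> e * a' s" using apos[OF that] e by (intro mult_left_mono) auto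
    finally show ?thesis .
  qed
  have main: "c' s * a' s \<le> (e * a' s + c' s)\<^sup>2" if "s \<ge> 0" for s
  proof -
    have eq: "(T - U) \<union> (space M - T) = space M - U" using U_subset_T unfolding T_def U_def by auto
    have "mass (pen s) (space M - U) = b' s + c' s"
      unfolding b'_def c'_def eq[symmetric] by (rule mass_Un) (use pen_int[OF that] in auto)
    then have "c' s * a' s \<le> (b' s + c' s)\<^sup>2" using pen_borell[OF that] unfolding a'_def c'_def by simp
    also have "\<dots> \<le> (e * a' s + c' s)\<^sup>2" using ble[OF that] nn by (intro power_mono) auto
    finally show ?thesis .
  qed
  \<comment> \<open>At this value the bracket is at most \<open>1/5 + 1/4 = 9/20\<close> times
    \<open>a' s\<close>, and \<open>81/400 < 1/4\<close>.\<close>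
  have ne: "c' s \<noteq> a' s / 4" if "s \<ge> 0" for s
  proof
    assume c: "c' s = a' s / 4"
    have "(a' s)\<^sup>2 / 4 = c' s * a' s" by (simp add: c power2_eq_square)
    also have "\<dots> \<le> (e * a' s + c' s)\<^sup>2" by (rule main[OF that])
    also have "\<dots> \<le> (9/20 * a' s)\<^sup>2"
      using e apos'[OF that] mult_right_mono[of e "1/5" "a' s"] by (intro power_mono) (auto simp: c)
    finally have "(a' s)\<^sup>2 / 4 \<le> 81/400 * (a' s)\<^sup>2" by (simp add: power_mult_distrib power_divide)
    then show False using apos'[OF that] zero_less_power[of "a' s" 2] by linarith
  qed
  have "c' 0 < a' 0 / 4"
  proof (rule ccontr)
    assume "\<not> c' 0 < a' 0 / 4"
    then have c0: "c' 0 - a' 0 / 4 \<ge> 0" by simp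
    \<comment> \<open>Relative to \<open>U\<close>, the penalty gains a factor
      \<open>exp (- 8 * s * r)\<close> outside \<open>T\<close>. Since \<open>exp x \<ge> x\<close>,
      this \<open>s\<close> is large enough to reach the ratio 1/4.\<close>
    define s where "s = mass V1 (space M - T) / (2 * r * mass V1 U)"
    have s: "s \<ge> 0" unfolding s_def using A r_pos mass_nonneg[of V1 "space M - T"] by auto
    have "c' s \<le> exp (- s * (9 * r)) * mass V1 (space M - T)"
      unfolding c'_def by (rule scale_le) (use s in \<open>auto simp: T_def\<close>)
    also have "\<dots> = exp (- s * r) * (exp (- (8 * s * r)) * mass V1 (space M - T))"
      by (simp add: algebra_simps flip: exp_add mult.assoc)
    also have "\<dots> \<le> exp (- s * r) * (mass V1 U / 4)"
    proof (rule mult_left_mono)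
      have "mass V1 (space M - T) = (8 * s * r) * (mass V1 U / 4)" unfolding s_def using A r_pos by simp
      also have "\<dots> \<le> exp (8 * s * r) * (mass V1 U / 4)"
        using exp_ge_add_one_self[of "8 * s * r"] A by (intro mult_right_mono) linarith+
      finally have "exp (- (8 * s * r)) * mass V1 (space M - T) \<le> exp (- (8 * s * r)) * (exp (8 * s * r) * (mass V1 U / 4))"
        by (intro mult_left_mono) auto
      also have "\<dots> = mass V1 U / 4" by (simp add: exp_minus)
      finally show "exp (- (8 * s * r)) * mass V1 (space M - T) \<le> mass V1 U / 4" .
    qed simp
    also have "\<dots> \<le> a' s / 4" using apos[OF s] by simp
    finally have cs: "c' s - a' s / 4 \<le> 0" by simp
    have "\<exists>x\<ge>0. x \<le> s \<and> c' x - a' x / 4 = 0"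
      by (rule IVT2'[OF cs c0 s]) (intro continuous_intros continuous_on_subset[OF cont(1)] continuous_on_subset[OF cont(2)]; auto)
    then show False using ne by auto
  qed
  then have lt: "c' 0 \<le> a' 0 / 4" by simp
  \<comment> \<open>Given \<open>C \<le> A' / 4\<close>, the quadratic inequality becomes linear:
    \<open>C\<close> keeps the coefficient \<open>1 - 2/5 - 1/4 = 7/20\<close>, which exceeds the
    1/5 in front of \<open>e * A'\<close>.\<close>
  define A' C where "A' = a' 0" and "C = c' 0"
  have "C * A' \<le> (e * A' + C)\<^sup>2" using main[of 0] unfolding A'_def C_def by simp
  also have "\<dots> = e * A' * (e * A') + 2 * (e * A') * C + C * C" by (simp add: power2_eq_square algebra_simps)
  also have "\<dots> \<le> (1/5 * A') * (e * A') + 2 * (1/5 * A') * C + (A' / 4) * C"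
    using e nn[of 0] lt unfolding A'_def C_def by (intro add_mono mult_right_mono mult_left_mono) auto
  finally have "A' * C \<le> A' * (1/5 * (e * A') + 2/5 * C + C / 4)" by (simp add: algebra_simps)
  then have "C \<le> 1/5 * (e * A') + 2/5 * C + C / 4"
    using apos'[of 0] unfolding A'_def by simp
  moreover have "0 \<le> e * A'" using e nn unfolding A'_def by simp
  ultimately have "C \<le> e * A'" by linarith
  then show ?thesis unfolding A'_def C_def a'_def c'_def pen0 .
qed

section \<open>Total variation of the untruncated measures\<close>

definition K where "K = 5 * Q / \<kappa> ^ 4 + 9 * sqrt (2 * G)"

lemma K_pos: "0 < K" unfolding K_def using Q_pos \<kappa>_pos G_pos by (simp add: add_pos_pos)

text \<open>Conditioning on \<open>T\<close> changes the probability by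
  \<open>q - (p / z) * c'\<close> divided by \<open>Z\<close>, and both terms lie between 0 and
  \<open>c'\<close>.\<close>

lemma restrict_bound:
  assumes V: "integrable M (\<lambda>x. exp (- V x))" and A [measurable]: "A \<in> sets M" and T: "0 < mass V T"
    and Z: "Z = mass V (space M)" and c: "mass V (space M - T) \<le> \<delta> * Z"
  shows "\<bar>mass V A / Z - mass V (A \<inter> T) / mass V T\<bar> \<le> \<delta>"
proof -
  define p q z c' where "p = mass V (A \<inter> T)" and "q = mass V (A - T)" and "z = mass V T" and "c' = mass V (space M - T)"
  have 1: "mass V A = p + q"
    unfolding p_def q_def by (subst mass_Un[symmetric]) (use V in \<open>auto simp: Int_Diff_Un\<close>)
  have 2: "Z = z + c'"
    unfolding Z z_def c'_def by (subst mass_Un[symmetric]) (use V in \<open>auto simp: T_def intro: arg_cong[where f="mass V"]\<close>)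
  have 3: "0 \<le> p" "0 \<le> q" "0 \<le> c'" "0 < z" unfolding p_def q_def c'_def z_def using T by (auto intro: mass_nonneg)
  have 4: "q \<le> c'" unfolding q_def c'_def by (rule mass_mono[OF V]) (use sets.sets_into_space[OF A] in auto)
  have 5: "p \<le> z" unfolding p_def z_def by (rule mass_mono[OF V]) auto
  have Zp: "Z > 0" using 2 3 by simp
  have "mass V A / Z - p / z = (q - (p / z) * c') / Z"
    unfolding 1 using Zp 3 by (simp add: 2 field_simps)
  moreover have "\<bar>q - (p / z) * c'\<bar> \<le> c'"
  proof -
    have pz: "0 \<le> p / z" "p / z \<le> 1" using 3 5 by auto
    have "0 \<le> (p / z) * c'" using pz(1) 3(3) by (rule mult_nonneg_nonneg)
    moreover have "(p / z) * c' \<le> 1 * c'" using pz(2) 3(3) by (rule mult_right_mono)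
    ultimately have "0 \<le> (p / z) * c'" "(p / z) * c' \<le> c'" by simp_all
    then show ?thesis using 3 4 by linarith
  qed
  ultimately have "\<bar>mass V A / Z - p / z\<bar> \<le> c' / Z"
    using Zp by (simp add: abs_divide divide_right_mono)
  also have "\<dots> \<le> \<delta>" using c Zp unfolding c'_def by (simp add: field_simps)
  finally show ?thesis unfolding p_def z_def .
qed

theorem TV_bound:
  assumes t1: "t \<le> 1" and t2: "10 * K * t \<le> 1" and A [measurable]: "A \<in> sets M"
  shows "\<bar>mass V1 A / Z1 - mass V0 A / Z0\<bar> \<le> K * t"
proof -
  define \<alpha> where "\<alpha> = Q / \<kappa> ^ 4 * t ^ 4"
  define \<delta> where "\<delta> = 3 * (sqrt (2 * G) * t)"
  have \<alpha>0: "0 \<le> \<alpha>" unfolding \<alpha>_def using Q_pos \<kappa>_pos t_pos by simp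
  have \<delta>0: "0 \<le> \<delta>" unfolding \<delta>_def using G_pos t_pos by simp
  have "t ^ 4 \<le> t" using t_pos t1 power_decreasing[of 1 4 t] by simp
  then have "\<alpha> \<le> Q / \<kappa> ^ 4 * t" unfolding \<alpha>_def using Q_pos \<kappa>_pos by (intro mult_left_mono) auto
  then have "5 * \<alpha> \<le> 5 * (Q / \<kappa> ^ 4 * t)" by simp
  also have "\<dots> = K * t - 3 * \<delta>" unfolding K_def \<delta>_def by (simp add: algebra_simps)
  finally have sum: "5 * \<alpha> + 3 * \<delta> \<le> K * t" by simp
  have t3: "K * t \<le> 1 / 10" using t2 by simp
  then have h: "\<alpha> \<le> 1 / 2" using sum \<delta>0 \<alpha>0 by linarith
  note Tp = mass_T_pos[OF h[unfolded \<alpha>_def]]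
  have TU: "T \<inter> U = U" "(T - U) \<inter> T = T - U" using U_subset_T by auto
  have m0: "mass V0 (space M - U) \<le> \<alpha> * Z0" using mass_V0_tail unfolding \<alpha>_def .
  have m0T: "mass V0 (space M - T) \<le> \<alpha> * Z0"
    by (rule order_trans[OF mass_mono[OF V0_int] m0]) (use U_subset_T in auto)
  have m0TU: "mass V0 (T - U) \<le> \<alpha> * Z0"
    by (rule order_trans[OF mass_mono[OF V0_int] m0]) (auto simp: T_def)
  have "mass V0 (T - U) / mass V0 T \<le> 2 * \<alpha>"
    using m0TU Tp mult_left_mono[OF Tp(1), of "2 * \<alpha>"] \<alpha>0 by (simp add: pos_divide_le_eq)
  \<comment> \<open>The truncated comparison is first used on the shell \<open>T - U\<close>: it
    transfers from \<open>V0\<close> to \<open>V1\<close> that the shell is light, which is the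
    input of \<open>V1_tail\<close>.\<close>
  then have ratio: "mass V1 (T - U) / mass V1 T \<le> 2 * \<alpha> + \<delta>"
    using truncated_TV[OF h[unfolded \<alpha>_def], of "T - U"] unfolding TU \<delta>_def by (auto simp: abs_le_iff)
  \<comment> \<open>The outer factor 2 converts a share of \<open>T\<close> into a share of
    \<open>U\<close>, which carries at least half of the \<open>V1\<close>-mass of
    \<open>T\<close>.\<close>
  define e where "e = 2 * (2 * \<alpha> + \<delta>)"
  have "0 \<le> e" unfolding e_def using \<alpha>0 \<delta>0 by simp
  moreover have "e \<le> 5 * \<alpha> + 3 * \<delta>" unfolding e_def using \<alpha>0 \<delta>0 by (simp add: algebra_simps)
  then have "e \<le> 1 / 5" using order_trans[OF sum t3] by simp
  ultimately have e: "0 \<le> e" "e \<le> 1 / 5" .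
  have split: "mass V1 T = mass V1 U + mass V1 (T - U)"
    by (subst mass_Un[symmetric]) (use V1_int U_subset_T in \<open>auto simp: Un_absorb1\<close>)
  have B1: "mass V1 (T - U) \<le> e / 2 * mass V1 T"
  proof -
    have "mass V1 (T - U) \<le> (2 * \<alpha> + \<delta>) * mass V1 T" using ratio Tp by (simp add: pos_divide_le_eq)
    also have "2 * \<alpha> + \<delta> = e / 2" unfolding e_def by simp
    finally show ?thesis .
  qed
  have "e / 2 * mass V1 T \<le> 1 / 2 * mass V1 T" using e Tp by (intro mult_right_mono) auto
  then have half: "mass V1 T \<le> 2 * mass V1 U" using B1 split by linarith
  then have Upos: "0 < mass V1 U" using Tp by simp
  have "e / 2 * mass V1 T \<le> e / 2 * (2 * mass V1 U)" using half e by (intro mult_left_mono) auto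
  then have "mass V1 (T - U) \<le> e * mass V1 U" using B1 by simp
  from V1_tail[OF this e(2,1) Upos] have "mass V1 (space M - T) \<le> e * mass V1 U" .
  also have "\<dots> \<le> e * Z1"
    using mass_mono[OF V1_int U_sets, of "space M"] e unfolding mass_space[symmetric]
    by (intro mult_left_mono) (auto simp: U_def)
  finally have m1: "mass V1 (space M - T) \<le> e * Z1" .
  have "\<bar>mass V1 A / Z1 - mass V1 (A \<inter> T) / mass V1 T\<bar> \<le> e"
    by (rule restrict_bound[OF V1_int A Tp(3) mass_space(2)[symmetric] m1])
  moreover have "\<bar>mass V0 A / Z0 - mass V0 (A \<inter> T) / mass V0 T\<bar> \<le> \<alpha>"
    by (rule restrict_bound[OF V0_int A Tp(2) mass_space(1)[symmetric] m0T])
  moreover have "\<bar>mass V0 (A \<inter> T) / mass V0 T - mass V1 (A \<inter> T) / mass V1 T\<bar> \<le> \<delta>"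
    using truncated_TV[OF h[unfolded \<alpha>_def] A] unfolding \<delta>_def .
  \<comment> \<open>Truncation costs \<open>e = 4 * \<alpha> + 2 * \<delta>\<close> for
    \<open>V1\<close> and \<open>\<alpha>\<close> for \<open>V0\<close>, the comparison
    \<open>\<delta>\<close>. This is the 5 in \<open>K\<close> and, with the 3 inside
    \<open>\<delta>\<close>, the 9.\<close>
  ultimately have "\<bar>mass V1 A / Z1 - mass V0 A / Z0\<bar> \<le> e + \<alpha> + \<delta>" by linarith
  also have "\<dots> = 5 * \<alpha> + 3 * \<delta>" unfolding e_def by simp
  also note sum
  finally show ?thesis .
qed

end

section \<open>Positive definite matrices and Gibbs measures\<close>

text \<open>Symmetric Gaussian elimination: removing one variable leaves a Schur complement that is
  again symmetric and positive definite. Matrices are functions on an index set because the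
  dimension \<open>p\<close> is a variable.\<close>

lemma pos_def_solvable:
  fixes A :: "nat \<Rightarrow> nat \<Rightarrow> real"
  assumes "finite I"
    and "\<And>i j. A i j = A j i"
    and "\<And>u. (\<exists>i\<in>I. u i \<noteq> 0) \<Longrightarrow> 0 < (\<Sum>i\<in>I. \<Sum>j\<in>I. u i * A i j * u j)"
  shows "\<exists>x. \<forall>i\<in>I. (\<Sum>j\<in>I. A i j * x j) = b i"
  using assms
proof (induction I arbitrary: A b rule: finite_induct)
  case empty
  then show ?case by simp
next
  case (insert k I)
  note sym = insert.prems(1) and pd = insert.prems(2)
  have "0 < (\<Sum>i\<in>insert k I. \<Sum>j\<in>insert k I. (if i = k then 1 else 0) * A i j * (if j = k then 1 else 0))"
    using pd[of "\<lambda>i. if i = k then 1 else 0"] by auto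
  also have "\<dots> = A k k"
  proof -
    have "(\<Sum>j\<in>insert k I. (if i = k then 1 else 0) * A i j * (if j = k then 1 else 0)) = (if i = k then A k k else 0)" for i
      using insert(1,2) by (simp add: sum.delta if_distrib[of "\<lambda>x. _ * x"] cong: if_cong)
    then show ?thesis using insert(1,2) by simp
  qed
  finally have a: "0 < A k k" .
  \<comment> \<open>the Schur complement of \<open>A k k\<close>\<close>
  define A' where "A' i j = A i j - A k i * A k j / A k k" for i j
  have sym': "A' i j = A' j i" for i j unfolding A'_def using sym[of i j] by simp
  have pd': "0 < (\<Sum>i\<in>I. \<Sum>j\<in>I. u i * A' i j * u j)" if u: "\<exists>i\<in>I. u i \<noteq> 0" for u
  proof -
    define s where "s = (\<Sum>j\<in>I. A k j * u j)"
    \<comment> \<open>This value minimises the quadratic form in coordinate \<open>k\<close>; the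
      minimum is the form of the Schur complement.\<close>
    define v where "v = u(k := - s / A k k)"
    have v: "v i = u i" if "i \<in> I" for i using that insert(2) unfolding v_def by auto
    have vk: "v k = - s / A k k" unfolding v_def by simp
    have "0 < (\<Sum>i\<in>insert k I. \<Sum>j\<in>insert k I. v i * A i j * v j)"
      using u v by (intro pd) force
    also have "\<dots> = v k * A k k * v k + (\<Sum>j\<in>I. v k * A k j * v j) + ((\<Sum>i\<in>I. v i * A i k * v k) + (\<Sum>i\<in>I. \<Sum>j\<in>I. v i * A i j * v j))"
      using insert(1,2) by (simp add: sum.distrib)
    also have "(\<Sum>j\<in>I. v k * A k j * v j) = v k * s"
      unfolding s_def sum_distrib_left by (intro sum.cong) (auto simp: v)
    also have "(\<Sum>i\<in>I. v i * A i k * v k) = v k * s"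
      unfolding s_def sum_distrib_left by (intro sum.cong) (auto simp: v sym[of _ k])
    also have "(\<Sum>i\<in>I. \<Sum>j\<in>I. v i * A i j * v j) = (\<Sum>i\<in>I. \<Sum>j\<in>I. u i * A i j * u j)"
      by (intro sum.cong) (auto simp: v)
    also have "v k * A k k * v k + v k * s + (v k * s + (\<Sum>i\<in>I. \<Sum>j\<in>I. u i * A i j * u j))
        = (\<Sum>i\<in>I. \<Sum>j\<in>I. u i * A i j * u j) - s * s / A k k"
      unfolding vk using a by (simp add: field_simps)
    also have "s * s / A k k = (\<Sum>i\<in>I. \<Sum>j\<in>I. u i * (A k i * A k j / A k k) * u j)"
      unfolding s_def sum_product sum_divide_distrib by (intro sum.cong refl) (simp add: ac_simps)
    also have "(\<Sum>i\<in>I. \<Sum>j\<in>I. u i * A i j * u j) - \<dots> = (\<Sum>i\<in>I. \<Sum>j\<in>I. u i * A' i j * u j)"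
      unfolding A'_def by (simp add: sum_subtractf algebra_simps)
    finally show ?thesis .
  qed
  obtain x where x: "\<And>i. i \<in> I \<Longrightarrow> (\<Sum>j\<in>I. A' i j * x j) = b i - A i k * b k / A k k"
    using insert.IH[OF sym' pd', of "\<lambda>i. b i - A i k * b k / A k k"] by auto
  define s where "s = (\<Sum>j\<in>I. A k j * x j)"
  \<comment> \<open>Back substitution from equation \<open>k\<close>.\<close>
  define y where "y = x(k := (b k - s) / A k k)"
  have y: "(\<Sum>j\<in>I. A i j * y j) = (\<Sum>j\<in>I. A i j * x j)" for i
    unfolding y_def using insert(2) by (intro sum.cong) auto
  show ?case
  proof (intro exI ballI)
    fix i assume i: "i \<in> insert k I"
    have eq: "(\<Sum>j\<in>insert k I. A i j * y j) = A i k * ((b k - s) / A k k) + (\<Sum>j\<in>I. A i j * x j)"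
      using insert(1,2) by (simp add: y) (simp add: y_def)
    show "(\<Sum>j\<in>insert k I. A i j * y j) = b i"
    proof (cases "i = k")
      case True
      then show ?thesis unfolding eq using a by (simp add: s_def)
    next
      case False
      then have "b i - A i k * b k / A k k = (\<Sum>j\<in>I. A' i j * x j)" using x i by simp
      also have "\<dots> = (\<Sum>j\<in>I. A i j * x j) - A k i * s / A k k"
        unfolding A'_def s_def sum_distrib_left sum_divide_distrib sum_subtractf[symmetric]
        by (intro sum.cong) (auto simp: algebra_simps)
      finally show ?thesis unfolding eq sym[of i k] using a by (simp add: field_simps)
    qed
  qed
qed

lemma id_mat_sum:
  "i \<in> {1..p} \<Longrightarrow> (\<Sum>j=1..p. id_mat i j * g j) = g i"
  "i \<in> {1..p} \<Longrightarrow> (\<Sum>j=1..p. g j * id_mat j i) = g i"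
  unfolding id_mat_def
  by (simp_all add: if_distrib[of "\<lambda>x. x * _"] if_distrib[of "\<lambda>x. _ * x"] sum.delta sum.delta' cong: if_cong)

text \<open>Solving for the unit vectors gives a right inverse. Symmetry of \<open>A\<close> makes
  that inverse symmetric, hence also a left inverse.\<close>

lemma mat_inverses_exist:
  assumes sym: "\<And>i j. A i j = A j i"
    and pd: "\<And>u. (\<exists>i\<in>{1..p}. u i \<noteq> 0) \<Longrightarrow> 0 < quad_form p A u"
  shows "\<exists>B. mat_inverses p A B"
proof -
  have "\<exists>x. \<forall>i\<in>{1..p}. (\<Sum>j=1..p. A i j * x j) = id_mat i k" for k
    by (rule pos_def_solvable) (use sym pd in \<open>auto simp: quad_form_def\<close>)
  then obtain B where B: "\<And>i k. i \<in> {1..p} \<Longrightarrow> (\<Sum>j=1..p. A i j * B k j) = id_mat i k"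
    by metis
  \<comment> \<open>Both entries equal the pairing, through the symmetric \<open>A\<close>, of the
    solutions with indices \<open>i\<close> and \<open>k\<close>.\<close>
  have Bsym: "B i k = B k i" if i: "i \<in> {1..p}" and k: "k \<in> {1..p}" for i k
  proof -
    have "B i k = (\<Sum>j=1..p. B i j * id_mat j k)" using id_mat_sum(2)[OF k] by simp
    also have "\<dots> = (\<Sum>j=1..p. \<Sum>l=1..p. B i j * (A j l * B k l))"
    proof (rule sum.cong[OF refl])
      fix j assume "j \<in> {1..p}"
      from B[OF this, of k] show "B i j * id_mat j k = (\<Sum>l=1..p. B i j * (A j l * B k l))"
        by (simp only: sum_distrib_left[symmetric])
    qed
    also have "\<dots> = (\<Sum>l=1..p. \<Sum>j=1..p. B i j * (A j l * B k l))" by (rule sum.swap)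
    also have "\<dots> = (\<Sum>l=1..p. (\<Sum>j=1..p. A l j * B i j) * B k l)"
    proof (rule sum.cong[OF refl])
      fix l
      show "(\<Sum>j=1..p. B i j * (A j l * B k l)) = (\<Sum>j=1..p. A l j * B i j) * B k l"
        unfolding sum_distrib_right
      proof (rule sum.cong[OF refl])
        fix j
        show "B i j * (A j l * B k l) = A l j * B i j * B k l" by (simp add: sym[of j l])
      qed
    qed
    also have "\<dots> = (\<Sum>l=1..p. id_mat l i * B k l)" using B by (intro sum.cong refl) (simp only:)
    also have "\<dots> = B k i" using id_mat_sum(2)[OF i, of "B k"] by (simp add: mult.commute)
    finally show ?thesis .
  qed
  have "mat_inverses p A (\<lambda>j k. B k j)"
    unfolding mat_inverses_def
  proof (intro ballI conjI)
    fix i k assume i: "i \<in> {1..p}" and k: "k \<in> {1..p}"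
    show "(\<Sum>j=1..p. A i j * B k j) = id_mat i k" by (rule B[OF i])
    have "(\<Sum>j=1..p. B i j * A j k) = (\<Sum>j=1..p. A k j * B i j)"
    proof (rule sum.cong[OF refl])
      fix j
      show "B i j * A j k = A k j * B i j" by (simp add: sym[of j k])
    qed
    moreover have "(\<Sum>j=1..p. B i j * A j k) = (\<Sum>j=1..p. B j i * A j k)"
    proof (rule sum.cong[OF refl])
      fix j assume "j \<in> {1..p}"
      then show "B i j * A j k = B j i * A j k" using Bsym[OF i] by simp
    qed
    ultimately have "(\<Sum>j=1..p. B j i * A j k) = (\<Sum>j=1..p. A k j * B i j)" by simp
    then show "(\<Sum>j=1..p. B j i * A j k) = id_mat i k" using B[OF k, of i] by (simp add: id_mat_def)
  qed
  then show ?thesis by blast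
qed

text \<open>The chosen inverse is determined only at indices in \<open>{1..p}\<close>, so the usual
  associativity argument is carried out entrywise. The double inverse arises because
  \<open>laplace_approx\<close> hands an inverse Hessian to \<open>gaussian\<close>, which inverts
  its covariance.\<close>

lemma mat_inv_mat_inv:
  assumes ex: "\<exists>B. mat_inverses p A B" and i: "i \<in> {1..p}" and k: "k \<in> {1..p}"
  shows "mat_inv p (mat_inv p A) i k = A i k"
proof -
  define B where "B = mat_inv p A"
  define C where "C = mat_inv p B"
  have AB: "mat_inverses p A B" unfolding B_def mat_inv_def using ex by (rule someI_ex)
  then have "mat_inverses p B A" unfolding mat_inverses_def by auto
  then have BC: "mat_inverses p B C" unfolding C_def mat_inv_def by (rule someI[where P="mat_inverses p B"])
  have "C i k = (\<Sum>j=1..p. id_mat i j * C j k)" using id_mat_sum(1)[OF i] by simp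
  also have "\<dots> = (\<Sum>j=1..p. \<Sum>l=1..p. A i l * B l j * C j k)"
    using AB i unfolding mat_inverses_def by (intro sum.cong refl) (simp flip: sum_distrib_right)
  also have "\<dots> = (\<Sum>l=1..p. \<Sum>j=1..p. A i l * B l j * C j k)" by (rule sum.swap)
  also have "\<dots> = (\<Sum>l=1..p. A i l * (\<Sum>j=1..p. B l j * C j k))"
    by (simp add: sum_distrib_left mult.assoc)
  also have "\<dots> = (\<Sum>l=1..p. A i l * id_mat l k)"
    using BC k unfolding mat_inverses_def by (intro sum.cong refl) simp
  also have "\<dots> = A i k" by (rule id_mat_sum(2)[OF k])
  finally show ?thesis unfolding C_def B_def .
qed

text \<open>A product of normal densities up to constants; it is the majorant for both Gibbs
  weights.\<close>

lemma integrable_exp_neg_square: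
  assumes "finite I"
  shows "integrable (vec_space I) (\<lambda>x. exp (- (1/2) * (\<Sum>k\<in>I. (x k - m k)\<^sup>2)))"
proof -
  have 1: "integrable lborel (\<lambda>x. exp (- (1/2) * (x - c)\<^sup>2))" for c :: real
  proof -
    have "integrable lborel (\<lambda>x. sqrt (2 * pi) * normal_density c 1 x)"
      by (intro integrable_mult_right integrable_normal_density) auto
    then show ?thesis by (simp add: normal_density_def)
  qed
  have "integrable (vec_space I) (\<lambda>x. \<Prod>k\<in>I. exp (- (1/2) * (x k - m k)\<^sup>2))"
    by (rule lborel_product.product_integrable_prod[OF assms 1])
  then show ?thesis by (simp add: sum_distrib_left exp_sum[OF assms, symmetric])
qed

lemma measure_gibbs:
  fixes V :: "(nat \<Rightarrow> real) \<Rightarrow> real"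
  assumes V: "integrable (lborel_vec p) (\<lambda>x. exp (- V x))" and A: "A \<in> sets (lborel_vec p)"
    and Z: "0 < (LINT x|lborel_vec p. exp (- V x))"
  shows "measure (gibbs p V) A = (LINT x|lborel_vec p. indicator A x * exp (- V x)) / (LINT x|lborel_vec p. exp (- V x))"
proof -
  let ?Z = "LINT x|lborel_vec p. exp (- V x)"
  have m: "(\<lambda>x. ennreal (exp (- V x) / ?Z)) \<in> borel_measurable (lborel_vec p)"
    using borel_measurable_integrable[OF V] by measurable
  have i: "integrable (lborel_vec p) (\<lambda>x. indicator A x * exp (- V x) / ?Z)"
    using integrable_mult_indicator[OF A V] by simp
  have "emeasure (gibbs p V) A = (\<integral>\<^sup>+x. ennreal (exp (- V x) / ?Z) * indicator A x \<partial>lborel_vec p)"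
    unfolding gibbs_def by (rule emeasure_density[OF m A])
  also have "\<dots> = (\<integral>\<^sup>+x. ennreal (indicator A x * exp (- V x) / ?Z) \<partial>lborel_vec p)"
    by (intro nn_integral_cong) (auto simp: indicator_def)
  also have "\<dots> = ennreal (LINT x|lborel_vec p. indicator A x * exp (- V x) / ?Z)"
    by (rule nn_integral_eq_integral[OF i]) (use Z in auto)
  finally show ?thesis
    unfolding measure_def using Z by (simp add: Bochner_Integration.integral_nonneg)
qed

section \<open>Penalised likelihood of an exponential family\<close>

text \<open>Subtracting \<open>c / 2 * s\<^sup>2\<close> reduces this to the tangent inequality for
  a convex function. A negative \<open>c\<close> is allowed, so upper Taylor bounds follow by
  applying it to the negated function.\<close>

lemma second_order_lower:
  fixes g g1 g2 :: "real \<Rightarrow> real"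
  assumes C: "convex C" and x: "x \<in> C" and y: "y \<in> C"
    and d1: "\<And>s. (g has_real_derivative g1 s) (at s)" and d2: "\<And>s. (g1 has_real_derivative g2 s) (at s)"
    and c: "\<And>s. s \<in> C \<Longrightarrow> c \<le> g2 s"
  shows "g x + g1 x * (y - x) + c / 2 * (y - x)\<^sup>2 \<le> g y"
proof -
  have "(g1 x - c * x) * (y - x) \<le> (g y - c / 2 * y\<^sup>2) - (g x - c / 2 * x\<^sup>2)"
  proof (rule f''_imp_f'[OF C])
    show "((\<lambda>s. g s - c / 2 * s\<^sup>2) has_real_derivative g1 s - c * s) (at s)" for s
      by (rule derivative_eq_intros d1 refl)+ simp
    show "((\<lambda>s. g1 s - c * s) has_real_derivative g2 s - c) (at s)" for s
      by (rule derivative_eq_intros d2 refl)+ simp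
    show "0 \<le> g2 s - c" if "s \<in> C" for s using c[OF that] by simp
  qed (use x y in auto)
  then show ?thesis by (simp add: power2_eq_square algebra_simps)
qed

lemma parallelogram:
  fixes p q r c :: real
  shows "r * (p - c)\<^sup>2 + r * (q - c)\<^sup>2 = 2 * (r * ((p + q) / 2 - c)\<^sup>2) + 2 * (r * ((p - q) / 2)\<^sup>2)"
  by (simp add: power2_eq_square field_simps)

lemma mat_inverses_cong:
  assumes "\<And>i k. i \<in> {1..p} \<Longrightarrow> k \<in> {1..p} \<Longrightarrow> A i k = A' i k"
  shows "mat_inverses p A B \<longleftrightarrow> mat_inverses p A' B"
  unfolding mat_inverses_def
  by (intro ball_cong refl arg_cong2[where f="(\<and>)"] arg_cong2[where f="(=)"] sum.cong) (auto simp: assms)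

text \<open>The design matrix \<open>X\<close> is arbitrary here; the inverse problem enters only
  through the hypotheses of \<open>glm_bounds\<close>.\<close>

locale glm =
  fixes h h1 h2 h3 :: "real \<Rightarrow> real" and X :: "nat \<Rightarrow> nat \<Rightarrow> real" and \<gamma> :: real
    and n p :: nat and Y \<theta>h :: "nat \<Rightarrow> real"
  assumes dh: "\<And>s. (h has_real_derivative h1 s) (at s)"
    and dh1: "\<And>s. (h1 has_real_derivative h2 s) (at s)"
    and dh2: "\<And>s. (h2 has_real_derivative h3 s) (at s)"
    and h2_pos: "\<And>s. 0 < h2 s"
    and \<gamma>: "0 \<le> \<gamma>"
    and min: "is_arg_min (neg_log_post h X \<gamma> n p Y) (\<lambda>\<theta>. \<theta> \<in> space (lborel_vec p)) \<theta>h"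
begin

abbreviation "F \<equiv> neg_log_post h X \<gamma> n p Y"
definition G :: "nat \<Rightarrow> real" where "G k = real k powr (2 * \<gamma>)"
definition dot :: "nat \<Rightarrow> (nat \<Rightarrow> real) \<Rightarrow> real" where "dot j \<theta> = (\<Sum>k=1..p. X j k * \<theta> k)"
definition a where "a j = dot j \<theta>h"
definition H :: "nat \<Rightarrow> nat \<Rightarrow> real" where
  "H k l = (\<Sum>j=1..n. h2 (a j) * X j k * X j l) + (if k = l then G k else 0)"

lemma F_eq: "F \<theta> = (\<Sum>j=1..n. h (dot j \<theta>) - Y j * dot j \<theta>) + 1/2 * (\<Sum>k=1..p. G k * (\<theta> k)\<^sup>2)"
  unfolding neg_log_post_def neg_log_lik_def dot_def G_def ..

lemma G_ge_1: "1 \<le> k \<Longrightarrow> 1 \<le> G k"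
  unfolding G_def using \<gamma> by (simp add: ge_one_powr_ge_zero)

lemma G_pos: "1 \<le> k \<Longrightarrow> 0 < G k"
  using G_ge_1[of k] by linarith

lemma dot_diff: "dot j (\<lambda>k. \<theta> k - \<theta>' k) = dot j \<theta> - dot j \<theta>'"
  unfolding dot_def by (simp add: sum_subtractf algebra_simps)

section \<open>Derivatives of the penalised likelihood\<close>

lemma dot_update: "l \<in> {1..p} \<Longrightarrow> dot j (\<theta>(l := s)) = dot j \<theta> + X j l * (s - \<theta> l)"
proof -
  assume l: "l \<in> {1..p}"
  have "dot j (\<theta>(l := s)) = X j l * s + (\<Sum>k\<in>{1..p} - {l}. X j k * \<theta> k)"
    unfolding dot_def using l by (subst sum.remove[of _ l]) auto
  moreover have "dot j \<theta> = X j l * \<theta> l + (\<Sum>k\<in>{1..p} - {l}. X j k * \<theta> k)"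
    unfolding dot_def using l by (subst sum.remove[of _ l]) auto
  ultimately show ?thesis by (simp add: algebra_simps)
qed

definition grad :: "nat \<Rightarrow> (nat \<Rightarrow> real) \<Rightarrow> real" where
  "grad l \<theta> = (\<Sum>j=1..n. (h1 (dot j \<theta>) - Y j) * X j l) + G l * \<theta> l"

lemma dot_update_deriv:
  "l \<in> {1..p} \<Longrightarrow> ((\<lambda>s. dot j (\<theta>(l := s))) has_real_derivative X j l) (at s)"
  by (auto simp: dot_update intro!: derivative_eq_intros)

lemma F_deriv:
  assumes l: "l \<in> {1..p}"
  shows "((\<lambda>s. F (\<theta>(l := s))) has_real_derivative grad l (\<theta>(l := s))) (at s)"
proof -
  have q: "((\<lambda>s. \<Sum>k=1..p. G k * ((\<theta>(l := s)) k)\<^sup>2) has_real_derivative 2 * (G l * s)) (at s)"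
  proof -
    have "(\<Sum>k=1..p. G k * ((\<theta>(l := s)) k)\<^sup>2) = G l * s\<^sup>2 + (\<Sum>k\<in>{1..p} - {l}. G k * (\<theta> k)\<^sup>2)" for s
      using l by (subst sum.remove[of _ l]) auto
    then show ?thesis by (auto intro!: derivative_eq_intros)
  qed
  have t: "((\<lambda>s. h (dot j (\<theta>(l := s)))) has_real_derivative h1 (dot j (\<theta>(l := s))) * X j l) (at s)" for j
    by (rule DERIV_chain2[OF dh dot_update_deriv[OF l]])
  have "((\<lambda>s. (\<Sum>j=1..n. h (dot j (\<theta>(l := s))) - Y j * dot j (\<theta>(l := s))) + 1/2 * (\<Sum>k=1..p. G k * ((\<theta>(l := s)) k)\<^sup>2))
      has_real_derivative (\<Sum>j=1..n. h1 (dot j (\<theta>(l := s))) * X j l - Y j * X j l) + 1/2 * (2 * (G l * s))) (at s)"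
    by (intro DERIV_add DERIV_sum DERIV_diff t DERIV_cmult q dot_update_deriv l)
  then show ?thesis unfolding F_eq grad_def by (simp add: algebra_simps)
qed

lemma F_partial: "l \<in> {1..p} \<Longrightarrow> partial l F = grad l"
  unfolding partial_def using DERIV_imp_deriv[OF F_deriv] by (auto simp: fun_eq_iff)

lemma F_hessian:
  assumes k: "k \<in> {1..p}" and l: "l \<in> {1..p}"
  shows "hessian F \<theta>h k l = H k l"
proof -
  have t: "((\<lambda>s. h1 (dot j (\<theta>h(k := s)))) has_real_derivative h2 (dot j (\<theta>h(k := s))) * X j k) (at s)" for j s
    by (rule DERIV_chain2[OF dh1 dot_update_deriv[OF k]])
  have u: "((\<lambda>s. (\<theta>h(k := s)) l) has_real_derivative (if k = l then 1 else 0)) (at s)" for s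
    by (auto intro!: derivative_eq_intros)
  have "((\<lambda>s. (\<Sum>j=1..n. (h1 (dot j (\<theta>h(k := s))) - Y j) * X j l) + G l * (\<theta>h(k := s)) l)
     has_real_derivative (\<Sum>j=1..n. (h2 (dot j (\<theta>h(k := s))) * X j k - 0) * X j l) + G l * (if k = l then 1 else 0)) (at s)" for s
    by (intro DERIV_add DERIV_sum DERIV_diff DERIV_cmult_right DERIV_const t DERIV_cmult u)
  from DERIV_imp_deriv[OF this[of "\<theta>h k"]]
  have "partial k (grad l) \<theta>h = (\<Sum>j=1..n. (h2 (dot j \<theta>h) * X j k) * X j l) + G l * (if k = l then 1 else 0)"
    unfolding partial_def grad_def by simp
  then show ?thesis unfolding hessian_def F_partial[OF l] H_def a_def by simp
qed

lemma \<theta>h_space: "\<theta>h \<in> space (lborel_vec p)" and F_min: "\<theta> \<in> space (lborel_vec p) \<Longrightarrow> F \<theta>h \<le> F \<theta>"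
  using min unfolding is_arg_min_def by (auto simp: not_less)

lemma grad_zero:
  assumes l: "l \<in> {1..p}"
  shows "grad l \<theta>h = 0"
proof (rule DERIV_local_min)
  show "((\<lambda>s. F (\<theta>h(l := s))) has_real_derivative grad l \<theta>h) (at (\<theta>h l))"
    using F_deriv[OF l, of \<theta>h "\<theta>h l"] by simp
  \<comment> \<open>Changing a coordinate in \<open>{1..p}\<close> stays in the space of extensional
    functions, so the constrained minimiser is a critical point.\<close>
  have "\<theta>h(l := s) \<in> space (lborel_vec p)" for s
    using \<theta>h_space l by (auto simp: space_PiM PiE_iff extensional_def)
  then show "\<forall>s. \<bar>\<theta>h l - s\<bar> < 1 \<longrightarrow> F (\<theta>h(l := \<theta>h l)) \<le> F (\<theta>h(l := s))"
    using F_min by simp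
qed simp

section \<open>The potentials, centred at the mode\<close>

definition V0 :: "(nat \<Rightarrow> real) \<Rightarrow> real" where
  "V0 \<theta> = 1/2 * ((\<Sum>j=1..n. h2 (a j) * (dot j \<theta> - a j)\<^sup>2) + (\<Sum>k=1..p. G k * (\<theta> k - \<theta>h k)\<^sup>2))"

text \<open>A Bregman divergence of \<open>h\<close> for each observation, plus the penalty
  recentred at \<open>\<theta>h\<close>. The data \<open>Y\<close> act only through
  \<open>\<theta>h\<close>.\<close>

definition V1 :: "(nat \<Rightarrow> real) \<Rightarrow> real" where
  "V1 \<theta> = (\<Sum>j=1..n. h (dot j \<theta>) - h (a j) - h1 (a j) * (dot j \<theta> - a j)) + 1/2 * (\<Sum>k=1..p. G k * (\<theta> k - \<theta>h k)\<^sup>2)"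

text \<open>The vanishing gradient at \<open>\<theta>h\<close>, paired with the displacement from
  \<open>\<theta>h\<close>, supplies exactly the linear terms to be subtracted.\<close>

lemma F_V1: "F \<theta> = F \<theta>h + V1 \<theta>"
proof -
  have "0 = (\<Sum>l=1..p. grad l \<theta>h * (\<theta> l - \<theta>h l))" using grad_zero by simp
  also have "\<dots> = (\<Sum>l=1..p. \<Sum>j=1..n. (h1 (a j) - Y j) * (X j l * (\<theta> l - \<theta>h l))) + (\<Sum>l=1..p. G l * \<theta>h l * (\<theta> l - \<theta>h l))"
    unfolding grad_def a_def by (simp add: sum_distrib_right sum.distrib distrib_right mult.assoc)
  also have "(\<Sum>l=1..p. \<Sum>j=1..n. (h1 (a j) - Y j) * (X j l * (\<theta> l - \<theta>h l))) = (\<Sum>j=1..n. (h1 (a j) - Y j) * dot j (\<lambda>k. \<theta> k - \<theta>h k))"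
    unfolding dot_def sum_distrib_left by (rule sum.swap)
  also have "\<dots> = (\<Sum>j=1..n. (h1 (a j) - Y j) * (dot j \<theta> - a j))" by (simp add: dot_diff a_def)
  finally have g: "0 = (\<Sum>j=1..n. (h1 (a j) - Y j) * (dot j \<theta> - a j)) + (\<Sum>l=1..p. G l * \<theta>h l * (\<theta> l - \<theta>h l))" .
  have sq: "(\<Sum>k=1..p. G k * (\<theta> k)\<^sup>2) = (\<Sum>k=1..p. G k * (\<theta>h k)\<^sup>2) + (\<Sum>k=1..p. G k * (\<theta> k - \<theta>h k)\<^sup>2) + 2 * (\<Sum>l=1..p. G l * \<theta>h l * (\<theta> l - \<theta>h l))"
    unfolding sum_distrib_left sum.distrib[symmetric] by (intro sum.cong refl) (simp add: power2_eq_square algebra_simps)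
  have hs: "(\<Sum>j=1..n. h (dot j \<theta>) - Y j * dot j \<theta>) = (\<Sum>j=1..n. h (a j) - Y j * a j)
      + (\<Sum>j=1..n. h (dot j \<theta>) - h (a j) - h1 (a j) * (dot j \<theta> - a j)) + (\<Sum>j=1..n. (h1 (a j) - Y j) * (dot j \<theta> - a j))"
    unfolding sum.distrib[symmetric] by (intro sum.cong refl) (simp add: algebra_simps)
  show ?thesis
    unfolding F_eq[of \<theta>] F_eq[of \<theta>h] V1_def sq hs a_def[symmetric] using g by (simp add: algebra_simps)
qed

lemma quad_form_H: "quad_form p H u = (\<Sum>j=1..n. h2 (a j) * (dot j u)\<^sup>2) + (\<Sum>k=1..p. G k * (u k)\<^sup>2)"
proof -
  have "quad_form p H u = (\<Sum>k=1..p. \<Sum>l=1..p. (\<Sum>j=1..n. h2 (a j) * ((X j k * u k) * (X j l * u l))) + (if k = l then G k * u k * u l else 0))"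
    unfolding quad_form_def H_def
    by (intro sum.cong refl) (auto simp: distrib_left distrib_right sum_distrib_left sum_distrib_right ac_simps)
  also have "\<dots> = (\<Sum>k=1..p. \<Sum>l=1..p. \<Sum>j=1..n. h2 (a j) * ((X j k * u k) * (X j l * u l))) + (\<Sum>k=1..p. G k * (u k)\<^sup>2)"
    by (simp add: sum.distrib power2_eq_square mult.assoc)
  also have "(\<Sum>k=1..p. \<Sum>l=1..p. \<Sum>j=1..n. h2 (a j) * ((X j k * u k) * (X j l * u l)))
      = (\<Sum>k=1..p. \<Sum>j=1..n. \<Sum>l=1..p. h2 (a j) * ((X j k * u k) * (X j l * u l)))"
    by (intro sum.cong refl sum.swap)
  also have "\<dots> = (\<Sum>j=1..n. \<Sum>k=1..p. \<Sum>l=1..p. h2 (a j) * ((X j k * u k) * (X j l * u l)))"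
    by (rule sum.swap)
  also have "\<dots> = (\<Sum>j=1..n. h2 (a j) * (dot j u)\<^sup>2)"
  proof (rule sum.cong[OF refl])
    fix j
    have "(dot j u)\<^sup>2 = (\<Sum>k=1..p. \<Sum>l=1..p. (X j k * u k) * (X j l * u l))"
      unfolding dot_def power2_eq_square sum_product ..
    then show "(\<Sum>k=1..p. \<Sum>l=1..p. h2 (a j) * ((X j k * u k) * (X j l * u l))) = h2 (a j) * (dot j u)\<^sup>2"
      by (simp only: sum_distrib_left)
  qed
  finally show ?thesis .
qed

lemma V0_quad: "V0 \<theta> = 1/2 * quad_form p H (\<lambda>k. \<theta> k - \<theta>h k)"
  unfolding V0_def quad_form_H dot_diff a_def ..

lemma H_inverse:
  assumes "i \<in> {1..p}" "k \<in> {1..p}"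
  shows "mat_inv p (mat_inv p (hessian F \<theta>h)) i k = H i k"
proof -
  have "\<exists>B. mat_inverses p H B"
  proof (rule mat_inverses_exist)
    show "H i j = H j i" for i j unfolding H_def by (auto intro!: sum.cong)
    fix u :: "nat \<Rightarrow> real" assume "\<exists>i\<in>{1..p}. u i \<noteq> 0"
    then obtain i where i: "i \<in> {1..p}" "u i \<noteq> 0" by auto
    have "0 < (\<Sum>k=1..p. G k * (u k)\<^sup>2)"
      by (rule sum_pos2[OF _ i(1)]) (use i in \<open>auto simp: G_pos less_imp_le\<close>)
    moreover have "0 \<le> (\<Sum>j=1..n. h2 (a j) * (dot j u)\<^sup>2)" using h2_pos by (intro sum_nonneg) (auto simp: less_imp_le)
    ultimately show "0 < quad_form p H u" unfolding quad_form_H by simp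
  qed
  moreover have "mat_inverses p H B \<longleftrightarrow> mat_inverses p (hessian F \<theta>h) B" for B
    by (rule mat_inverses_cong) (simp add: F_hessian)
  ultimately have "\<exists>B. mat_inverses p (hessian F \<theta>h) B" by simp
  from mat_inv_mat_inv[OF this assms] show ?thesis using F_hessian assms by simp
qed

lemma laplace_approx_eq: "laplace_approx p F \<theta>h = gibbs p V0"
proof -
  have "quad_form p (mat_inv p (mat_inv p (hessian F \<theta>h))) u = quad_form p H u" for u
    unfolding quad_form_def using H_inverse by (intro sum.cong refl) simp
  then show ?thesis unfolding laplace_approx_def gaussian_def V0_quad[abs_def] by simp
qed

lemma gibbs_F: "gibbs p F = gibbs p V1"
proof -
  obtain c where c: "c = exp (- F \<theta>h)" by simp
  have "exp (- F \<theta>) = c * exp (- V1 \<theta>)" for \<theta> unfolding c F_V1[of \<theta>] by (simp flip: exp_add)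
  moreover have "c > 0" unfolding c by simp
  ultimately show ?thesis unfolding gibbs_def by simp
qed

end

text \<open>\<open>dot_bound\<close> controls a single predictor, \<open>dot_sum\<close> all of them
  in square sum, and \<open>coercive\<close> bounds the Hessian from below by the weights
  \<open>W\<close>. \<open>radius\<close> keeps the predictors on the ball within 1 of those at the
  mode, which is why \<open>m0\<close> and \<open>C3\<close> refer to \<open>C0 + 1\<close>.\<close>

locale glm_bounds = glm +
  fixes w W :: "nat \<Rightarrow> real" and m0 C3 C0 Mb Cb a0 b \<tau> \<kappa> :: real
  assumes p1: "1 \<le> p"
    and w_pos: "\<And>k. k \<in> {1..p} \<Longrightarrow> 0 < w k" and w_le_W: "\<And>k. k \<in> {1..p} \<Longrightarrow> w k \<le> W k"
    and pos: "0 < a0" "0 < b" "0 < \<tau>" "0 < \<kappa>" "0 \<le> C3" "0 \<le> Cb" "0 \<le> Mb" "0 \<le> m0"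
    and aj: "\<And>j. j \<in> {1..n} \<Longrightarrow> \<bar>a j\<bar> \<le> C0"
    and m0: "\<And>s. \<bar>s\<bar> \<le> C0 + 1 \<Longrightarrow> m0 \<le> h2 s"
    and C3: "\<And>s. \<bar>s\<bar> \<le> C0 + 1 \<Longrightarrow> \<bar>h3 s\<bar> \<le> C3"
    and dot_bound: "\<And>j d. j \<in> {1..n} \<Longrightarrow> (dot j d)\<^sup>2 \<le> Mb\<^sup>2 * \<tau>\<^sup>2 * (\<Sum>k=1..p. w k * (d k)\<^sup>2)"
    and dot_sum: "\<And>d. (\<Sum>j=1..n. (dot j d)\<^sup>2) \<le> Cb * (\<Sum>k=1..p. w k * (d k)\<^sup>2)"
    and coercive: "\<And>d. a0 * (\<Sum>k=1..p. W k * (d k)\<^sup>2) \<le> m0 * (\<Sum>j=1..n. (dot j d)\<^sup>2) + (\<Sum>k=1..p. G k * (d k)\<^sup>2)"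
    and radius: "9 * Mb\<^sup>2 * \<kappa> * \<tau> \<le> 1"
    and b_ge: "(C3 * Cb * Mb)\<^sup>2 \<le> 32 * a0 * b" and small: "81 * b * \<kappa>\<^sup>2 \<le> 1"
begin

abbreviation "M \<equiv> lborel_vec p"

section \<open>Measurability and integrability of the potentials\<close>

lemma dot_meas [measurable]: "dot j \<in> borel_measurable M"
proof -
  have "(\<lambda>\<theta>. \<theta> k) \<in> borel_measurable M" if "k \<in> {1..p}" for k
    using measurable_component_singleton[OF that, of "\<lambda>_. lborel :: real measure"] by simp
  then show ?thesis unfolding dot_def[abs_def] by (intro borel_measurable_sum borel_measurable_times) auto
qed

lemma sq_meas [measurable]: "(\<lambda>\<theta>. \<Sum>k=1..p. G k * (\<theta> k - \<theta>h k)\<^sup>2) \<in> borel_measurable M"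
proof -
  have "(\<lambda>\<theta>. \<theta> k) \<in> borel_measurable M" if "k \<in> {1..p}" for k
    using measurable_component_singleton[OF that, of "\<lambda>_. lborel :: real measure"] by simp
  then show ?thesis by (intro borel_measurable_sum borel_measurable_times borel_measurable_power borel_measurable_diff) auto
qed

lemma h_meas [measurable]: "h \<in> borel_measurable borel"
  by (intro borel_measurable_continuous_onI continuous_at_imp_continuous_on ballI DERIV_isCont[OF dh])

lemma V0_meas [measurable]: "V0 \<in> borel_measurable M" unfolding V0_def[abs_def] by measurable
lemma V1_meas [measurable]: "V1 \<in> borel_measurable M" unfolding V1_def[abs_def] by measurable

lemma h_tangent: "h x + h1 x * (y - x) \<le> h y"
  using second_order_lower[OF convex_UNIV UNIV_I UNIV_I dh dh1, of 0 x y] h2_pos by (simp add: less_imp_le)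

lemma G_sum_ge: "(\<Sum>k=1..p. (\<theta> k - \<theta>h k)\<^sup>2) \<le> (\<Sum>k=1..p. G k * (\<theta> k - \<theta>h k)\<^sup>2)"
proof (rule sum_mono)
  fix k assume "k \<in> {1..p}"
  then have "1 * (\<theta> k - \<theta>h k)\<^sup>2 \<le> G k * (\<theta> k - \<theta>h k)\<^sup>2" using G_ge_1 by (intro mult_right_mono) auto
  then show "(\<theta> k - \<theta>h k)\<^sup>2 \<le> G k * (\<theta> k - \<theta>h k)\<^sup>2" by simp
qed

lemma V_ge:
  "1/2 * (\<Sum>k=1..p. (\<theta> k - \<theta>h k)\<^sup>2) \<le> V0 \<theta>" "1/2 * (\<Sum>k=1..p. (\<theta> k - \<theta>h k)\<^sup>2) \<le> V1 \<theta>"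
proof -
  have "0 \<le> (\<Sum>j=1..n. h2 (a j) * (dot j \<theta> - a j)\<^sup>2)" using h2_pos by (intro sum_nonneg) (auto simp: less_imp_le)
  then show "1/2 * (\<Sum>k=1..p. (\<theta> k - \<theta>h k)\<^sup>2) \<le> V0 \<theta>" unfolding V0_def using G_sum_ge[of \<theta>] by simp
  have "0 \<le> (\<Sum>j=1..n. h (dot j \<theta>) - h (a j) - h1 (a j) * (dot j \<theta> - a j))"
    using h_tangent[of "a _" "dot _ \<theta>"] by (intro sum_nonneg) (simp add: algebra_simps)
  then show "1/2 * (\<Sum>k=1..p. (\<theta> k - \<theta>h k)\<^sup>2) \<le> V1 \<theta>" unfolding V1_def using G_sum_ge[of \<theta>] by simp
qed

lemma V_int: "integrable M (\<lambda>\<theta>. exp (- V0 \<theta>))" "integrable M (\<lambda>\<theta>. exp (- V1 \<theta>))"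
proof -
  show "integrable M (\<lambda>\<theta>. exp (- V0 \<theta>))"
    by (rule Bochner_Integration.integrable_bound[OF integrable_exp_neg_square[of "{1..p}" \<theta>h]])
      (measurable, use V_ge in simp)
  show "integrable M (\<lambda>\<theta>. exp (- V1 \<theta>))"
    by (rule Bochner_Integration.integrable_bound[OF integrable_exp_neg_square[of "{1..p}" \<theta>h]])
      (measurable, use V_ge in simp)
qed

section \<open>Convexity and the local comparison of the two potentials\<close>

lemma dot_midpt: "dot j (midpt {1..p} x y) = (dot j x + dot j y) / 2"
proof -
  have "dot j (midpt {1..p} x y) = (\<Sum>k=1..p. (X j k * x k + X j k * y k) / 2)"
    unfolding dot_def by (intro sum.cong refl) (simp add: algebra_simps)
  then show ?thesis unfolding dot_def by (simp add: sum.distrib flip: sum_divide_distrib)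
qed

lemma dot_half_diff: "dot j (\<lambda>k. (x k - y k) / 2) = (dot j x - dot j y) / 2"
proof -
  have "dot j (\<lambda>k. (x k - y k) / 2) = (\<Sum>k=1..p. (X j k * x k - X j k * y k) / 2)"
    unfolding dot_def by (intro sum.cong refl) (simp add: algebra_simps)
  then show ?thesis unfolding dot_def by (simp add: sum_subtractf flip: sum_divide_distrib)
qed

lemma aj_le: "j \<in> {1..n} \<Longrightarrow> m0 \<le> h2 (a j)"
  using aj[of j] by (intro m0) simp

lemma V0_refl: "V0 (\<lambda>k\<in>{1..p}. 2 * \<theta>h k - x k) = V0 x"
proof -
  have "dot j (\<lambda>k\<in>{1..p}. 2 * \<theta>h k - x k) = (\<Sum>k=1..p. 2 * (X j k * \<theta>h k) - X j k * x k)" for j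
    unfolding dot_def by (intro sum.cong refl) (simp add: algebra_simps)
  then have d: "dot j (\<lambda>k\<in>{1..p}. 2 * \<theta>h k - x k) - a j = - (dot j x - a j)" for j
    unfolding dot_def a_def by (simp add: sum_subtractf flip: sum_distrib_left)
  have "(\<Sum>k=1..p. G k * ((\<lambda>k\<in>{1..p}. 2 * \<theta>h k - x k) k - \<theta>h k)\<^sup>2) = (\<Sum>k=1..p. G k * (x k - \<theta>h k)\<^sup>2)"
    by (intro sum.cong refl) (simp add: power2_eq_square algebra_simps)
  then show ?thesis unfolding V0_def d power2_minus by (simp only:)
qed

text \<open>For a quadratic function the parallelogram identity is exact; the gain is the Hessian
  form at the half difference, bounded below by \<open>coercive\<close>.\<close>

lemma V0_par:
  "2 * V0 (midpt {1..p} x y) + a0 * (\<Sum>k=1..p. W k * ((x k - y k) / 2)\<^sup>2) \<le> V0 x + V0 y"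
proof -
  define d where "d k = (x k - y k) / 2" for k
  let ?z = "midpt {1..p} x y"
  have dd: "dot j d = (dot j x - dot j y) / 2" for j unfolding d_def by (rule dot_half_diff)
  have 1: "(\<Sum>j=1..n. h2 (a j) * (dot j x - a j)\<^sup>2) + (\<Sum>j=1..n. h2 (a j) * (dot j y - a j)\<^sup>2)
     = 2 * (\<Sum>j=1..n. h2 (a j) * (dot j ?z - a j)\<^sup>2) + 2 * (\<Sum>j=1..n. h2 (a j) * (dot j d)\<^sup>2)"
    unfolding sum_distrib_left sum.distrib[symmetric] dot_midpt dd
    by (intro sum.cong refl) (simp only: parallelogram restrict_apply')
  have 2: "(\<Sum>k=1..p. G k * (x k - \<theta>h k)\<^sup>2) + (\<Sum>k=1..p. G k * (y k - \<theta>h k)\<^sup>2)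
     = 2 * (\<Sum>k=1..p. G k * (?z k - \<theta>h k)\<^sup>2) + 2 * (\<Sum>k=1..p. G k * (d k)\<^sup>2)"
    unfolding sum_distrib_left sum.distrib[symmetric] d_def
    by (intro sum.cong refl) (simp only: parallelogram restrict_apply')
  have "V0 x + V0 y = 2 * V0 ?z + ((\<Sum>j=1..n. h2 (a j) * (dot j d)\<^sup>2) + (\<Sum>k=1..p. G k * (d k)\<^sup>2))"
    unfolding V0_def distrib_left using 1 2 by linarith
  moreover have "m0 * (\<Sum>j=1..n. (dot j d)\<^sup>2) \<le> (\<Sum>j=1..n. h2 (a j) * (dot j d)\<^sup>2)"
    unfolding sum_distrib_left using aj_le by (intro sum_mono mult_right_mono) auto
  ultimately show ?thesis using coercive[of d] unfolding d_def by linarith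
qed

lemma V1_conv: "2 * V1 (midpt {1..p} x y) \<le> V1 x + V1 y"
proof -
  let ?z = "midpt {1..p} x y"
  have 1: "2 * (\<Sum>j=1..n. h (dot j ?z) - h (a j) - h1 (a j) * (dot j ?z - a j))
     \<le> (\<Sum>j=1..n. h (dot j x) - h (a j) - h1 (a j) * (dot j x - a j)) + (\<Sum>j=1..n. h (dot j y) - h (a j) - h1 (a j) * (dot j y - a j))"
    unfolding sum_distrib_left sum.distrib[symmetric]
  proof (rule sum_mono)
    fix j
    define s t where "s = dot j x" and "t = dot j y"
    have "h ((s + t) / 2) + h1 ((s + t) / 2) * (s - (s + t) / 2) \<le> h s"
      "h ((s + t) / 2) + h1 ((s + t) / 2) * (t - (s + t) / 2) \<le> h t" by (rule h_tangent)+
    moreover have "h1 ((s + t) / 2) * (s - (s + t) / 2) + h1 ((s + t) / 2) * (t - (s + t) / 2) = 0"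
      unfolding distrib_left[symmetric] by simp
    ultimately have hm: "2 * h ((s + t) / 2) \<le> h s + h t" by linarith
    have aux: "2 * (A - B - C) \<le> A1 - B - C1 + (A2 - B - C2)" if "2 * A \<le> A1 + A2" "2 * C = C1 + C2"
      for A B C A1 C1 A2 C2 :: real using that by (simp add: algebra_simps)
    have lin: "2 * (h1 (a j) * ((s + t) / 2 - a j)) = h1 (a j) * (s - a j) + h1 (a j) * (t - a j)"
      by (simp add: field_simps)
    show "2 * (h (dot j ?z) - h (a j) - h1 (a j) * (dot j ?z - a j))
      \<le> h (dot j x) - h (a j) - h1 (a j) * (dot j x - a j) + (h (dot j y) - h (a j) - h1 (a j) * (dot j y - a j))"
      unfolding dot_midpt s_def[symmetric] t_def[symmetric] by (rule aux[OF hm lin])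
  qed
  have 2: "2 * (\<Sum>k=1..p. G k * (?z k - \<theta>h k)\<^sup>2) \<le> (\<Sum>k=1..p. G k * (x k - \<theta>h k)\<^sup>2) + (\<Sum>k=1..p. G k * (y k - \<theta>h k)\<^sup>2)"
    unfolding sum_distrib_left sum.distrib[symmetric]
  proof (rule sum_mono)
    fix k assume k: "k \<in> {1..p}"
    have "2 * ((x k + y k) / 2 - \<theta>h k)\<^sup>2 \<le> (x k - \<theta>h k)\<^sup>2 + (y k - \<theta>h k)\<^sup>2"
      using zero_le_power2[of "x k - y k"] by (simp add: power2_eq_square field_simps)
    from mult_left_mono[OF this, of "G k"] show "2 * (G k * (?z k - \<theta>h k)\<^sup>2) \<le> G k * (x k - \<theta>h k)\<^sup>2 + G k * (y k - \<theta>h k)\<^sup>2"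
      using k G_pos[of k] by (simp add: algebra_simps less_imp_le)
  qed
  show ?thesis unfolding V1_def using 1 2 by simp
qed

lemma dot_near:
  assumes j: "j \<in> {1..n}" and x: "(\<Sum>k=1..p. w k * (x k - \<theta>h k)\<^sup>2) \<le> 9 * (\<kappa> / \<tau>)"
  shows "\<bar>dot j x - a j\<bar> \<le> 1"
proof -
  have "(dot j x - a j)\<^sup>2 = (dot j (\<lambda>k. x k - \<theta>h k))\<^sup>2" by (simp add: dot_diff a_def)
  also have "\<dots> \<le> Mb\<^sup>2 * \<tau>\<^sup>2 * (\<Sum>k=1..p. w k * (x k - \<theta>h k)\<^sup>2)" by (rule dot_bound[OF j])
  also have "\<dots> \<le> Mb\<^sup>2 * \<tau>\<^sup>2 * (9 * (\<kappa> / \<tau>))" using x by (intro mult_left_mono) auto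
  also have "\<dots> = 9 * Mb\<^sup>2 * \<kappa> * \<tau>" using pos by (simp add: power2_eq_square field_simps)
  finally have "(dot j x - a j)\<^sup>2 \<le> 1" using radius by linarith
  then show ?thesis by (simp add: abs_square_le_1)
qed

text \<open>Two one-sided expansions, of \<open>h1\<close> and of its negative, each with curvature
  at least \<open>- C3\<close>.\<close>

lemma h1_taylor:
  assumes "\<bar>s\<bar> \<le> C0 + 1" "\<bar>t\<bar> \<le> C0 + 1"
  shows "\<bar>h1 t - h1 s - h2 s * (t - s)\<bar> \<le> C3 / 2 * (t - s)\<^sup>2"
proof -
  let ?C = "{- (C0 + 1)..C0 + 1}"
  have C: "convex ?C" "s \<in> ?C" "t \<in> ?C" using assms by (auto simp: abs_le_iff)
  have B: "- C3 \<le> h3 r" "- C3 \<le> - h3 r" if "r \<in> ?C" for r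
    using C3[of r] that by (auto simp: abs_le_iff)
  have "h1 s + h2 s * (t - s) + (- C3) / 2 * (t - s)\<^sup>2 \<le> h1 t"
    by (rule second_order_lower[OF C dh1 dh2]) (rule B(1))
  moreover have "- h1 s + (- h2 s) * (t - s) + (- C3) / 2 * (t - s)\<^sup>2 \<le> - h1 t"
    by (rule second_order_lower[OF C DERIV_minus[OF dh1] DERIV_minus[OF dh2]]) (rule B(2))
  ultimately show ?thesis unfolding abs_le_iff by (simp add: algebra_simps)
qed

text \<open>With \<open>z\<close> the midpoint, \<open>x = z + d\<close> and
  \<open>y = z - d\<close> on the coordinates. At \<open>z\<close> the slopes of the two potentials
  along \<open>d\<close> nearly cancel: for each \<open>j\<close> there remains a Taylor remainder
  of \<open>h1\<close> at \<open>a j\<close>, quadratic in the distance of \<open>z\<close> from the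
  mode, times \<open>dot j d\<close>. The positive quadratic terms in \<open>d\<close> from both
  potentials pay for it, leaving a square of \<open>\<tau> * N\<close>.\<close>

lemma V_loc:
  assumes x: "(\<Sum>k=1..p. w k * (x k - \<theta>h k)\<^sup>2) \<le> 9 * (\<kappa> / \<tau>)"
    and y: "(\<Sum>k=1..p. w k * (y k - \<theta>h k)\<^sup>2) \<le> 9 * (\<kappa> / \<tau>)"
  shows "V0 (midpt {1..p} x y) + V1 (midpt {1..p} x y)
      - 2 * b * \<tau>\<^sup>2 * (\<Sum>k=1..p. w k * (midpt {1..p} x y k - \<theta>h k)\<^sup>2)\<^sup>2 \<le> V0 x + V1 y"
proof -
  let ?z = "midpt {1..p} x y"
  define d where "d k = (x k - y k) / 2" for k
  define N where "N = (\<Sum>k=1..p. w k * (?z k - \<theta>h k)\<^sup>2)"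
  define D where "D = sqrt (\<Sum>k=1..p. w k * (d k)\<^sup>2)"
  have N0: "0 \<le> N" unfolding N_def using w_pos by (intro sum_nonneg) (auto simp: less_imp_le)
  have Dpre: "0 \<le> (\<Sum>k=1..p. w k * (d k)\<^sup>2)" using w_pos by (intro sum_nonneg) (auto simp: less_imp_le)
  have D0: "0 \<le> D" and D2: "D\<^sup>2 = (\<Sum>k=1..p. w k * (d k)\<^sup>2)" unfolding D_def using Dpre by auto
  have dd: "dot j d = (dot j x - dot j y) / 2" for j unfolding d_def by (rule dot_half_diff)
  have dot_d: "\<bar>dot j d\<bar> \<le> Mb * \<tau> * D" if j: "j \<in> {1..n}" for j
  proof -
    have "\<bar>dot j d\<bar>\<^sup>2 \<le> (Mb * \<tau> * D)\<^sup>2" using dot_bound[OF j, of d] by (simp add: D2 power_mult_distrib)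
    then show ?thesis by (rule power2_le_imp_le) (use pos D0 in auto)
  qed
  let ?v0 = "\<lambda>\<theta> j. 1/2 * (h2 (a j) * (dot j \<theta> - a j)\<^sup>2)"
  let ?v1 = "\<lambda>\<theta> j. h (dot j \<theta>) - h (a j) - h1 (a j) * (dot j \<theta> - a j)"
  \<comment> \<open>The coefficient \<open>m0\<close> of the square of \<open>dot j d\<close>
    collects at least \<open>m0 / 2\<close> from each of the two potentials.\<close>
  have pt: "?v0 ?z j + ?v1 ?z j - C3 / 2 * (Mb * \<tau> * D) * (dot j ?z - a j)\<^sup>2 + m0 * (dot j d)\<^sup>2 \<le> ?v0 x j + ?v1 y j"
    if j: "j \<in> {1..n}" for j
  proof -
    define q e where "q = dot j ?z" and "e = dot j d"
    have xq: "dot j x = q + e" and yq: "dot j y = q - e"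
      unfolding q_def e_def dot_midpt dd by (simp_all add: field_simps)
    have near: "\<bar>dot j x - a j\<bar> \<le> 1" "\<bar>dot j y - a j\<bar> \<le> 1" using dot_near[OF j x] dot_near[OF j y] by auto
    have "q = (dot j x + dot j y) / 2" unfolding q_def dot_midpt ..
    then have qb: "\<bar>q\<bar> \<le> C0 + 1" "\<bar>dot j y\<bar> \<le> C0 + 1" "\<bar>a j\<bar> \<le> C0 + 1"
      using near aj[OF j] by (auto simp: abs_le_iff)
    let ?C = "{- (C0 + 1)..C0 + 1}"
    have "h q + h1 q * (dot j y - q) + m0 / 2 * (dot j y - q)\<^sup>2 \<le> h (dot j y)"
      by (rule second_order_lower[OF convex_closed_interval _ _ dh dh1, of _ "- (C0 + 1)" "C0 + 1"])
        (use qb m0 in \<open>auto simp: abs_le_iff\<close>)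
    then have low: "h q - h1 q * e + m0 / 2 * e\<^sup>2 \<le> h (q - e)" unfolding yq by simp
    have "(h1 q - h1 (a j) - h2 (a j) * (q - a j)) * e \<le> \<bar>h1 q - h1 (a j) - h2 (a j) * (q - a j)\<bar> * \<bar>e\<bar>"
      unfolding abs_mult[symmetric] by (rule abs_ge_self)
    also have "\<dots> \<le> (C3 / 2 * (q - a j)\<^sup>2) * (Mb * \<tau> * D)"
      using h1_taylor[OF qb(3,1)] dot_d[OF j] pos unfolding e_def by (intro mult_mono) auto
    finally have err: "(h1 q - h1 (a j) - h2 (a j) * (q - a j)) * e \<le> C3 / 2 * (Mb * \<tau> * D) * (q - a j)\<^sup>2"
      by (simp add: ac_simps)
    have conv: "m0 / 2 * e\<^sup>2 \<le> h2 (a j) / 2 * e\<^sup>2" using aj_le[OF j] by (intro mult_right_mono) auto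
    have "1/2 * (h2 (a j) * (q + e - a j)\<^sup>2) = 1/2 * (h2 (a j) * (q - a j)\<^sup>2) + h2 (a j) * (q - a j) * e + h2 (a j) / 2 * e\<^sup>2"
      by (simp add: power2_eq_square field_simps)
    moreover have "h1 (a j) * (q - e - a j) = h1 (a j) * (q - a j) - h1 (a j) * e" by (simp add: algebra_simps)
    moreover have "(h1 q - h1 (a j) - h2 (a j) * (q - a j)) * e = h1 q * e - h1 (a j) * e - h2 (a j) * (q - a j) * e"
      by (simp add: algebra_simps)
    ultimately show ?thesis
      unfolding xq yq q_def[symmetric] e_def[symmetric] using low err conv by linarith
  qed
  have Gterm: "(\<Sum>k=1..p. G k * (x k - \<theta>h k)\<^sup>2) + (\<Sum>k=1..p. G k * (y k - \<theta>h k)\<^sup>2)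
     = 2 * (\<Sum>k=1..p. G k * (?z k - \<theta>h k)\<^sup>2) + 2 * (\<Sum>k=1..p. G k * (d k)\<^sup>2)"
  proof -
    show ?thesis
      unfolding sum_distrib_left sum.distrib[symmetric] d_def
      by (intro sum.cong refl) (simp only: parallelogram restrict_apply')
  qed
  have "(\<Sum>j=1..n. ?v0 ?z j + ?v1 ?z j - C3 / 2 * (Mb * \<tau> * D) * (dot j ?z - a j)\<^sup>2 + m0 * (dot j d)\<^sup>2) \<le> (\<Sum>j=1..n. ?v0 x j + ?v1 y j)"
    by (rule sum_mono) (rule pt)
  then have "(\<Sum>j=1..n. ?v0 ?z j) + (\<Sum>j=1..n. ?v1 ?z j) - C3 / 2 * (Mb * \<tau> * D) * (\<Sum>j=1..n. (dot j ?z - a j)\<^sup>2) + m0 * (\<Sum>j=1..n. (dot j d)\<^sup>2)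
     \<le> (\<Sum>j=1..n. ?v0 x j) + (\<Sum>j=1..n. ?v1 y j)"
    unfolding sum.distrib sum_subtractf sum_distrib_left[symmetric] .
  moreover have "C3 / 2 * (Mb * \<tau> * D) * (\<Sum>j=1..n. (dot j ?z - a j)\<^sup>2) \<le> C3 / 2 * (Mb * \<tau> * D) * (Cb * N)"
  proof (rule mult_left_mono)
    have "(\<Sum>j=1..n. (dot j ?z - a j)\<^sup>2) = (\<Sum>j=1..n. (dot j (\<lambda>k. ?z k - \<theta>h k))\<^sup>2)" by (simp only: dot_diff a_def)
    then show "(\<Sum>j=1..n. (dot j ?z - a j)\<^sup>2) \<le> Cb * N" unfolding N_def using dot_sum[of "\<lambda>k. ?z k - \<theta>h k"] by simp
    show "0 \<le> C3 / 2 * (Mb * \<tau> * D)" using pos D0 by auto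
  qed
  moreover have "C3 / 2 * (Mb * \<tau> * D) * (Cb * N) \<le> 2 * b * \<tau>\<^sup>2 * N\<^sup>2 + a0 * D\<^sup>2"
  proof -
    \<comment> \<open>Chosen so that the cross term is \<open>2 * (P * D)\<close>. The 1/16 in its
      square, together with the target \<open>2 * b\<close>, explains the 32 in
      \<open>b_ge\<close>.\<close>
    define P where "P = C3 * Cb * Mb / 4 * (\<tau> * N)"
    have "C3 / 2 * (Mb * \<tau> * D) * (Cb * N) = 2 * (P * D)" unfolding P_def by simp
    also have "\<dots> \<le> P\<^sup>2 / a0 + a0 * D\<^sup>2" by (rule amgm_param[OF pos(1)])
    also have "P\<^sup>2 / a0 \<le> 2 * b * \<tau>\<^sup>2 * N\<^sup>2"
    proof -
      have "P\<^sup>2 = (C3 * Cb * Mb)\<^sup>2 / 16 * (\<tau> * N)\<^sup>2" unfolding P_def power_mult_distrib power_divide by simp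
      also have "\<dots> \<le> (32 * a0 * b) / 16 * (\<tau> * N)\<^sup>2" using b_ge by (intro mult_right_mono divide_right_mono) auto
      also have "\<dots> = a0 * (2 * b * \<tau>\<^sup>2 * N\<^sup>2)" by (simp add: power_mult_distrib)
      finally show ?thesis using pos by (simp add: pos_divide_le_eq mult.commute)
    qed
    finally show ?thesis by simp
  qed
  moreover have "a0 * D\<^sup>2 \<le> m0 * (\<Sum>j=1..n. (dot j d)\<^sup>2) + (\<Sum>k=1..p. G k * (d k)\<^sup>2)"
  proof -
    have "a0 * D\<^sup>2 \<le> a0 * (\<Sum>k=1..p. W k * (d k)\<^sup>2)"
      unfolding D2 using pos w_le_W by (intro mult_left_mono sum_mono mult_right_mono) auto
    then show ?thesis using coercive[of d] by linarith
  qed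
  moreover have "V0 x + V1 y = (\<Sum>j=1..n. ?v0 x j) + (\<Sum>j=1..n. ?v1 y j) + (\<Sum>k=1..p. G k * (?z k - \<theta>h k)\<^sup>2) + (\<Sum>k=1..p. G k * (d k)\<^sup>2)"
    unfolding V0_def V1_def sum_distrib_left[symmetric] distrib_left using Gterm by linarith
  moreover have "V0 ?z + V1 ?z = (\<Sum>j=1..n. ?v0 ?z j) + (\<Sum>j=1..n. ?v1 ?z j) + (\<Sum>k=1..p. G k * (?z k - \<theta>h k)\<^sup>2)"
    unfolding V0_def V1_def sum_distrib_left[symmetric] distrib_left by linarith
  ultimately show ?thesis unfolding N_def[symmetric] by linarith
qed

sublocale pair: laplace_pair "{1..p}" w W \<theta>h V0 V1 a0 b \<kappa> \<tau>
proof
  show "V0 \<in> borel_measurable M" "V1 \<in> borel_measurable M" by (rule V0_meas V1_meas)+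
qed (use p1 pos small w_pos w_le_W V_int V0_refl V0_par V1_conv V_loc in auto)

theorem total_variation_bound:
  assumes "pair.t \<le> 1" "10 * pair.K * pair.t \<le> 1"
  shows "total_variation (gibbs p F) (laplace_approx p F \<theta>h) \<le> pair.K * pair.t"
  unfolding total_variation_def gibbs_F laplace_approx_eq
proof (rule cSUP_least)
  show "sets (gibbs p V1) \<noteq> {}" by auto
  fix A assume "A \<in> sets (gibbs p V1)"
  then have A: "A \<in> sets M" by (simp add: gibbs_def)
  have "measure (gibbs p V1) A = pair.mass V1 A / pair.Z1"
    unfolding pair.mass_def pair.Z1_def using V_int A pair.Z_pos(2)[unfolded pair.Z1_def] by (intro measure_gibbs) auto
  moreover have "measure (gibbs p V0) A = pair.mass V0 A / pair.Z0"
    unfolding pair.mass_def pair.Z0_def using V_int A pair.Z_pos(1)[unfolded pair.Z0_def] by (intro measure_gibbs) auto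
  ultimately show "\<bar>measure (gibbs p V1) A - measure (gibbs p V0) A\<bar> \<le> pair.K * pair.t"
    using pair.TV_bound[OF assms A] by simp
qed

end

section \<open>The inverse problem\<close>

text \<open>Weighted Cauchy-Schwarz. For
  \<open>c k = n + k powr (2 * \<gamma>0 + 2 * \<beta>)\<close> the sum of the reciprocals is the
  square of \<open>S_tau\<close>, which yields \<open>dot_bound\<close>.\<close>

lemma linear_form_bound:
  fixes e c \<psi> d :: "nat \<Rightarrow> real"
  assumes "\<And>k. k \<in> I \<Longrightarrow> 0 < e k" "\<And>k. k \<in> I \<Longrightarrow> 0 < c k" "\<And>k. k \<in> I \<Longrightarrow> \<bar>\<psi> k\<bar> \<le> B"
  shows "(\<Sum>k\<in>I. sqrt (e k) * \<psi> k * d k)\<^sup>2 \<le> B\<^sup>2 * (\<Sum>k\<in>I. 1 / c k) * (\<Sum>k\<in>I. e k * c k * (d k)\<^sup>2)"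
proof -
  have "(\<Sum>k\<in>I. sqrt (e k) * \<psi> k * d k) = (\<Sum>k\<in>I. (\<psi> k / sqrt (c k)) * (sqrt (e k * c k) * d k))"
  proof (rule sum.cong[OF refl])
    fix k assume "k \<in> I"
    then have "sqrt (c k) \<noteq> 0" using assms(2)[of k] by simp
    then show "sqrt (e k) * \<psi> k * d k = (\<psi> k / sqrt (c k)) * (sqrt (e k * c k) * d k)" by (simp add: real_sqrt_mult)
  qed
  then have "(\<Sum>k\<in>I. sqrt (e k) * \<psi> k * d k)\<^sup>2 \<le> (\<Sum>k\<in>I. (\<psi> k / sqrt (c k))\<^sup>2) * (\<Sum>k\<in>I. (sqrt (e k * c k) * d k)\<^sup>2)"
    by (simp only: Cauchy_Schwarz_ineq_sum)
  also have "(\<Sum>k\<in>I. (sqrt (e k * c k) * d k)\<^sup>2) = (\<Sum>k\<in>I. e k * c k * (d k)\<^sup>2)"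
    using assms(1,2) by (intro sum.cong refl) (simp add: power_mult_distrib less_imp_le)
  also have "(\<Sum>k\<in>I. (\<psi> k / sqrt (c k))\<^sup>2) * (\<Sum>k\<in>I. e k * c k * (d k)\<^sup>2) \<le> (\<Sum>k\<in>I. B\<^sup>2 * (1 / c k)) * (\<Sum>k\<in>I. e k * c k * (d k)\<^sup>2)"
  proof (intro mult_right_mono sum_mono sum_nonneg)
    fix k assume k: "k \<in> I"
    have "(\<psi> k)\<^sup>2 \<le> B\<^sup>2" using assms(3)[OF k] by (meson abs_ge_zero abs_le_square_iff order_trans abs_ge_self)
    then show "(\<psi> k / sqrt (c k))\<^sup>2 \<le> B\<^sup>2 * (1 / c k)"
      using assms(2)[OF k] by (simp add: power_divide divide_right_mono)
    show "0 \<le> e k * c k * (d k)\<^sup>2" using assms(1,2)[OF k] by (simp add: less_imp_le)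
  qed
  finally show ?thesis by (simp add: sum_distrib_left)
qed

lemma quad_form_Psi_mat:
  "quad_form p (\<lambda>k l. Psi_mat \<psi> n k l - real n * id_mat k l) u
     = (\<Sum>j=1..n. (\<Sum>k=1..p. \<psi> k (real j / real n) * u k)\<^sup>2) - real n * (\<Sum>k=1..p. (u k)\<^sup>2)"
proof -
  have "quad_form p (\<lambda>k l. Psi_mat \<psi> n k l - real n * id_mat k l) u
     = (\<Sum>k=1..p. \<Sum>l=1..p. \<Sum>j=1..n. (\<psi> k (real j / real n) * u k) * (\<psi> l (real j / real n) * u l))
       - (\<Sum>k=1..p. \<Sum>l=1..p. u k * (real n * id_mat k l) * u l)"
    unfolding quad_form_def Psi_mat_def
    by (simp add: sum_subtractf left_diff_distrib right_diff_distrib sum_distrib_left sum_distrib_right ac_simps)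
  also have "(\<Sum>k=1..p. \<Sum>l=1..p. u k * (real n * id_mat k l) * u l) = real n * (\<Sum>k=1..p. (u k)\<^sup>2)"
  proof -
    have "(\<Sum>l=1..p. u k * (real n * id_mat k l) * u l) = real n * (u k)\<^sup>2" if "k \<in> {1..p}" for k
    proof -
      have "(\<Sum>l=1..p. u k * (real n * id_mat k l) * u l) = real n * u k * (\<Sum>l=1..p. id_mat k l * u l)"
        by (simp add: sum_distrib_left ac_simps)
      then show ?thesis using id_mat_sum(1)[OF that, of u] by (simp add: power2_eq_square)
    qed
    then show ?thesis by (simp add: sum_distrib_left)
  qed
  also have "(\<Sum>k=1..p. \<Sum>l=1..p. \<Sum>j=1..n. (\<psi> k (real j / real n) * u k) * (\<psi> l (real j / real n) * u l))
      = (\<Sum>k=1..p. \<Sum>j=1..n. \<Sum>l=1..p. (\<psi> k (real j / real n) * u k) * (\<psi> l (real j / real n) * u l))"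
    by (intro sum.cong refl sum.swap)
  also have "\<dots> = (\<Sum>j=1..n. \<Sum>k=1..p. \<Sum>l=1..p. (\<psi> k (real j / real n) * u k) * (\<psi> l (real j / real n) * u l))"
    by (rule sum.swap)
  also have "\<dots> = (\<Sum>j=1..n. (\<Sum>k=1..p. \<psi> k (real j / real n) * u k)\<^sup>2)"
    unfolding power2_eq_square sum_product ..
  finally show ?thesis .
qed

lemma exp_family_derivs:
  assumes "exp_family \<Y> \<mu>"
  defines "h \<equiv> log_partition \<mu>"
  shows "(h has_real_derivative deriv h s) (at s)"
    "(deriv h has_real_derivative deriv (deriv h) s) (at s)"
    "(deriv (deriv h) has_real_derivative deriv (deriv (deriv h)) s) (at s)"
    "isCont (deriv (deriv (deriv h))) s" "0 < deriv (deriv h) s"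
proof -
  have d: "(deriv ^^ m) h differentiable (at s)" for m s
    using assms unfolding exp_family_def by auto
  have D: "((deriv ^^ m) h has_real_derivative deriv ((deriv ^^ m) h) s) (at s)" for m s
    using d[of m s] by (simp add: DERIV_deriv_iff_real_differentiable)
  show "(h has_real_derivative deriv h s) (at s)" using D[of 0 s] by simp
  show "(deriv h has_real_derivative deriv (deriv h) s) (at s)" using D[of 1 s] by simp
  show "(deriv (deriv h) has_real_derivative deriv (deriv (deriv h)) s) (at s)" using D[of 2 s] by (simp add: eval_nat_numeral)
  show "isCont (deriv (deriv (deriv h))) s" using DERIV_isCont[OF D[of 3 s]] by (simp add: eval_nat_numeral)
  show "0 < deriv (deriv h) s" using assms unfolding exp_family_def by (simp add: eval_nat_numeral)
qed

theorem theorem3p7: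
  fixes E :: "(real \<Rightarrow> real) set"
    and R Rt :: "(real \<Rightarrow> real) \<Rightarrow> real \<Rightarrow> real"
    and \<phi> :: "nat \<Rightarrow> real \<Rightarrow> real"
    and ev :: "nat \<Rightarrow> real"
    and \<beta> c' C' \<gamma> lam K0 C0 :: real
    and \<Y> :: "real set"
    and \<mu> :: "real measure"
  assumes "L2_subspace E"
    and "compact_operator E R"
    and "adjoint_operator E R Rt"
    and "complete_orthonormal_basis E \<phi>"
    and eigen: "\<And>k. k \<ge> 1 \<Longrightarrow> AE t in I01. Rt (R (\<phi> k)) t = ev k * \<phi> k t"
    and "\<And>k l. 1 \<le> k \<Longrightarrow> k \<le> l \<Longrightarrow> ev l \<le> ev k"
    and "\<And>k. k \<ge> 1 \<Longrightarrow> ev k > 0"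
    and "0 < c'" and "c' < C'" and "\<beta> \<ge> 0"
    and "\<And>k. k \<ge> 1 \<Longrightarrow> c' * real k powr (-2 * \<beta>) \<le> ev k \<and> ev k \<le> C' * real k powr (-2 * \<beta>)"
    and pointwise: "\<And>p \<theta> t. p \<ge> 1 \<Longrightarrow> t \<in> {0..1} \<Longrightarrow> R (qfun \<phi> p \<theta>) t = (\<Sum>k=1..p. \<theta> k * R (\<phi> k) t)"
    and "exp_family \<Y> \<mu>"
    and "\<gamma> \<ge> 0"
    and i: "(SUP k\<in>{1..}. supnorm (psi R \<phi> ev k)) < \<infinity>"
    and "K0 > 0"
    and ii: "\<And>n p u. n \<ge> 1 \<Longrightarrow> p \<ge> 1 \<Longrightarrow>
        \<bar>quad_form p (\<lambda>k l. Psi_mat (psi R \<phi> ev) n k l - real n * id_mat k l) u\<bar>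
          \<le> K0 * (\<Sum>k=1..p. real k powr lam * (u k)\<^sup>2)"
  shows "\<exists>c>0. \<exists>K>0. \<forall>n\<ge>1. \<forall>p\<ge>1. \<forall>Y \<theta>h \<gamma>0.
     let f = neg_log_post (log_partition \<mu>) (design R \<phi> n) \<gamma> n p Y in
       (\<forall>j\<in>{1..n}. Y j \<in> \<Y>) \<longrightarrow>
       is_arg_min f (\<lambda>\<theta>. \<theta> \<in> space (lborel_vec p)) \<theta>h \<longrightarrow>
       supnorm (R (qfun \<phi> p \<theta>h)) \<le> ereal C0 \<longrightarrow>
       \<gamma>0 \<le> \<gamma> \<longrightarrow> 2 * \<gamma>0 + 2 * \<beta> \<ge> lam \<longrightarrow>
       S_tau \<beta> n p \<gamma>0 * S_p \<beta> \<gamma> n p \<gamma>0 \<le> c \<longrightarrow>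
       total_variation (gibbs p f) (laplace_approx p f \<theta>h)
         \<le> K * (S_tau \<beta> n p \<gamma>0 * S_p \<beta> \<gamma> n p \<gamma>0)"
proof -
  note ev_pos = assms(7)
  note ev_bounds = assms(11)
  define h where "h = log_partition \<mu>"
  note hd = exp_family_derivs[OF \<open>exp_family \<Y> \<mu>\<close>, folded h_def]
  define \<psi> where "\<psi> = psi R \<phi> ev"
  obtain Mb where Mb: "0 \<le> Mb" "\<And>k t. 1 \<le> k \<Longrightarrow> t \<in> {0..1} \<Longrightarrow> \<bar>\<psi> k t\<bar> \<le> Mb"
  proof -
    let ?s = "SUP k\<in>{1..}. supnorm (psi R \<phi> ev k)"
    have le: "ereal \<bar>\<psi> k t\<bar> \<le> ?s" if "1 \<le> k" "t \<in> {0..1}" for k t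
    proof -
      have "ereal \<bar>\<psi> k t\<bar> \<le> supnorm (psi R \<phi> ev k)" unfolding supnorm_def \<psi>_def by (rule SUP_upper[OF that(2)])
      also have "\<dots> \<le> ?s" by (rule SUP_upper) (use that in auto)
      finally show ?thesis .
    qed
    obtain s where s: "?s = ereal s" using le[of 1 0] i by (cases ?s) auto
    show ?thesis
    proof (rule that)
      show "0 \<le> max 0 s" by simp
      show "\<bar>\<psi> k t\<bar> \<le> max 0 s" if "1 \<le> k" "t \<in> {0..1}" for k t using le[OF that] unfolding s by simp
    qed
  qed
  \<comment> \<open>The absolute value keeps \<open>J\<close> nonempty for negative
    \<open>C0\<close> as well.\<close>
  define J where "J = {- (\<bar>C0\<bar> + 1)..\<bar>C0\<bar> + 1}"
  have J: "compact J" "J \<noteq> {}" "\<And>s. \<bar>s\<bar> \<le> C0 + 1 \<Longrightarrow> s \<in> J" unfolding J_def by (auto simp: abs_le_iff)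
  obtain m where m: "0 < m" "\<And>s. s \<in> J \<Longrightarrow> m \<le> deriv (deriv h) s"
  proof -
    have "continuous_on J (deriv (deriv h))"
      by (intro continuous_at_imp_continuous_on ballI DERIV_isCont[OF hd(3)])
    from continuous_attains_inf[OF J(1,2) this] show ?thesis using that hd(5) by blast
  qed
  obtain C3 where C3: "0 \<le> C3" "\<And>s. s \<in> J \<Longrightarrow> \<bar>deriv (deriv (deriv h)) s\<bar> \<le> C3"
  proof -
    have "continuous_on J (\<lambda>s. \<bar>deriv (deriv (deriv h)) s\<bar>)"
      by (intro continuous_at_imp_continuous_on ballI continuous_intros hd(4))
    from continuous_attains_sup[OF J(1,2) this] show ?thesis using that by (meson abs_ge_zero order_trans)
  qed
  have C'_pos: "0 < C'" using \<open>0 < c'\<close> \<open>c' < C'\<close> by simp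
  \<comment> \<open>The Gram matrix may fall short of \<open>n\<close> by
    \<open>K0 * k powr lam\<close>, a deficit that the penalty has to pay for in
    \<open>coercive\<close>. With \<open>m0\<close> this small the deficit uses at most half of the
    penalty; the other half is left for \<open>a0\<close>.\<close>
  define m0 where "m0 = min m (1 / (2 * C' * K0))"
  define a0 where "a0 = min m0 (1 / (2 * C'))"
  \<comment> \<open>What \<open>b_ge\<close> asks for, plus 1 to stay positive when the square
    vanishes.\<close>
  define b where "b = (C3 * (1 + K0) * Mb)\<^sup>2 / (32 * a0) + 1"
  \<comment> \<open>The first entry serves \<open>small\<close>; the second serves
    \<open>radius\<close>, given \<open>\<tau> \<le> 1\<close>.\<close>
  define \<kappa> where "\<kappa> = min (1 / (9 * (b + 1))) (1 / (9 * (Mb\<^sup>2 + 1)))"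
  have m0: "0 < m0" "m0 \<le> m" "m0 * K0 \<le> 1 / (2 * C')"
  proof -
    show "0 < m0" "m0 \<le> m" unfolding m0_def using m C'_pos \<open>0 < K0\<close> by auto
    have "m0 * K0 \<le> 1 / (2 * C' * K0) * K0" unfolding m0_def using \<open>0 < K0\<close> by (intro mult_right_mono) auto
    then show "m0 * K0 \<le> 1 / (2 * C')" using \<open>0 < K0\<close> by simp
  qed
  have a0: "0 < a0" "a0 \<le> m0" "a0 \<le> 1 / (2 * C')" unfolding a0_def using m0 C'_pos by auto
  have b: "0 < b" "(C3 * (1 + K0) * Mb)\<^sup>2 \<le> 32 * a0 * b"
  proof -
    have "0 \<le> (C3 * (1 + K0) * Mb)\<^sup>2 / (32 * a0)" using a0 by simp
    then show "0 < b" unfolding b_def by linarith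
    have "32 * a0 * b = (C3 * (1 + K0) * Mb)\<^sup>2 + 32 * a0" unfolding b_def using a0 by (simp add: field_simps)
    then show "(C3 * (1 + K0) * Mb)\<^sup>2 \<le> 32 * a0 * b" using a0 by simp
  qed
  have Mb1: "0 < Mb\<^sup>2 + 1" by (simp add: add_nonneg_pos)
  have \<kappa>: "0 < \<kappa>" "81 * b * \<kappa>\<^sup>2 \<le> 1" "9 * Mb\<^sup>2 * \<kappa> \<le> 1"
  proof -
    show k0: "0 < \<kappa>" unfolding \<kappa>_def using b Mb1 by auto
    have "\<kappa>\<^sup>2 \<le> (1 / (9 * (b + 1)))\<^sup>2" using k0 by (intro power_mono) (auto simp: \<kappa>_def)
    then have "81 * b * \<kappa>\<^sup>2 \<le> 81 * b * (1 / (9 * (b + 1)))\<^sup>2" using b by (intro mult_left_mono) auto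
    also have "\<dots> = b / (b + 1)\<^sup>2" unfolding power_divide power_mult_distrib by simp
    also have "\<dots> \<le> 1"
    proof -
      have "b \<le> (b + 1)\<^sup>2" using b(1) zero_le_power2[of b] unfolding power2_sum by simp
      then show ?thesis using b(1) by simp
    qed
    finally show "81 * b * \<kappa>\<^sup>2 \<le> 1" .
    have "9 * Mb\<^sup>2 * \<kappa> \<le> 9 * Mb\<^sup>2 * (1 / (9 * (Mb\<^sup>2 + 1)))" by (intro mult_left_mono) (auto simp: \<kappa>_def)
    also have "\<dots> \<le> 1" using Mb1 by (simp add: field_simps)
    finally show "9 * Mb\<^sup>2 * \<kappa> \<le> 1" .
  qed
  \<comment> \<open>This constant of the locale depends on \<open>a0\<close>, \<open>b\<close> and
    \<open>\<kappa>\<close> alone, so it can be named before \<open>n\<close>, \<open>p\<close> and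
    the data are fixed.\<close>
  define K where "K = laplace_pair.K a0 b \<kappa>"
  define c where "c = min 1 (1 / (10 * max 1 K))"
  have c1: "c \<le> 1" and c2: "c \<le> 1 / (10 * max 1 K)" unfolding c_def by (rule min.cobounded1 min.cobounded2)+
  have main: "total_variation (gibbs p f) (laplace_approx p f \<theta>h) \<le> K * (S_tau \<beta> n p \<gamma>0 * S_p \<beta> \<gamma> n p \<gamma>0) \<and> 0 < K"
    if n: "1 \<le> n" and p: "1 \<le> p" and f: "f = neg_log_post h (design R \<phi> n) \<gamma> n p Y"
      and min: "is_arg_min f (\<lambda>\<theta>. \<theta> \<in> space (lborel_vec p)) \<theta>h"
      and C0: "supnorm (R (qfun \<phi> p \<theta>h)) \<le> ereal C0"
      and g: "\<gamma>0 \<le> \<gamma>" "2 * \<gamma>0 + 2 * \<beta> \<ge> lam"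
      and t: "S_tau \<beta> n p \<gamma>0 * S_p \<beta> \<gamma> n p \<gamma>0 \<le> c"
    for n p Y \<theta>h \<gamma>0 f
  proof -
    define u where "u k = real n + real k powr (2 * \<gamma>0 + 2 * \<beta>)" for k
    define v where "v k = real n + real k powr (2 * \<gamma> + 2 * \<beta>)" for k
    \<comment> \<open>The factor \<open>ev k\<close> turns coefficients with respect to
      \<open>\<phi> k\<close> into coefficients with respect to \<open>\<psi> k\<close>; it cancels
      in \<open>w k / W k\<close>.\<close>
    define w where "w k = ev k * u k" for k
    define W where "W k = ev k * v k" for k
    define \<tau> where "\<tau> = S_tau \<beta> n p \<gamma>0"
    have u_pos: "0 < u k" for k unfolding u_def using n by (simp add: add_pos_nonneg)
    have uv: "u k \<le> v k" if "1 \<le> k" for k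
      unfolding u_def v_def using that g by (auto intro!: powr_mono)
    have v_pos: "0 < v k" for k unfolding v_def using n by (simp add: add_pos_nonneg)
    have \<tau>2: "\<tau>\<^sup>2 = (\<Sum>k=1..p. 1 / u k)"
      unfolding \<tau>_def S_tau_def u_def[symmetric] using u_pos by (intro real_sqrt_pow2 sum_nonneg) (auto simp: less_imp_le)
    have \<tau>_pos: "0 < \<tau>"
      unfolding \<tau>_def S_tau_def u_def[symmetric] using u_pos p by (auto intro!: sum_pos)
    have S_eq: "(\<Sum>k=1..p. w k / W k) = S_p \<beta> \<gamma> n p \<gamma>0"
      unfolding S_p_def u_def[symmetric] v_def[symmetric] w_def W_def
      using ev_pos by (intro sum.cong refl) (simp add: less_imp_neq[symmetric])
    \<comment> \<open>The summand for \<open>k = 1\<close> equals 1 whatever the exponents are, so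
      \<open>\<tau>\<close> is at most the product and hence at most 1.\<close>
    have S1: "1 \<le> S_p \<beta> \<gamma> n p \<gamma>0"
    proof -
      have "1 = u 1 / v 1" unfolding u_def v_def using n by simp
      also have "\<dots> \<le> (\<Sum>k=1..p. u k / v k)"
        using p u_pos v_pos by (intro member_le_sum) (auto simp: less_imp_le)
      finally show ?thesis unfolding S_p_def u_def v_def .
    qed
    have t1: "\<tau> * S_p \<beta> \<gamma> n p \<gamma>0 \<le> 1" using order_trans[OF t c1] unfolding \<tau>_def .
    have \<tau>1: "\<tau> \<le> 1"
    proof -
      have "\<tau> * 1 \<le> \<tau> * S_p \<beta> \<gamma> n p \<gamma>0" using \<tau>_pos by (intro mult_left_mono S1) simp
      then show ?thesis using t1 by simp
    qed
    interpret glm h "deriv h" "deriv (deriv h)" "deriv (deriv (deriv h))" "design R \<phi> n" \<gamma> n p Y \<theta>h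
      by standard (use hd \<open>0 \<le> \<gamma>\<close> min f in auto)
    have tj: "real j / real n \<in> {0..1}" if "j \<in> {1..n}" for j using that n by auto
    have X: "design R \<phi> n j k = sqrt (ev k) * \<psi> k (real j / real n)" if "k \<in> {1..p}" for j k
      unfolding design_def \<psi>_def psi_def using ev_pos[of k] that by simp
    have dot_psi: "dot j d = (\<Sum>k=1..p. sqrt (ev k) * \<psi> k (real j / real n) * d k)" for j d
      unfolding dot_def using X by (intro sum.cong refl) simp
    have dot_psi': "dot j d = (\<Sum>k=1..p. \<psi> k (real j / real n) * (sqrt (ev k) * d k))" for j d
      unfolding dot_psi by (intro sum.cong refl) simp
    have gram: "\<bar>(\<Sum>j=1..n. (dot j d)\<^sup>2) - real n * (\<Sum>k=1..p. ev k * (d k)\<^sup>2)\<bar> \<le> K0 * (\<Sum>k=1..p. real k powr (2 * \<gamma>0 + 2 * \<beta>) * (ev k * (d k)\<^sup>2))" for d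
    proof -
      have sq: "(sqrt (ev k) * d k)\<^sup>2 = ev k * (d k)\<^sup>2" if "k \<in> {1..p}" for k
        using ev_pos[of k] that by (simp add: power_mult_distrib less_imp_le)
      \<comment> \<open>At the vector \<open>sqrt (ev k) * d k\<close>, hypothesis (ii) becomes a
        statement on the Gram matrix of the design.\<close>
      have "\<bar>(\<Sum>j=1..n. (dot j d)\<^sup>2) - real n * (\<Sum>k=1..p. (sqrt (ev k) * d k)\<^sup>2)\<bar> \<le> K0 * (\<Sum>k=1..p. real k powr lam * (sqrt (ev k) * d k)\<^sup>2)"
        using ii[OF n p, of "\<lambda>k. sqrt (ev k) * d k"] unfolding quad_form_Psi_mat \<psi>_def[symmetric] dot_psi' .
      also have "\<dots> \<le> K0 * (\<Sum>k=1..p. real k powr (2 * \<gamma>0 + 2 * \<beta>) * (sqrt (ev k) * d k)\<^sup>2)"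
        using \<open>0 < K0\<close> g by (intro mult_left_mono sum_mono mult_right_mono powr_mono) auto
      finally have *: "\<bar>(\<Sum>j=1..n. (dot j d)\<^sup>2) - real n * (\<Sum>k=1..p. (sqrt (ev k) * d k)\<^sup>2)\<bar> \<le> \<dots>" .
      have s1: "(\<Sum>k=1..p. (sqrt (ev k) * d k)\<^sup>2) = (\<Sum>k=1..p. ev k * (d k)\<^sup>2)"
        by (intro sum.cong refl sq)
      have s2: "(\<Sum>k=1..p. real k powr (2 * \<gamma>0 + 2 * \<beta>) * (sqrt (ev k) * d k)\<^sup>2) = (\<Sum>k=1..p. real k powr (2 * \<gamma>0 + 2 * \<beta>) * (ev k * (d k)\<^sup>2))"
        by (intro sum.cong refl arg_cong2[where f="(*)"] sq)
      show ?thesis using * unfolding s1 s2 .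
    qed
    have w_sum: "(\<Sum>k=1..p. w k * (d k)\<^sup>2) = real n * (\<Sum>k=1..p. ev k * (d k)\<^sup>2) + (\<Sum>k=1..p. real k powr (2 * \<gamma>0 + 2 * \<beta>) * (ev k * (d k)\<^sup>2))" for d
      unfolding w_def u_def sum_distrib_left sum.distrib[symmetric] by (intro sum.cong refl) (simp add: algebra_simps)
    have W_sum: "(\<Sum>k=1..p. W k * (d k)\<^sup>2) = real n * (\<Sum>k=1..p. ev k * (d k)\<^sup>2) + (\<Sum>k=1..p. real k powr (2 * \<gamma> + 2 * \<beta>) * (ev k * (d k)\<^sup>2))" for d
      unfolding W_def v_def sum_distrib_left sum.distrib[symmetric] by (intro sum.cong refl) (simp add: algebra_simps)
    have e_nn: "0 \<le> (\<Sum>k=1..p. ev k * (d k)\<^sup>2)" "0 \<le> (\<Sum>k=1..p. real k powr q * (ev k * (d k)\<^sup>2))" for d q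
      using ev_pos by (auto intro!: sum_nonneg simp: less_imp_le)
    interpret glm_bounds h "deriv h" "deriv (deriv h)" "deriv (deriv (deriv h))" "design R \<phi> n" \<gamma> n p Y \<theta>h
      w W m0 C3 C0 Mb "1 + K0" a0 b \<tau> \<kappa>
    proof
      show "1 \<le> p" by (rule p)
      show "0 < w k" "w k \<le> W k" if "k \<in> {1..p}" for k
        unfolding w_def W_def using that ev_pos[of k] u_pos uv[of k] by auto
      show "0 < a0" "0 < b" "0 < \<tau>" "0 < \<kappa>" "0 \<le> C3" "0 \<le> 1 + K0" "0 \<le> Mb" "0 \<le> m0"
        using a0 b \<tau>_pos \<kappa> C3 \<open>0 < K0\<close> Mb m0 by auto
      show "\<bar>a j\<bar> \<le> C0" if j: "j \<in> {1..n}" for j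
      proof -
        \<comment> \<open>Evaluation at a design point relies on \<open>pointwise\<close>: linearity
          of \<open>R\<close> in \<open>L2\<close> alone holds only almost everywhere.\<close>
        have "R (qfun \<phi> p \<theta>h) (real j / real n) = a j"
          unfolding pointwise[OF p tj[OF j]] a_def dot_def design_def by (simp add: mult.commute)
        then have "ereal \<bar>a j\<bar> \<le> supnorm (R (qfun \<phi> p \<theta>h))"
          unfolding supnorm_def using SUP_upper[OF tj[OF j], of "\<lambda>t. ereal \<bar>R (qfun \<phi> p \<theta>h) t\<bar>"] by simp
        then show ?thesis using C0 by (meson ereal_less_eq(3) order_trans)
      qed
      show "m0 \<le> deriv (deriv h) s" if "\<bar>s\<bar> \<le> C0 + 1" for s using m(2)[OF J(3)[OF that]] m0(2) by simp
      show "\<bar>deriv (deriv (deriv h)) s\<bar> \<le> C3" if "\<bar>s\<bar> \<le> C0 + 1" for s by (rule C3(2)[OF J(3)[OF that]])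
      show "(dot j d)\<^sup>2 \<le> Mb\<^sup>2 * \<tau>\<^sup>2 * (\<Sum>k=1..p. w k * (d k)\<^sup>2)" if j: "j \<in> {1..n}" for j d
        unfolding dot_psi \<tau>2 w_def using ev_pos u_pos Mb(2)[OF _ tj[OF j]] by (intro linear_form_bound) auto
      show "(\<Sum>j=1..n. (dot j d)\<^sup>2) \<le> (1 + K0) * (\<Sum>k=1..p. w k * (d k)\<^sup>2)" for d
      proof -
        let ?A = "real n * (\<Sum>k=1..p. ev k * (d k)\<^sup>2)" and ?B = "\<Sum>k=1..p. real k powr (2 * \<gamma>0 + 2 * \<beta>) * (ev k * (d k)\<^sup>2)"
        have "(\<Sum>j=1..n. (dot j d)\<^sup>2) \<le> ?A + K0 * ?B" using gram[of d] by linarith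
        also have "\<dots> \<le> (1 + K0) * (?A + ?B)"
          using e_nn(1)[of d] e_nn(2)[where d=d and q="2 * \<gamma>0 + 2 * \<beta>"] \<open>0 < K0\<close> by (simp add: algebra_simps)
        finally show ?thesis unfolding w_sum .
      qed
      show "a0 * (\<Sum>k=1..p. W k * (d k)\<^sup>2) \<le> m0 * (\<Sum>j=1..n. (dot j d)\<^sup>2) + (\<Sum>k=1..p. G k * (d k)\<^sup>2)" for d
      proof -
        let ?A = "real n * (\<Sum>k=1..p. ev k * (d k)\<^sup>2)" and ?B = "\<Sum>k=1..p. real k powr (2 * \<gamma>0 + 2 * \<beta>) * (ev k * (d k)\<^sup>2)"
          and ?D = "\<Sum>k=1..p. real k powr (2 * \<gamma> + 2 * \<beta>) * (ev k * (d k)\<^sup>2)"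
        have BD: "?B \<le> ?D"
          using g ev_pos by (intro sum_mono mult_right_mono powr_mono) (auto simp: less_imp_le)
        have "m0 * (?A - K0 * ?B) \<le> m0 * (\<Sum>j=1..n. (dot j d)\<^sup>2)"
          using gram[of d] m0 by (intro mult_left_mono) linarith+
        then have 1: "m0 * ?A - m0 * K0 * ?B \<le> m0 * (\<Sum>j=1..n. (dot j d)\<^sup>2)" by (simp add: right_diff_distrib)
        have "m0 * K0 * ?B \<le> 1 / (2 * C') * ?D"
          using m0(3) BD e_nn(2) C'_pos by (intro mult_mono) auto
        \<comment> \<open>The upper eigenvalue bound enters here:
          \<open>ev k * k powr (2 * \<beta>) \<le> C'\<close> lets \<open>G k\<close> dominate
          \<open>ev k * k powr (2 * \<gamma> + 2 * \<beta>) / C'\<close>.\<close>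
        moreover have "1 / C' * ?D \<le> (\<Sum>k=1..p. G k * (d k)\<^sup>2)"
          unfolding sum_distrib_left
        proof (rule sum_mono)
          fix k assume k: "k \<in> {1..p}"
          have "ev k * real k powr (2 * \<beta>) \<le> C' * real k powr (- 2 * \<beta>) * real k powr (2 * \<beta>)"
            using ev_bounds[of k] k by (intro mult_right_mono) auto
          also have "\<dots> = C'" using k by (simp add: mult.assoc flip: powr_add)
          finally have "ev k * real k powr (2 * \<beta>) / C' \<le> 1" using C'_pos by simp
          then have "real k powr (2 * \<gamma>) * (d k)\<^sup>2 * (ev k * real k powr (2 * \<beta>) / C') \<le> real k powr (2 * \<gamma>) * (d k)\<^sup>2 * 1"
            by (intro mult_left_mono) auto
          then show "1 / C' * (real k powr (2 * \<gamma> + 2 * \<beta>) * (ev k * (d k)\<^sup>2)) \<le> G k * (d k)\<^sup>2"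
            unfolding G_def powr_add by (simp add: ac_simps)
        qed
        moreover have "1 / C' * ?D = 1 / (2 * C') * ?D + 1 / (2 * C') * ?D" by (simp add: field_simps)
        moreover have "a0 * ?A \<le> m0 * ?A" using a0 e_nn(1)[of d] by (intro mult_right_mono) auto
        moreover have "a0 * ?D \<le> 1 / (2 * C') * ?D" using a0 e_nn(2) by (intro mult_right_mono) auto
        ultimately have "a0 * ?A + a0 * ?D \<le> m0 * (\<Sum>j=1..n. (dot j d)\<^sup>2) + (\<Sum>k=1..p. G k * (d k)\<^sup>2)"
          using 1 by linarith
        then show ?thesis unfolding W_sum distrib_left .
      qed
      show "9 * Mb\<^sup>2 * \<kappa> * \<tau> \<le> 1"
        using mult_mono[OF \<kappa>(3) \<tau>1] \<tau>_pos by simp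
      show "(C3 * (1 + K0) * Mb)\<^sup>2 \<le> 32 * a0 * b" by (rule b(2))
      show "81 * b * \<kappa>\<^sup>2 \<le> 1" by (rule \<kappa>(2))
    qed
    have K: "pair.K = K" "0 < K" using pair.K_pos unfolding K_def by auto
    have pt: "pair.t = \<tau> * S_p \<beta> \<gamma> n p \<gamma>0" unfolding pair.t_def pair.S_def S_eq ..
    have "10 * K * (\<tau> * S_p \<beta> \<gamma> n p \<gamma>0) \<le> 10 * K * (1 / (10 * max 1 K))"
      using order_trans[OF t c2] K unfolding \<tau>_def by (intro mult_left_mono) auto
    also have "\<dots> \<le> 1" using K by (simp add: field_simps)
    finally have "10 * K * (\<tau> * S_p \<beta> \<gamma> n p \<gamma>0) \<le> 1" .
    then have "total_variation (gibbs p F) (laplace_approx p F \<theta>h) \<le> K * (\<tau> * S_p \<beta> \<gamma> n p \<gamma>0)"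
      using total_variation_bound t1 unfolding K pt by simp
    then show ?thesis using K unfolding f \<tau>_def by simp
  qed
  have c: "0 < c" unfolding c_def by simp
  show ?thesis
  proof (intro exI conjI allI impI)
    show "0 < c" by (rule c)
    \<comment> \<open>Positivity of \<open>K\<close> itself is available only inside an
      interpretation of the locale, hence the maximum with 1.\<close>
    show "0 < max 1 K" by simp
    fix n p Y \<theta>h \<gamma>0 assume n: "1 \<le> (n::nat)" and p: "1 \<le> (p::nat)"
    show "let f = neg_log_post (log_partition \<mu>) (design R \<phi> n) \<gamma> n p Y in
       (\<forall>j\<in>{1..n}. Y j \<in> \<Y>) \<longrightarrow>
       is_arg_min f (\<lambda>\<theta>. \<theta> \<in> space (lborel_vec p)) \<theta>h \<longrightarrow>
       supnorm (R (qfun \<phi> p \<theta>h)) \<le> ereal C0 \<longrightarrow>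
       \<gamma>0 \<le> \<gamma> \<longrightarrow> 2 * \<gamma>0 + 2 * \<beta> \<ge> lam \<longrightarrow>
       S_tau \<beta> n p \<gamma>0 * S_p \<beta> \<gamma> n p \<gamma>0 \<le> c \<longrightarrow>
       total_variation (gibbs p f) (laplace_approx p f \<theta>h)
         \<le> max 1 K * (S_tau \<beta> n p \<gamma>0 * S_p \<beta> \<gamma> n p \<gamma>0)"
      unfolding Let_def
    proof (intro impI)
      let ?f = "neg_log_post (log_partition \<mu>) (design R \<phi> n) \<gamma> n p Y"
      assume "is_arg_min ?f (\<lambda>\<theta>. \<theta> \<in> space (lborel_vec p)) \<theta>h" "supnorm (R (qfun \<phi> p \<theta>h)) \<le> ereal C0"
        "\<gamma>0 \<le> \<gamma>" "lam \<le> 2 * \<gamma>0 + 2 * \<beta>" "S_tau \<beta> n p \<gamma>0 * S_p \<beta> \<gamma> n p \<gamma>0 \<le> c"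
      from main[OF n p _ this] have "total_variation (gibbs p ?f) (laplace_approx p ?f \<theta>h) \<le> K * (S_tau \<beta> n p \<gamma>0 * S_p \<beta> \<gamma> n p \<gamma>0)"
        by (simp add: h_def)
      also have "\<dots> \<le> max 1 K * (S_tau \<beta> n p \<gamma>0 * S_p \<beta> \<gamma> n p \<gamma>0)"
      proof (rule mult_right_mono)
        show "0 \<le> S_tau \<beta> n p \<gamma>0 * S_p \<beta> \<gamma> n p \<gamma>0"
          unfolding S_tau_def S_p_def by (intro mult_nonneg_nonneg real_sqrt_ge_zero sum_nonneg) auto
      qed simp
      finally show "total_variation (gibbs p ?f) (laplace_approx p ?f \<theta>h) \<le> max 1 K * (S_tau \<beta> n p \<gamma>0 * S_p \<beta> \<gamma> n p \<gamma>0)" .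
    qed
  qed
qed

end
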